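(* Let $\mathsf H$ be a bounded heart in a triangulated category $\mathsf D$, and let $\lambda\colon K(\mathsf D)\to\Lambda$ be a homomorphism to a free abelian group of finite rank. Let $$\nabla_{\mathbb Z}(\mathsf H):=\bigcup_{\mathsf H[1]\ge\mathsf K\ge\mathsf H}\mathrm{Cofaces}(E(\mathsf K))=\{E(\mathsf K)-E(\mathsf S)\mid \mathsf H[1]\ge\mathsf K\ge\mathsf H,\ \mathsf S\text{ a face subcategory of }\mathsf K\},$$ $$\nabla_{\mathbb R}(\mathsf H):=\{\operatorname{conv}(\sigma)\mid\sigma\in\nabla_{\mathbb Z}(\mathsf H)\}=\{E(\mathsf K)_{\mathbb R}-E(\mathsf S)_{\mathbb R}\mid \mathsf H[1]\ge\mathsf K\ge\mathsf H,\ \mathsf S\text{ a face subcategory of }\mathsf K\},$$ where $\mathsf K$ runs over bounded hearts in $\mathsf D$. Then: (1) $\nabla_{\mathbb Z}(\mathsf H)$ is an (integral) cofan in $\Lambda$. (2) $\nabla_{\mathbb Z}(\mathsf H)$ does not depend on the ambient triangulated category $\mathsf D$: if $\mathsf H$ (with the same $\lambda\colon K(\mathsf H)\to\Lambda$) is also a bounded heart in another triangulated category, the resulting set of cones is the same. (3) If $\mathsf H$ is a length category then $\nabla_{\mathbb Z}(\mathsf H)$ is complete, i.e. for each $v\in\Lambda^*=\operatorname{Hom}(\Lambda,\mathbb Z)$ there is $\sigma\in\nabla_{\mathbb Z}(\mathsf H)$ with $v|_\sigma\ge0$. (4) $\nabla_{\mathbb R}(\mathsf H)$ is a real cofan in $\Lambda_{\mathbb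 R}=\Lambda\otimes\mathbb R$, namely the realification of $\nabla_{\mathbb Z}(\mathsf H)$ (the set of convex hulls of the cones of $\nabla_{\mathbb Z}(\mathsf H)$).
   Context: A bounded heart is the heart of a bounded t-structure; for a bounded heart $\mathsf K$ in $\mathsf D$, $K(\mathsf K)=K(\mathsf D)$ canonically; write $\lambda(k)=\lambda([k])$. Hearts are ordered by $\mathsf K\ge\mathsf H$ iff $\operatorname{Hom}_{\mathsf D}(\mathsf K[n],\mathsf H)=0$ for all $n>0$. Length means noetherian and artinian. An integral cone in $\Lambda$ is a submonoid of $\Lambda$ (contains $0$ and is closed under sums); a real cone in $\Lambda_{\mathbb R}$ is a non-empty subset closed under sums and non-negative real scalars. A face of a cone $\sigma$ is a non-empty subset $\tau\subseteq\sigma$ with $a+b\in\tau\iff a,b\in\tau$ for all $a,b\in\sigma$. Sums and differences of cones are Minkowski sums/differences. A coface of $\sigma$ is a cone $\sigma-\kappa$ for a subcone $\kappa\subseteq\sigma$ (equivalently for a face); $\mathrm{Cofaces}(\sigma)$ is the set of all of these. A cofan is a set $\nabla$ of cones such that (a) if $\tau$ is a face of $\sigma\in\nabla$ then $\sigma-\tau\in\nabla$; (b) if $\sigma,\sigma'\in\nabla$ then $\sigma+\sigma'=\sigma-\tau$ for some face $\tau$ of $\sigma$. (The same definition applies with integral cones in $\Lambda$, giving integral cofans, and with real cones in $\Lambda_{\mathbb R}$, giving real cofans.) For a subcategory $\mathsf S$ of a heart $\mathsf K$, $E(\mathsf S)\subseteq\Lambda$ is the integral cone generated by $\{\lambda(s)\mid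 s\in\mathsf S\}$ (non-negative integral combinations), and $E(\mathsf S)_{\mathbb R}\subseteq\Lambda_{\mathbb R}$ is its convex hull, i.e. the real cone generated. A face subcategory of $\mathsf K$ is a full subcategory of the form $\{k\in\mathsf K\mid\lambda(k)\in\tau\}$ for a face $\tau$ of $E(\mathsf K)$. *)

theory Defs
  imports "HOL-Analysis.Convex" "HOL-Algebra.Free_Abelian_Groups"
begin

section \<open>Additive categories\<close>

text \<open>
  A (small) category has a set \<open>Ob C\<close> of objects and pairwise disjoint hom-sets. Fields applied to
  arguments that are not objects, or not composable arrows, of \<open>C\<close> carry no meaning. Hence the full
  subcategory of \<open>C\<close> on a set \<open>S\<close> of objects is simply \<open>C\<lparr>Ob := S\<rparr>\<close>.
\<close>

record ('o, 'm) cat =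
  Ob :: "'o set"
  Hom :: "'o \<Rightarrow> 'o \<Rightarrow> 'm set"
  Comp :: "'m \<Rightarrow> 'm \<Rightarrow> 'm" (infixr "\<odot>\<index>" 75)
  Id :: "'o \<Rightarrow> 'm"

record ('o, 'm) add_cat = "('o, 'm) cat" +
  Add :: "'m \<Rightarrow> 'm \<Rightarrow> 'm" (infixl "\<boxplus>\<index>" 65)
  Zero :: "'o \<Rightarrow> 'o \<Rightarrow> 'm"

record ('o, 'm) tri_cat = "('o, 'm) add_cat" +
  ShO :: "'o \<Rightarrow> 'o"
  ShM :: "'m \<Rightarrow> 'm"
  Tri :: "'o \<Rightarrow> 'o \<Rightarrow> 'o \<Rightarrow> 'm \<Rightarrow> 'm \<Rightarrow> 'm \<Rightarrow> bool"

locale category =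
  fixes C :: "('o, 'm, 'z) cat_scheme" (structure)
  assumes hom_disjoint:
      "\<lbrakk>X \<in> Ob C; Y \<in> Ob C; X' \<in> Ob C; Y' \<in> Ob C; f \<in> Hom C X Y; f \<in> Hom C X' Y'\<rbrakk>
        \<Longrightarrow> X = X' \<and> Y = Y'"
    and id_in_hom: "X \<in> Ob C \<Longrightarrow> Id C X \<in> Hom C X X"
    and comp_in_hom:
      "\<lbrakk>X \<in> Ob C; Y \<in> Ob C; Z \<in> Ob C; f \<in> Hom C X Y; g \<in> Hom C Y Z\<rbrakk>
        \<Longrightarrow> g \<odot> f \<in> Hom C X Z"
    and id_left: "\<lbrakk>X \<in> Ob C; Y \<in> Ob C; f \<in> Hom C X Y\<rbrakk> \<Longrightarrow> Id C Y \<odot> f = f"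
    and id_right: "\<lbrakk>X \<in> Ob C; Y \<in> Ob C; f \<in> Hom C X Y\<rbrakk> \<Longrightarrow> f \<odot> Id C X = f"
    and comp_assoc:
      "\<lbrakk>W \<in> Ob C; X \<in> Ob C; Y \<in> Ob C; Z \<in> Ob C;
        f \<in> Hom C W X; g \<in> Hom C X Y; h \<in> Hom C Y Z\<rbrakk>
        \<Longrightarrow> (h \<odot> g) \<odot> f = h \<odot> (g \<odot> f)"

definition iso_arrow :: "('o, 'm, 'z) cat_scheme \<Rightarrow> 'o \<Rightarrow> 'o \<Rightarrow> 'm \<Rightarrow> bool" where
  "iso_arrow C X Y f \<longleftrightarrow> f \<in> Hom C X Y \<and>
     (\<exists>g \<in> Hom C Y X. Comp C g f = Id C X \<and> Comp C f g = Id C Y)"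

definition isomorphic_in :: "('o, 'm, 'z) cat_scheme \<Rightarrow> 'o \<Rightarrow> 'o \<Rightarrow> bool" where
  "isomorphic_in C X Y \<longleftrightarrow> (\<exists>f. iso_arrow C X Y f)"

definition zero_object :: "('o, 'm, 'z) cat_scheme \<Rightarrow> 'o \<Rightarrow> bool" where
  "zero_object C N \<longleftrightarrow> N \<in> Ob C \<and>
     (\<forall>X \<in> Ob C. (\<exists>!f. f \<in> Hom C X N) \<and> (\<exists>!f. f \<in> Hom C N X))"

definition hom_group :: "('o, 'm, 'z) add_cat_scheme \<Rightarrow> 'o \<Rightarrow> 'o \<Rightarrow> 'm monoid" where
  "hom_group C X Y = \<lparr>carrier = Hom C X Y, monoid.mult = Add C, one = Zero C X Y\<rparr>"

definition biproduct ::
    "('o, 'm, 'z) add_cat_scheme \<Rightarrow> 'o \<Rightarrow> 'o \<Rightarrow> 'o \<Rightarrow> 'm \<Rightarrow> 'm \<Rightarrow> 'm \<Rightarrow> 'm \<Rightarrow> bool" where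
  "biproduct C X Y S i j p q \<longleftrightarrow>
     S \<in> Ob C \<and> i \<in> Hom C X S \<and> j \<in> Hom C Y S \<and> p \<in> Hom C S X \<and> q \<in> Hom C S Y \<and>
     Comp C p i = Id C X \<and> Comp C q j = Id C Y \<and>
     Comp C q i = Zero C X Y \<and> Comp C p j = Zero C Y X \<and>
     Add C (Comp C i p) (Comp C j q) = Id C S"

locale additive_category = category C
  for C :: "('o, 'm, 'z) add_cat_scheme" (structure) +
  assumes hom_group: "\<lbrakk>X \<in> Ob C; Y \<in> Ob C\<rbrakk> \<Longrightarrow> comm_group (hom_group C X Y)"
    and comp_add_left:
      "\<lbrakk>X \<in> Ob C; Y \<in> Ob C; Z \<in> Ob C; f \<in> Hom C X Y; g \<in> Hom C Y Z; g' \<in> Hom C Y Z\<rbrakk>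
        \<Longrightarrow> (g \<boxplus> g') \<odot> f = (g \<odot> f) \<boxplus> (g' \<odot> f)"
    and comp_add_right:
      "\<lbrakk>X \<in> Ob C; Y \<in> Ob C; Z \<in> Ob C; f \<in> Hom C X Y; f' \<in> Hom C X Y; g \<in> Hom C Y Z\<rbrakk>
        \<Longrightarrow> g \<odot> (f \<boxplus> f') = (g \<odot> f) \<boxplus> (g \<odot> f')"
    and has_zero_object: "\<exists>N. zero_object C N"
    and has_biproducts:
      "\<lbrakk>X \<in> Ob C; Y \<in> Ob C\<rbrakk> \<Longrightarrow> \<exists>S i j p q. biproduct C X Y S i j p q"

definition additive_functor ::
    "('o, 'm, 'z) add_cat_scheme \<Rightarrow> ('p, 'n, 'y) add_cat_scheme \<Rightarrow> ('o \<Rightarrow> 'p) \<Rightarrow> ('m \<Rightarrow> 'n) \<Rightarrow> bool"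
where
  "additive_functor C D Fo Fm \<longleftrightarrow>
     (\<forall>X \<in> Ob C. Fo X \<in> Ob D) \<and>
     (\<forall>X \<in> Ob C. Fm (Id C X) = Id D (Fo X)) \<and>
     (\<forall>X \<in> Ob C. \<forall>Y \<in> Ob C. \<forall>f \<in> Hom C X Y. Fm f \<in> Hom D (Fo X) (Fo Y)) \<and>
     (\<forall>X \<in> Ob C. \<forall>Y \<in> Ob C. \<forall>Z \<in> Ob C. \<forall>f \<in> Hom C X Y. \<forall>g \<in> Hom C Y Z.
        Fm (Comp C g f) = Comp D (Fm g) (Fm f)) \<and>
     (\<forall>X \<in> Ob C. \<forall>Y \<in> Ob C. \<forall>f \<in> Hom C X Y. \<forall>g \<in> Hom C X Y.
        Fm (Add C f g) = Add D (Fm f) (Fm g))"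

definition fully_faithful ::
    "('o, 'm, 'z) cat_scheme \<Rightarrow> ('p, 'n, 'y) cat_scheme \<Rightarrow> ('o \<Rightarrow> 'p) \<Rightarrow> ('m \<Rightarrow> 'n) \<Rightarrow> bool" where
  "fully_faithful C D Fo Fm \<longleftrightarrow>
     (\<forall>X \<in> Ob C. \<forall>Y \<in> Ob C. bij_betw Fm (Hom C X Y) (Hom D (Fo X) (Fo Y)))"

definition additive_equivalence ::
    "('o, 'm, 'z) add_cat_scheme \<Rightarrow> ('p, 'n, 'y) add_cat_scheme \<Rightarrow> ('o \<Rightarrow> 'p) \<Rightarrow> ('m \<Rightarrow> 'n) \<Rightarrow> bool"
where
  "additive_equivalence C D Fo Fm \<longleftrightarrow>
     additive_functor C D Fo Fm \<and> fully_faithful C D Fo Fm \<and>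
     (\<forall>Y \<in> Ob D. \<exists>X \<in> Ob C. isomorphic_in D (Fo X) Y)"

section \<open>Length categories\<close>

definition mono_arrow :: "('o, 'm, 'z) cat_scheme \<Rightarrow> 'o \<Rightarrow> 'o \<Rightarrow> 'm \<Rightarrow> bool" where
  "mono_arrow C A X m \<longleftrightarrow> m \<in> Hom C A X \<and>
     (\<forall>W \<in> Ob C. \<forall>u \<in> Hom C W A. \<forall>v \<in> Hom C W A. Comp C m u = Comp C m v \<longrightarrow> u = v)"

text \<open>Subobjects of \<open>X\<close> are represented by monomorphisms into \<open>X\<close>, preordered by factorisation.\<close>

definition subobject_le :: "('o, 'm, 'z) cat_scheme \<Rightarrow> 'o \<times> 'm \<Rightarrow> 'o \<times> 'm \<Rightarrow> bool" where
  "subobject_le C a b \<longleftrightarrow> (\<exists>u \<in> Hom C (fst a) (fst b). snd a = Comp C (snd b) u)"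

definition subobjects :: "('o, 'm, 'z) cat_scheme \<Rightarrow> 'o \<Rightarrow> ('o \<times> 'm) set" where
  "subobjects C X = {a. fst a \<in> Ob C \<and> mono_arrow C (fst a) X (snd a)}"

definition noetherian_cat :: "('o, 'm, 'z) cat_scheme \<Rightarrow> bool" where
  "noetherian_cat C \<longleftrightarrow> (\<forall>X \<in> Ob C. \<forall>a :: nat \<Rightarrow> 'o \<times> 'm.
     (\<forall>n. a n \<in> subobjects C X) \<and> (\<forall>n. subobject_le C (a n) (a (Suc n))) \<longrightarrow>
     (\<exists>N. \<forall>n \<ge> N. subobject_le C (a n) (a N)))"

definition artinian_cat :: "('o, 'm, 'z) cat_scheme \<Rightarrow> bool" where
  "artinian_cat C \<longleftrightarrow> (\<forall>X \<in> Ob C. \<forall>a :: nat \<Rightarrow> 'o \<times> 'm.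
     (\<forall>n. a n \<in> subobjects C X) \<and> (\<forall>n. subobject_le C (a (Suc n)) (a n)) \<longrightarrow>
     (\<exists>N. \<forall>n \<ge> N. subobject_le C (a N) (a n)))"

definition length_cat :: "('o, 'm, 'z) cat_scheme \<Rightarrow> bool" where
  "length_cat C \<longleftrightarrow> noetherian_cat C \<and> artinian_cat C"

section \<open>Triangulated categories\<close>

abbreviation neg_arrow :: "('o, 'm, 'z) add_cat_scheme \<Rightarrow> 'o \<Rightarrow> 'o \<Rightarrow> 'm \<Rightarrow> 'm" where
  "neg_arrow C X Y f \<equiv> m_inv (hom_group C X Y) f"

text \<open>The translation functor is an additive automorphism of the category, as in Verdier's axioms.\<close>

locale triangulated_category = additive_category D
  for D :: "('o, 'm, 'z) tri_cat_scheme" (structure) +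
  assumes shift_functor: "additive_functor D D (ShO D) (ShM D)"
    and shift_bij: "bij_betw (ShO D) (Ob D) (Ob D)"
    and shift_fully_faithful: "fully_faithful D D (ShO D) (ShM D)"
    and tri_typed:
      "Tri D X Y Z f g h \<Longrightarrow> X \<in> Ob D \<and> Y \<in> Ob D \<and> Z \<in> Ob D \<and>
         f \<in> Hom D X Y \<and> g \<in> Hom D Y Z \<and> h \<in> Hom D Z (ShO D X)"
    and tri_iso:
      "\<lbrakk>Tri D X Y Z f g h; X' \<in> Ob D; Y' \<in> Ob D; Z' \<in> Ob D;
        f' \<in> Hom D X' Y'; g' \<in> Hom D Y' Z'; h' \<in> Hom D Z' (ShO D X');
        iso_arrow D X X' a; iso_arrow D Y Y' b; iso_arrow D Z Z' c;
        f' \<odot> a = b \<odot> f; g' \<odot> b = c \<odot> g; h' \<odot> c = ShM D a \<odot> h\<rbrakk>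
        \<Longrightarrow> Tri D X' Y' Z' f' g' h'"
    and tri_id:
      "\<lbrakk>X \<in> Ob D; zero_object D N\<rbrakk> \<Longrightarrow> Tri D X X N (Id D X) (Zero D X N) (Zero D N (ShO D X))"
    and tri_cone:
      "\<lbrakk>X \<in> Ob D; Y \<in> Ob D; f \<in> Hom D X Y\<rbrakk> \<Longrightarrow> \<exists>Z g h. Tri D X Y Z f g h"
    and tri_rotate:
      "\<lbrakk>X \<in> Ob D; Y \<in> Ob D; Z \<in> Ob D; f \<in> Hom D X Y; g \<in> Hom D Y Z; h \<in> Hom D Z (ShO D X)\<rbrakk>
        \<Longrightarrow> Tri D X Y Z f g h \<longleftrightarrow>
            Tri D Y Z (ShO D X) g h (neg_arrow D (ShO D X) (ShO D Y) (ShM D f))"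
    and tri_morphism:
      "\<lbrakk>Tri D X Y Z f g h; Tri D X' Y' Z' f' g' h'; a \<in> Hom D X X'; b \<in> Hom D Y Y';
        f' \<odot> a = b \<odot> f\<rbrakk>
        \<Longrightarrow> \<exists>c \<in> Hom D Z Z'. g' \<odot> b = c \<odot> g \<and> h' \<odot> c = ShM D a \<odot> h"
    and octahedral:
      "\<lbrakk>Tri D X Y Z' f i d; Tri D Y Z X' g j e; Tri D X Z Y' (g \<odot> f) k l\<rbrakk>
        \<Longrightarrow> \<exists>u v. Tri D Z' Y' X' u v (ShM D i \<odot> e) \<and>
              u \<odot> i = k \<odot> g \<and> l \<odot> u = d \<and> v \<odot> k = j \<and> e \<odot> v = ShM D f \<odot> l"

definition shift_obj :: "('o, 'm, 'z) tri_cat_scheme \<Rightarrow> int \<Rightarrow> 'o \<Rightarrow> 'o" where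
  "shift_obj D n X =
     (if 0 \<le> n then (ShO D ^^ nat n) X else (inv_into (Ob D) (ShO D) ^^ nat (- n)) X)"

abbreviation shift_sub :: "('o, 'm, 'z) tri_cat_scheme \<Rightarrow> int \<Rightarrow> 'o set \<Rightarrow> 'o set" where
  "shift_sub D n S \<equiv> shift_obj D n ` S"

section \<open>Bounded t-structures and hearts\<close>

definition strictly_full :: "('o, 'm, 'z) cat_scheme \<Rightarrow> 'o set \<Rightarrow> bool" where
  "strictly_full C S \<longleftrightarrow> S \<subseteq> Ob C \<and>
     (\<forall>X \<in> S. \<forall>Y \<in> Ob C. isomorphic_in C X Y \<longrightarrow> Y \<in> S)"

text \<open>
  In the usual notation \<open>U\<close> is \<open>D\<^sup>\<le>\<^sup>0\<close> and \<open>V\<close> is \<open>D\<^sup>\<ge>\<^sup>0\<close>; thus \<open>D\<^sup>\<le>\<^sup>n\<close> is \<open>U[-n]\<close> and \<open>D\<^sup>\<ge>\<^sup>n\<close> is \<open>V[-n]\<close>.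
\<close>

definition t_structure :: "('o, 'm, 'z) tri_cat_scheme \<Rightarrow> 'o set \<Rightarrow> 'o set \<Rightarrow> bool" where
  "t_structure D U V \<longleftrightarrow>
     strictly_full D U \<and> strictly_full D V \<and>
     shift_sub D 1 U \<subseteq> U \<and> shift_sub D (- 1) V \<subseteq> V \<and>
     (\<forall>X \<in> U. \<forall>Y \<in> shift_sub D (- 1) V. Hom D X Y = {Zero D X Y}) \<and>
     (\<forall>X \<in> Ob D. \<exists>A \<in> U. \<exists>B \<in> shift_sub D (- 1) V. \<exists>f g h. Tri D A X B f g h)"

definition bounded_t_structure :: "('o, 'm, 'z) tri_cat_scheme \<Rightarrow> 'o set \<Rightarrow> 'o set \<Rightarrow> bool" where
  "bounded_t_structure D U V \<longleftrightarrow> t_structure D U V \<and>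
     (\<forall>X \<in> Ob D. \<exists>n :: nat. X \<in> shift_sub D (- int n) U \<and> X \<in> shift_sub D (int n) V)"

definition bounded_heart :: "('o, 'm, 'z) tri_cat_scheme \<Rightarrow> 'o set \<Rightarrow> bool" where
  "bounded_heart D H \<longleftrightarrow> (\<exists>U V. bounded_t_structure D U V \<and> H = U \<inter> V)"

definition heart_ge :: "('o, 'm, 'z) tri_cat_scheme \<Rightarrow> 'o set \<Rightarrow> 'o set \<Rightarrow> bool" where
  "heart_ge D K H \<longleftrightarrow>
     (\<forall>n > 0. \<forall>X \<in> shift_sub D n K. \<forall>Y \<in> H. Hom D X Y = {Zero D X Y})"

definition intermediate_hearts :: "('o, 'm, 'z) tri_cat_scheme \<Rightarrow> 'o set \<Rightarrow> 'o set set" where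
  "intermediate_hearts D H =
     {K. bounded_heart D K \<and> heart_ge D (shift_sub D 1 H) K \<and> heart_ge D K H}"

section \<open>The Grothendieck group\<close>

definition K0_relations :: "('o, 'm, 'z) tri_cat_scheme \<Rightarrow> ('o \<Rightarrow>\<^sub>0 int) set" where
  "K0_relations D = {frag_of Y - frag_of X - frag_of Z | X Y Z f g h. Tri D X Y Z f g h}"

definition K0_subgroup :: "('o, 'm, 'z) tri_cat_scheme \<Rightarrow> ('o \<Rightarrow>\<^sub>0 int) set" where
  "K0_subgroup D = generate (free_Abelian_group (Ob D)) (K0_relations D)"

definition K0 :: "('o, 'm, 'z) tri_cat_scheme \<Rightarrow> ('o \<Rightarrow>\<^sub>0 int) set monoid" where
  "K0 D = free_Abelian_group (Ob D) Mod K0_subgroup D"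

definition K0_class :: "('o, 'm, 'z) tri_cat_scheme \<Rightarrow> 'o \<Rightarrow> ('o \<Rightarrow>\<^sub>0 int) set" where
  "K0_class D X = r_coset (free_Abelian_group (Ob D)) (K0_subgroup D) (frag_of X)"

text \<open>The additive group of a type, as a group in the sense of HOL-Algebra.\<close>

definition type_group :: "'a::ab_group_add monoid" where
  "type_group = \<lparr>carrier = UNIV, monoid.mult = (+), one = 0\<rparr>"

definition free_of_finite_rank :: "'a::ab_group_add itself \<Rightarrow> bool" where
  "free_of_finite_rank _ \<longleftrightarrow>
     (\<exists>n :: nat. (type_group :: 'a monoid) \<cong> free_Abelian_group {..<n})"

section \<open>Extension of scalars\<close>

text \<open>
  The type \<open>'a tensor_real\<close> is the tensor product over the integers of an abelian group with the
  reals: the free abelian group on pairs modulo the subgroup generated by the bilinearity relations.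
\<close>

inductive_set tensor_null :: "('a::ab_group_add \<times> real \<Rightarrow>\<^sub>0 int) set" where
  zero: "0 \<in> tensor_null"
| add_left: "frag_of (x + y, r) - frag_of (x, r) - frag_of (y, r) \<in> tensor_null"
| add_right: "frag_of (x, r + s) - frag_of (x, r) - frag_of (x, s) \<in> tensor_null"
| diff: "a \<in> tensor_null \<Longrightarrow> b \<in> tensor_null \<Longrightarrow> a - b \<in> tensor_null"

lemma tensor_null_minus: "a \<in> tensor_null \<Longrightarrow> - a \<in> tensor_null"
  using tensor_null.diff[OF tensor_null.zero] by simp

lemma tensor_null_add: "a \<in> tensor_null \<Longrightarrow> b \<in> tensor_null \<Longrightarrow> a + b \<in> tensor_null"
  using tensor_null.diff[OF _ tensor_null_minus] by fastforce

definition tensor_rel :: "('a::ab_group_add \<times> real \<Rightarrow>\<^sub>0 int) \<Rightarrow> ('a \<times> real \<Rightarrow>\<^sub>0 int) \<Rightarrow> bool" where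
  "tensor_rel a b \<longleftrightarrow> a - b \<in> tensor_null"

lemma equivp_tensor_rel: "equivp tensor_rel"
proof (rule equivpI)
  show "reflp tensor_rel"
    by (simp add: reflp_def tensor_rel_def tensor_null.zero)
  show "symp tensor_rel"
    unfolding symp_def tensor_rel_def using tensor_null_minus by fastforce
  show "transp tensor_rel"
    unfolding transp_def tensor_rel_def
  proof (intro allI impI)
    fix x y z :: "'b \<times> real \<Rightarrow>\<^sub>0 int"
    assume "x - y \<in> tensor_null" "y - z \<in> tensor_null"
    from tensor_null_add[OF this] show "x - z \<in> tensor_null" by simp
  qed
qed

quotient_type (overloaded) 'a tensor_real =
    "'a::ab_group_add \<times> real \<Rightarrow>\<^sub>0 int" / tensor_rel
  by (rule equivp_tensor_rel)

definition tensor_scale ::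
    "real \<Rightarrow> ('a::ab_group_add \<times> real \<Rightarrow>\<^sub>0 int) \<Rightarrow> ('a \<times> real \<Rightarrow>\<^sub>0 int)" where
  "tensor_scale r = frag_extend (\<lambda>(x, s). frag_of (x, r * s))"

lemma tensor_scale_of [simp]: "tensor_scale r (frag_of (x, s)) = frag_of (x, r * s)"
  by (simp add: tensor_scale_def)

lemma tensor_scale_diff: "tensor_scale r (a - b) = tensor_scale r a - tensor_scale r b"
  by (simp add: tensor_scale_def frag_extend_diff)

lemma tensor_scale_add: "tensor_scale r (a + b) = tensor_scale r a + tensor_scale r b"
  by (simp add: tensor_scale_def frag_extend_add)

lemma tensor_scale_null: "a \<in> tensor_null \<Longrightarrow> tensor_scale r a \<in> tensor_null"
proof (induction rule: tensor_null.induct)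
  case zero
  then show ?case by (simp add: tensor_scale_def tensor_null.zero)
next
  case (add_left x y s)
  then show ?case by (simp add: tensor_scale_diff tensor_null.add_left)
next
  case (add_right x s t)
  then show ?case by (simp add: tensor_scale_diff distrib_left tensor_null.add_right)
next
  case (diff a b)
  then show ?case by (simp add: tensor_scale_diff tensor_null.diff)
qed

lemma tensor_scale_scale: "tensor_scale r (tensor_scale s a) = tensor_scale (r * s) a"
proof (rule frag_induction[of a UNIV])
  show "tensor_scale r (tensor_scale s (frag_of x)) = tensor_scale (r * s) (frag_of x)" for x :: "'a \<times> real"
    by (cases x) (simp add: mult.assoc)
qed (simp_all add: tensor_scale_diff, simp add: tensor_scale_def)

lemma tensor_scale_one: "tensor_scale 1 a = a"
proof (rule frag_induction[of a UNIV])
  show "tensor_scale 1 (frag_of x) = frag_of x" for x :: "'a \<times> real"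
    by (cases x) simp
qed (simp_all add: tensor_scale_diff, simp add: tensor_scale_def)

lemma tensor_scale_add_scalar:
  "tensor_scale (r + s) a - (tensor_scale r a + tensor_scale s a) \<in> tensor_null"
proof (rule frag_induction[of a UNIV])
  show "tensor_scale (r + s) 0 - (tensor_scale r 0 + tensor_scale s 0)
      \<in> (tensor_null :: ('a \<times> real \<Rightarrow>\<^sub>0 int) set)"
    by (simp add: tensor_scale_def tensor_null.zero)
next
  fix x :: "'a \<times> real"
  show "tensor_scale (r + s) (frag_of x) - (tensor_scale r (frag_of x) + tensor_scale s (frag_of x))
      \<in> tensor_null"
    using tensor_null.add_right[of "fst x" "r * snd x" "s * snd x"]
    by (cases x) (simp add: distrib_right diff_diff_eq)
next
  fix a b :: "'a \<times> real \<Rightarrow>\<^sub>0 int"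
  assume "tensor_scale (r + s) a - (tensor_scale r a + tensor_scale s a) \<in> tensor_null"
    and "tensor_scale (r + s) b - (tensor_scale r b + tensor_scale s b) \<in> tensor_null"
  from tensor_null.diff[OF this]
  show "tensor_scale (r + s) (a - b) - (tensor_scale r (a - b) + tensor_scale s (a - b))
      \<in> tensor_null"
    by (simp add: tensor_scale_diff algebra_simps)
qed simp

instantiation tensor_real :: (ab_group_add) real_vector
begin

lift_definition zero_tensor_real :: "'a tensor_real" is 0 .

lift_definition plus_tensor_real :: "'a tensor_real \<Rightarrow> 'a tensor_real \<Rightarrow> 'a tensor_real" is "(+)"
  unfolding tensor_rel_def by (drule (1) tensor_null_add) (simp add: algebra_simps)

lift_definition minus_tensor_real :: "'a tensor_real \<Rightarrow> 'a tensor_real \<Rightarrow> 'a tensor_real" is "(-)"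
  unfolding tensor_rel_def by (drule (1) tensor_null.diff) (simp add: algebra_simps)

lift_definition uminus_tensor_real :: "'a tensor_real \<Rightarrow> 'a tensor_real" is "uminus"
  unfolding tensor_rel_def by (drule tensor_null_minus) (simp add: algebra_simps)

lift_definition scaleR_tensor_real :: "real \<Rightarrow> 'a tensor_real \<Rightarrow> 'a tensor_real" is tensor_scale
  unfolding tensor_rel_def by (drule tensor_scale_null) (simp add: tensor_scale_diff)

instance
proof
  fix x y z :: "'a tensor_real" and r s :: real
  show "x + y + z = x + (y + z)"
    by transfer (simp add: tensor_rel_def tensor_null.zero add.assoc)
  show "x + y = y + x"
    by transfer (simp add: tensor_rel_def tensor_null.zero add.commute)
  show "0 + x = x"
    by transfer (simp add: tensor_rel_def tensor_null.zero)
  show "- x + x = 0"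
    by transfer (simp add: tensor_rel_def tensor_null.zero)
  show "x - y = x + - y"
    by transfer (simp add: tensor_rel_def tensor_null.zero)
  show "r *\<^sub>R (x + y) = r *\<^sub>R x + r *\<^sub>R y"
    by transfer (simp add: tensor_rel_def tensor_null.zero tensor_scale_add)
  show "(r + s) *\<^sub>R x = r *\<^sub>R x + s *\<^sub>R x"
    by transfer (simp add: tensor_rel_def tensor_scale_add_scalar)
  show "r *\<^sub>R s *\<^sub>R x = (r * s) *\<^sub>R x"
    by transfer (simp add: tensor_rel_def tensor_null.zero tensor_scale_scale)
  show "1 *\<^sub>R x = x"
    by transfer (simp add: tensor_rel_def tensor_null.zero tensor_scale_one)
qed

end

lift_definition tensor_one :: "'a::ab_group_add \<Rightarrow> 'a tensor_real" is "\<lambda>x. frag_of (x, 1)" .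

section \<open>Cones and cofans\<close>

definition integral_cone :: "'a::ab_group_add set \<Rightarrow> bool" where
  "integral_cone s \<longleftrightarrow> 0 \<in> s \<and> (\<forall>x \<in> s. \<forall>y \<in> s. x + y \<in> s)"

definition real_cone :: "'a::real_vector set \<Rightarrow> bool" where
  "real_cone s \<longleftrightarrow> s \<noteq> {} \<and> (\<forall>x \<in> s. \<forall>y \<in> s. x + y \<in> s) \<and> (\<forall>x \<in> s. \<forall>r \<ge> 0. r *\<^sub>R x \<in> s)"

definition cone_face :: "'a::ab_group_add set \<Rightarrow> 'a set \<Rightarrow> bool" where
  "cone_face t s \<longleftrightarrow> t \<noteq> {} \<and> t \<subseteq> s \<and> (\<forall>a \<in> s. \<forall>b \<in> s. a + b \<in> t \<longleftrightarrow> a \<in> t \<and> b \<in> t)"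

text \<open>
  Minkowski differences; Minkowski sums are \<open>(+)\<close> on sets from \<^theory>\<open>HOL-Library.Set_Algebras\<close>,
  whereas \<open>(-)\<close> on sets is the set-theoretic difference.
\<close>

definition minkowski_diff :: "'a::ab_group_add set \<Rightarrow> 'a set \<Rightarrow> 'a set" (infixl "\<ominus>\<^sub>M" 65) where
  "s \<ominus>\<^sub>M k = {a - b | a b. a \<in> s \<and> b \<in> k}"

definition cofaces :: "'a::ab_group_add set \<Rightarrow> 'a set set" where
  "cofaces s = {s \<ominus>\<^sub>M k | k. integral_cone k \<and> k \<subseteq> s}"

definition cofan :: "('a::ab_group_add set \<Rightarrow> bool) \<Rightarrow> 'a set set \<Rightarrow> bool" where
  "cofan is_cone F \<longleftrightarrow>
     (\<forall>s \<in> F. is_cone s) \<and>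
     (\<forall>s \<in> F. \<forall>t. cone_face t s \<longrightarrow> s \<ominus>\<^sub>M t \<in> F) \<and>
     (\<forall>s \<in> F. \<forall>s' \<in> F. \<exists>t. cone_face t s \<and> s + s' = s \<ominus>\<^sub>M t)"

abbreviation integral_cofan :: "'a::ab_group_add set set \<Rightarrow> bool" where
  "integral_cofan \<equiv> cofan integral_cone"

abbreviation real_cofan :: "'a::real_vector set set \<Rightarrow> bool" where
  "real_cofan \<equiv> cofan real_cone"

definition conv :: "'a::ab_group_add set \<Rightarrow> 'a tensor_real set" where
  "conv s = convex hull (tensor_one ` s)"

definition realification :: "'a::ab_group_add set set \<Rightarrow> 'a tensor_real set set" where
  "realification F = conv ` F"

text \<open>Completeness, with the dual lattice given by the additive maps to the integers.\<close>

definition complete_cofan :: "'a::ab_group_add set set \<Rightarrow> bool" where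
  "complete_cofan F \<longleftrightarrow>
     (\<forall>v :: 'a \<Rightarrow> int. additive v \<longrightarrow> (\<exists>s \<in> F. \<forall>x \<in> s. 0 \<le> v x))"

section \<open>The cofan of a bounded heart\<close>

definition eff_cone ::
    "('o, 'm, 'z) tri_cat_scheme \<Rightarrow> (('o \<Rightarrow>\<^sub>0 int) set \<Rightarrow> 'l::ab_group_add) \<Rightarrow> 'o set \<Rightarrow> 'l set" where
  "eff_cone D lam S = integral_cone hull {lam (K0_class D X) | X. X \<in> S}"

definition eff_cone_real ::
    "('o, 'm, 'z) tri_cat_scheme \<Rightarrow> (('o \<Rightarrow>\<^sub>0 int) set \<Rightarrow> 'l::ab_group_add) \<Rightarrow> 'o set
      \<Rightarrow> 'l tensor_real set" where
  "eff_cone_real D lam S = conv (eff_cone D lam S)"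

definition face_subcategory ::
    "('o, 'm, 'z) tri_cat_scheme \<Rightarrow> (('o \<Rightarrow>\<^sub>0 int) set \<Rightarrow> 'l::ab_group_add) \<Rightarrow> 'o set \<Rightarrow> 'o set \<Rightarrow> bool"
where
  "face_subcategory D lam K S \<longleftrightarrow>
     (\<exists>t. cone_face t (eff_cone D lam K) \<and> S = {X \<in> K. lam (K0_class D X) \<in> t})"

definition heart_cofan ::
    "('o, 'm, 'z) tri_cat_scheme \<Rightarrow> (('o \<Rightarrow>\<^sub>0 int) set \<Rightarrow> 'l::ab_group_add) \<Rightarrow> 'o set \<Rightarrow> 'l set set"
where
  "heart_cofan D lam H = (\<Union>K \<in> intermediate_hearts D H. cofaces (eff_cone D lam K))"

definition heart_cofan_real ::
    "('o, 'm, 'z) tri_cat_scheme \<Rightarrow> (('o \<Rightarrow>\<^sub>0 int) set \<Rightarrow> 'l::ab_group_add) \<Rightarrow> 'o set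
      \<Rightarrow> 'l tensor_real set set" where
  "heart_cofan_real D lam H =
     {eff_cone_real D lam K \<ominus>\<^sub>M eff_cone_real D lam S | K S.
        K \<in> intermediate_hearts D H \<and> face_subcategory D lam K S}"

end

theory Submission
  imports Defs
begin

text \<open>
  The bounded hearts between \<open>H[1]\<close> and \<open>H\<close> are the tilts \<open>F[1] * T\<close> of \<open>H\<close> at its torsion pairs
  \<open>(T, F)\<close>, so \<open>E(K) = E(T) - E(F)\<close>. Torsion pairs, and hence the cofan, depend only on the additive
  category \<open>H\<close>. If \<open>K'\<close> is the tilt at \<open>(T', F')\<close>, the torsion sequences with respect to \<open>(T, F)\<close> of the
  objects of \<open>T'\<close> and \<open>F'\<close> have outer terms in \<open>T\<close>, \<open>F \<inter> T'\<close> and in \<open>T \<inter> F'\<close>, \<open>F\<close> respectively, so that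
  \<open>E(K) + E(K') = E(K) + E(F \<inter> T') - E(T \<inter> F')\<close> is a coface of \<open>E(K)\<close>; since cofaces of cofaces are
  cofaces, this gives the cofan axioms. If \<open>H\<close> is a length category and \<open>v\<close> a functional, the objects
  all of whose subobjects have \<open>v \<le> 0\<close> form the torsion-free part of a torsion pair, and \<open>v\<close> is
  nonnegative on the cone of its tilt. Finally, \<open>conv\<close> commutes with Minkowski sums and differences of
  cones, and every face of \<open>conv s\<close> is spanned by a face of \<open>s\<close>.
\<close>

section \<open>Integral cones, faces and cofaces\<close>

text \<open>The heart is never shown to be abelian. Short exact sequences are replaced by triangles
  with all three terms in the heart, and what abelianness would give is derived from the t-structure
  and the octahedral axiom: cones of monomorphisms (\<open>mono_cone_in_heart\<close>), images
  (\<open>heart_image\<close>) and preimages of subobjects (\<open>heart_pullback\<close>). Torsion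
  pairs therefore appear twice: \<open>tors_pair\<close>, with triangles, is what tilting needs,
  while \<open>torsion_pair_in\<close>, with monomorphisms and cokernels, makes sense without D;
  statement (2) rests on their agreement. On the side of cones the obstacle is that a coface does
  not remember the subcone that was subtracted. \<open>cofaces_iff\<close> removes this choice: it
  is a condition on single elements of M that is stable under addition, so the sum axiom only has to
  be checked on the classes that generate E(K').\<close>

lemma minkowski_diffI: "a \<in> s \<Longrightarrow> b \<in> k \<Longrightarrow> a - b \<in> s \<ominus>\<^sub>M k"
  by (auto simp: minkowski_diff_def)

lemma minkowski_diffE:
  assumes "x \<in> s \<ominus>\<^sub>M k" obtains a b where "a \<in> s" "b \<in> k" "x = a - b"
  using assms by (auto simp: minkowski_diff_def)

lemma integral_cone_hull: "integral_cone (integral_cone hull A)"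
  by (rule hull_in) (auto simp: integral_cone_def)

lemma integral_cone_hull_minimal:
  "integral_cone c \<Longrightarrow> A \<subseteq> c \<Longrightarrow> integral_cone hull A \<subseteq> c"
  by (simp add: hull_minimal)

lemma integral_cone_add: "integral_cone c \<Longrightarrow> x \<in> c \<Longrightarrow> y \<in> c \<Longrightarrow> x + y \<in> c"
  by (simp add: integral_cone_def)

lemma integral_cone_zero: "integral_cone c \<Longrightarrow> 0 \<in> c"
  by (simp add: integral_cone_def)

lemma integral_coneI:
  "0 \<in> c \<Longrightarrow> (\<And>x y. x \<in> c \<Longrightarrow> y \<in> c \<Longrightarrow> x + y \<in> c) \<Longrightarrow> integral_cone c"
  by (simp add: integral_cone_def)

lemma integral_cone_sum:
  assumes "integral_cone s" "integral_cone t"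
  shows "integral_cone (s + t)"
proof (rule integral_coneI)
  show "0 \<in> s + t"
    using set_plus_intro[of 0 s 0 t] assms by (simp add: integral_cone_def)
  fix x y assume "x \<in> s + t" "y \<in> s + t"
  then obtain a b c d where *: "a \<in> s" "b \<in> t" "x = a + b" "c \<in> s" "d \<in> t" "y = c + d"
    by (auto elim!: set_plus_elim)
  then have "x + y = (a + c) + (b + d)"
    by (simp add: ac_simps)
  then show "x + y \<in> s + t"
    using * assms integral_cone_add by (metis set_plus_intro)
qed

lemma cone_face_zero:
  assumes "cone_face t s" "0 \<in> s" shows "0 \<in> t"
proof -
  obtain a where "a \<in> t" "a \<in> s"
    using assms(1) by (auto simp: cone_face_def)
  then show ?thesis
    using assms by (metis add.right_neutral cone_face_def)
qed

lemma cone_face_integral_cone: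
  assumes "cone_face t s" "integral_cone s" shows "integral_cone t"
  using assms cone_face_zero[OF assms(1)] unfolding integral_cone_def cone_face_def by blast

text \<open>For a subcone k this is the smallest face of s containing k: a face that contains x + y
  contains x.\<close>

definition generated_face :: "'a::ab_group_add set \<Rightarrow> 'a set \<Rightarrow> 'a set" where
  "generated_face s k = {x \<in> s. \<exists>y \<in> s. x + y \<in> k}"

lemma generated_face_face:
  assumes s: "integral_cone s" and k: "integral_cone k" "k \<subseteq> s"
  shows "cone_face (generated_face s k) s"
proof -
  have "a \<in> generated_face s k \<and> b \<in> generated_face s k"
    if ab: "a \<in> s" "b \<in> s" "a + b \<in> generated_face s k" for a b
  proof -
    obtain y where y: "y \<in> s" "a + b + y \<in> k"
      using ab by (auto simp: generated_face_def)
    then have "b + y \<in> s" "a + (b + y) \<in> k" "a + y \<in> s" "b + (a + y) \<in> k"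
      using s ab by (auto simp: integral_cone_def algebra_simps)
    then show ?thesis
      using ab by (auto simp: generated_face_def)
  qed
  moreover have "a + b \<in> generated_face s k"
    if ab: "a \<in> generated_face s k" "b \<in> generated_face s k" for a b
  proof -
    obtain y where y: "y \<in> s" "a + y \<in> k" "a \<in> s"
      using ab by (auto simp: generated_face_def)
    obtain z where z: "z \<in> s" "b + z \<in> k" "b \<in> s"
      using ab by (auto simp: generated_face_def)
    have "(a + y) + (b + z) \<in> k"
      using k y z unfolding integral_cone_def by blast
    then have "y + z \<in> s" "(a + b) + (y + z) \<in> k" "a + b \<in> s"
      using s y z by (auto simp: integral_cone_def algebra_simps)
    then show ?thesis
      by (auto simp: generated_face_def)
  qed
  moreover have "0 \<in> generated_face s k"
    using s k by (simp add: generated_face_def integral_cone_def) (metis add.right_neutral)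
  moreover have "generated_face s k \<subseteq> s"
    by (auto simp: generated_face_def)
  ultimately show ?thesis
    unfolding cone_face_def by (intro conjI ballI iffI) blast+
qed

text \<open>If b + y lies in k with y in s, then a - b = (a + y) - (b + y), so enlarging k to the
  face it generates produces no new differences. This is why cofaces by subcones and by faces
  coincide.\<close>

lemma minkowski_diff_generated_face:
  assumes s: "integral_cone s" and k: "integral_cone k" "k \<subseteq> s"
  shows "s \<ominus>\<^sub>M generated_face s k = s \<ominus>\<^sub>M k"
proof
  show "s \<ominus>\<^sub>M generated_face s k \<subseteq> s \<ominus>\<^sub>M k"
  proof
    fix x assume "x \<in> s \<ominus>\<^sub>M generated_face s k"
    then obtain a b y where "a \<in> s" "b \<in> s" "x = a - b" "y \<in> s" "b + y \<in> k"
      by (auto simp: minkowski_diff_def generated_face_def)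
    then have "a + y \<in> s" "x = (a + y) - (b + y)"
      using s by (auto simp: integral_cone_def)
    then show "x \<in> s \<ominus>\<^sub>M k"
      using \<open>b + y \<in> k\<close> minkowski_diffI by metis
  qed
  have "k \<subseteq> generated_face s k"
    using s k by (auto simp: generated_face_def integral_cone_def) (metis add.right_neutral)
  then show "s \<ominus>\<^sub>M k \<subseteq> s \<ominus>\<^sub>M generated_face s k"
    by (auto simp: minkowski_diff_def)
qed

lemma cofaces_eq_faces:
  assumes "integral_cone s"
  shows "cofaces s = {s \<ominus>\<^sub>M t | t. cone_face t s}"
proof (intro equalityI subsetI)
  fix M assume "M \<in> cofaces s"
  then obtain k where k: "integral_cone k" "k \<subseteq> s" "M = s \<ominus>\<^sub>M k"
    by (auto simp: cofaces_def)
  then have "M = s \<ominus>\<^sub>M generated_face s k"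
    using minkowski_diff_generated_face[OF assms] by simp
  then show "M \<in> {s \<ominus>\<^sub>M t | t. cone_face t s}"
    using generated_face_face[OF assms k(1,2)] by blast
next
  fix M assume "M \<in> {s \<ominus>\<^sub>M t | t. cone_face t s}"
  then obtain t where "cone_face t s" "M = s \<ominus>\<^sub>M t"
    by blast
  then show "M \<in> cofaces s"
    using cone_face_integral_cone[OF _ assms] unfolding cofaces_def
    by (intro CollectI exI[of _ t]) (simp add: cone_face_def)
qed

text \<open>Eliminates the existential subcone from the notion of coface. The condition on x is
  additive in x, so it may be verified on generators of M.\<close>

lemma cofaces_iff:
  assumes s: "integral_cone s"
  shows "M \<in> cofaces s \<longleftrightarrow>
    integral_cone M \<and> s \<subseteq> M \<and> (\<forall>x \<in> M. \<exists>a \<in> s. \<exists>b \<in> s. x = a - b \<and> - b \<in> M)"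
    (is "_ \<longleftrightarrow> ?coface")
proof
  assume "M \<in> cofaces s"
  then obtain k where k: "integral_cone k" "k \<subseteq> s" and M: "M = s \<ominus>\<^sub>M k"
    by (auto simp: cofaces_def)
  have z: "0 \<in> k" "0 \<in> s"
    using k s by (auto simp: integral_cone_def)
  have "integral_cone M"
  proof (rule integral_coneI)
    show "0 \<in> M"
      using z minkowski_diffI[of 0 s 0 k] by (simp add: M)
    fix x y assume "x \<in> M" "y \<in> M"
    then obtain a b a' b' where *: "a \<in> s" "b \<in> k" "x = a - b" "a' \<in> s" "b' \<in> k" "y = a' - b'"
      by (auto simp: M elim!: minkowski_diffE)
    then have "a + a' \<in> s" "b + b' \<in> k" "x + y = (a + a') - (b + b')"
      using s k by (auto simp: integral_cone_def)
    then show "x + y \<in> M"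
      unfolding M by (metis minkowski_diffI)
  qed
  moreover have "s \<subseteq> M"
    using minkowski_diffI[of _ s 0 k] z by (auto simp: M)
  moreover have "\<exists>a \<in> s. \<exists>b \<in> s. x = a - b \<and> - b \<in> M" if "x \<in> M" for x
  proof -
    obtain a b where "a \<in> s" "b \<in> k" "x = a - b"
      using \<open>x \<in> M\<close> by (auto simp: M elim!: minkowski_diffE)
    then show ?thesis
      using k z minkowski_diffI[of 0 s b k] by (auto simp: M)
  qed
  ultimately show ?coface
    by blast
next
  assume M: ?coface
  \<comment> \<open>The largest subcone of s whose subtraction stays inside M.\<close>
  define k where "k = {b \<in> s. - b \<in> M}"
  have "integral_cone k"
    using s M unfolding integral_cone_def k_def
    by (auto simp: minus_add_distrib simp del: add_uminus_conv_diff)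
  moreover have "M = s \<ominus>\<^sub>M k"
  proof
    show "M \<subseteq> s \<ominus>\<^sub>M k"
      using M by (fastforce simp: k_def minkowski_diff_def)
    show "s \<ominus>\<^sub>M k \<subseteq> M"
    proof
      fix x assume "x \<in> s \<ominus>\<^sub>M k"
      then obtain a b where "a \<in> M" "- b \<in> M" "x = a + - b"
        using M by (auto simp: k_def elim!: minkowski_diffE)
      then show "x \<in> M"
        using M unfolding integral_cone_def by blast
    qed
  qed
  moreover have "k \<subseteq> s"
    by (auto simp: k_def)
  ultimately show "M \<in> cofaces s"
    unfolding cofaces_def by blast
qed

lemma coface_integral_cone: "integral_cone s \<Longrightarrow> M \<in> cofaces s \<Longrightarrow> integral_cone M"
  by (simp add: cofaces_iff)

lemma coface_self: "integral_cone s \<Longrightarrow> s \<in> cofaces s"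
  by (force simp: cofaces_iff integral_cone_def)

text \<open>An element p - q of N, with p = a - b and q = c - d split in s, equals (a + d) - (b +
  c). The negative part stays in N because - c = - q - d and all of - b, - q, - d lie in N.\<close>

lemma coface_trans:
  assumes s: "integral_cone s" and M: "M \<in> cofaces s" and N: "N \<in> cofaces M"
  shows "N \<in> cofaces s"
proof -
  have cM: "integral_cone M" and sM: "s \<subseteq> M"
    using s M by (auto simp: cofaces_iff)
  have cN: "integral_cone N" and MN: "M \<subseteq> N"
    using cM N by (auto simp: cofaces_iff)
  have addN: "x + y \<in> N" if "x \<in> N" "y \<in> N" for x y
    using cN that by (auto simp: integral_cone_def)
  have "\<exists>a \<in> s. \<exists>b \<in> s. x = a - b \<and> - b \<in> N" if "x \<in> N" for x
  proof -
    obtain p q where pq: "p \<in> M" "q \<in> M" "x = p - q" "- q \<in> N"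
      using N cM \<open>x \<in> N\<close> by (auto simp: cofaces_iff)
    obtain a b where ab: "a \<in> s" "b \<in> s" "p = a - b" "- b \<in> M"
      using M s pq by (auto simp: cofaces_iff)
    obtain c d where cd: "c \<in> s" "d \<in> s" "q = c - d" "- d \<in> M"
      using M s pq by (auto simp: cofaces_iff)
    have "x = (a + d) - (b + c)" "- (b + c) = - b + (- q + - d)"
      using pq ab cd by auto
    moreover have "a + d \<in> s" "b + c \<in> s"
      using s ab cd by (auto simp: integral_cone_def)
    moreover have "- b + (- q + - d) \<in> N"
      using ab cd pq MN by (intro addN) auto
    ultimately show ?thesis
      by metis
  qed
  then show ?thesis
    using cN sM MN s by (auto simp: cofaces_iff)
qed

text \<open>Reduces the sum axiom for arbitrary cofaces to the cones they come from. An element of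
  M' is a difference of elements of s', and each of these is a difference of elements of s because s
  + s' is a coface of s; the negative parts never leave M + M'.\<close>

lemma sum_of_cofaces:
  assumes s: "integral_cone s" "integral_cone s'" and sum: "s + s' \<in> cofaces s"
    and M: "M \<in> cofaces s" and M': "M' \<in> cofaces s'"
  shows "M + M' \<in> cofaces M"
proof -
  have cM: "integral_cone M" "integral_cone M'" and sub: "s \<subseteq> M" "s' \<subseteq> M'"
    using s M M' by (auto simp: cofaces_iff)
  have inM: "0 \<in> M" "0 \<in> M'" and addM: "\<And>x y. x \<in> M \<Longrightarrow> y \<in> M \<Longrightarrow> x + y \<in> M"
    using cM by (auto simp: integral_cone_def)
  have sub_sum: "M \<subseteq> M + M'" "M' \<subseteq> M + M'"
    using inM by (metis set_zero_plus2 add.commute)+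
  have cone: "integral_cone (M + M')"
    by (rule integral_cone_sum[OF cM])
  then have addS: "x + y \<in> M + M'" if "x \<in> M + M'" "y \<in> M + M'" for x y
    using that by (auto simp: integral_cone_def)
  have s'_diff: "\<exists>a \<in> s. \<exists>b \<in> s. x = a - b \<and> - b \<in> M + M'" if "x \<in> s'" for x
  proof -
    have "x \<in> s + s'"
      using that s set_zero_plus2[of s s'] by (auto simp: integral_cone_def)
    then obtain a b where "a \<in> s" "b \<in> s" "x = a - b" "- b \<in> s + s'"
      using sum s by (auto simp: cofaces_iff)
    moreover have "s + s' \<subseteq> M + M'"
      using sub by (rule set_plus_mono2)
    ultimately show ?thesis
      by blast
  qed
  have "\<exists>a \<in> M. \<exists>b \<in> M. x = a - b \<and> - b \<in> M + M'" if x: "x \<in> M + M'" for x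
  proof -
    obtain m m' where m: "m \<in> M" "m' \<in> M'" "x = m + m'"
      using x by (auto elim!: set_plus_elim)
    obtain p q where pq: "p \<in> s'" "q \<in> s'" "m' = p - q" "- q \<in> M'"
      using M' s m by (auto simp: cofaces_iff)
    obtain a b where ab: "a \<in> s" "b \<in> s" "p = a - b" "- b \<in> M + M'"
      using s'_diff pq by blast
    obtain c d where cd: "c \<in> s" "d \<in> s" "q = c - d" "- d \<in> M + M'"
      using s'_diff pq by blast
    have "x = (m + (a + d)) - (b + c)" "- (b + c) = - b + (- q + - d)"
      using m pq ab cd by auto
    moreover have "m + (a + d) \<in> M" "b + c \<in> M"
      using ab cd m sub addM by blast+
    moreover have "- b + (- q + - d) \<in> M + M'"
      using ab cd pq sub_sum by (intro addS) auto
    ultimately show ?thesis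
      by metis
  qed
  then show ?thesis
    using cone sub_sum cM by (auto simp: cofaces_iff)
qed

lemma integral_cofan_cofaces:
  assumes cone: "\<And>s. s \<in> E \<Longrightarrow> integral_cone s"
    and sum: "\<And>s s'. s \<in> E \<Longrightarrow> s' \<in> E \<Longrightarrow> s + s' \<in> cofaces s"
  shows "integral_cofan (\<Union>s \<in> E. cofaces s)"
  unfolding cofan_def
proof (intro conjI ballI allI impI)
  fix M assume "M \<in> (\<Union>s \<in> E. cofaces s)"
  then obtain s where s: "s \<in> E" "M \<in> cofaces s"
    by blast
  then show cM: "integral_cone M"
    using cone coface_integral_cone by blast
  show "M \<ominus>\<^sub>M t \<in> (\<Union>s \<in> E. cofaces s)" if "cone_face t M" for t
  proof -
    have "M \<ominus>\<^sub>M t \<in> cofaces M"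
      unfolding cofaces_eq_faces[OF cM] using that by blast
    then show ?thesis
      using coface_trans[OF cone[OF s(1)] s(2)] s(1) by blast
  qed
  fix M' assume "M' \<in> (\<Union>s \<in> E. cofaces s)"
  then obtain s' where s': "s' \<in> E" "M' \<in> cofaces s'"
    by blast
  have "M + M' \<in> cofaces M"
    using sum_of_cofaces[OF cone cone sum] s s' by blast
  then show "\<exists>t. cone_face t M \<and> M + M' = M \<ominus>\<^sub>M t"
    unfolding cofaces_eq_faces[OF cM] by blast
qed

section \<open>Realification\<close>

lemma tensor_one_add: "tensor_one (x + y) = tensor_one x + tensor_one y"
  by transfer (use tensor_null.add_left in \<open>simp add: tensor_rel_def diff_diff_eq\<close>)

lemma tensor_one_zero: "tensor_one 0 = 0"
  using tensor_one_add[of 0 0] by simp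

lemma tensor_one_diff: "tensor_one (x - y) = tensor_one x - tensor_one y"
  using tensor_one_add[of "x - y" y] by simp

lemma real_cone_zero: "real_cone s \<Longrightarrow> 0 \<in> s"
  unfolding real_cone_def by (metis all_not_in_conv order_refl scaleR_zero_left)

lemma real_cone_integral_cone: "real_cone s \<Longrightarrow> integral_cone s"
  by (simp add: real_cone_zero integral_cone_def) (simp add: real_cone_def)

lemma real_coneI:
  assumes "0 \<in> s" "\<And>x y. x \<in> s \<Longrightarrow> y \<in> s \<Longrightarrow> x + y \<in> s"
    "\<And>x r. x \<in> s \<Longrightarrow> r > 0 \<Longrightarrow> r *\<^sub>R x \<in> s"
  shows "real_cone s"
proof -
  have "r *\<^sub>R x \<in> s" if "x \<in> s" "r \<ge> 0" for x r
    using assms that by (cases "r = 0") auto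
  then show ?thesis
    using assms(1,2) unfolding real_cone_def by blast
qed

text \<open>The generators are closed under doubling, and the preimage of a convex set under
  doubling is convex, so the hull is closed under doubling. Then x + y is the double of a midpoint,
  and r x is reached by shrinking x towards 0 by the factor r / 2^n and doubling n times.\<close>

lemma real_cone_conv:
  assumes s: "integral_cone s"
  shows "real_cone (conv s)"
proof -
  let ?c = "conv s"
  have conv: "convex ?c"
    by (simp add: conv_def)
  have zero: "0 \<in> ?c"
    using s hull_inc[of 0 "tensor_one ` s" convex] tensor_one_zero
    by (force simp: conv_def integral_cone_def)
  have "?c \<subseteq> {x. 2 *\<^sub>R x \<in> ?c}"
    unfolding conv_def
  proof (rule hull_minimal)
    show "tensor_one ` s \<subseteq> {x. 2 *\<^sub>R x \<in> convex hull (tensor_one ` s)}"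
    proof clarify
      fix x assume "x \<in> s"
      then have "tensor_one (x + x) \<in> tensor_one ` s"
        using s by (auto simp: integral_cone_def)
      then show "2 *\<^sub>R tensor_one x \<in> convex hull (tensor_one ` s)"
        by (simp add: tensor_one_add scaleR_2 hull_inc)
    qed
    have "convex ((\<lambda>x. 2 *\<^sub>R x) -` ?c)"
      using conv by (intro convex_linear_vimage linear_scaleR)
    then show "convex {x. 2 *\<^sub>R x \<in> convex hull (tensor_one ` s)}"
      by (simp add: vimage_def conv_def)
  qed
  then have dbl: "2 *\<^sub>R x \<in> ?c" if "x \<in> ?c" for x
    using that by blast
  have pow: "(2 ^ n) *\<^sub>R x \<in> ?c" if "x \<in> ?c" for n :: nat and x
  proof (induction n)
    case (Suc n)
    then show ?case
      using dbl[of "2 ^ n *\<^sub>R x"] by simp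
  qed (use that in simp)
  show ?thesis
  proof (rule real_coneI)
    show "0 \<in> ?c" by (rule zero)
    fix x y assume xy: "x \<in> ?c" "y \<in> ?c"
    have "(1/2) *\<^sub>R x + (1/2) *\<^sub>R y \<in> ?c"
      using conv xy by (intro convexD) auto
    then show "x + y \<in> ?c"
      using dbl by (fastforce simp: scaleR_add_right)
  next
    fix x and r :: real assume x: "x \<in> ?c" and r: "r > 0"
    obtain n where n: "r < 2 ^ n"
      using real_arch_pow[of 2 r] by auto
    have "(1 - r / 2 ^ n) *\<^sub>R 0 + (r / 2 ^ n) *\<^sub>R x \<in> ?c"
      using conv x r n zero by (intro convexD) auto
    then have "(2 ^ n) *\<^sub>R ((r / 2 ^ n) *\<^sub>R x) \<in> ?c"
      by (intro pow) simp
    then show "r *\<^sub>R x \<in> ?c"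
      by simp
  qed
qed

lemma tensor_one_in_conv: "x \<in> s \<Longrightarrow> tensor_one x \<in> conv s"
  by (simp add: conv_def hull_inc)

lemma conv_minimal:
  assumes "real_cone c" "\<And>x. x \<in> s \<Longrightarrow> tensor_one x \<in> c"
  shows "conv s \<subseteq> c"
  unfolding conv_def using assms
  by (intro hull_minimal) (auto simp: real_cone_def convex_def)

lemma conv_plus: "conv (s + t) = conv s + conv t"
proof -
  have "tensor_one ` (s + t) = tensor_one ` s + tensor_one ` t"
    by (force simp: set_plus_def tensor_one_add)
  then show ?thesis
    by (simp add: conv_def convex_hull_set_plus)
qed

lemma conv_minkowski_diff:
  assumes s: "integral_cone s" and t: "integral_cone t"
  shows "conv (s \<ominus>\<^sub>M t) = conv s \<ominus>\<^sub>M conv t"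
proof -
  have neg: "convex hull (uminus ` (tensor_one ` t)) = uminus ` conv t"
    unfolding conv_def by (rule convex_hull_linear_image[symmetric]) (simp add: linear_iff)
  have eq: "A \<ominus>\<^sub>M B = A + uminus ` B" for A B :: "'b::ab_group_add set"
    by (force simp: minkowski_diff_def set_plus_def)
  have "tensor_one ` (s \<ominus>\<^sub>M t) = tensor_one ` s + uminus ` (tensor_one ` t)"
    unfolding eq[symmetric] by (force simp: minkowski_diff_def tensor_one_diff)
  then show ?thesis
    by (simp add: conv_def convex_hull_set_plus neg eq)
qed

text \<open>Faces are defined by addition alone, so their stability under positive scalars has to be
  derived. A face contains the summands of its elements; hence an element of t, being a non-negative
  combination of generators, involves only generators that lie in t.\<close>

lemma face_of_conv:
  assumes s: "integral_cone s" and t: "cone_face t (conv s)"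
  defines "t0 \<equiv> {x \<in> s. tensor_one x \<in> t}"
  shows "cone_face t0 s" "conv t0 = t"
proof -
  have cone: "real_cone (conv s)"
    by (rule real_cone_conv[OF s])
  have mem: "\<And>x. x \<in> t \<Longrightarrow> x \<in> conv s"
    and face: "\<And>x y. x \<in> conv s \<Longrightarrow> y \<in> conv s \<Longrightarrow> x + y \<in> t \<longleftrightarrow> x \<in> t \<and> y \<in> t"
    using t by (auto simp: cone_face_def)
  have zero: "0 \<in> t"
    using cone_face_zero[OF t real_cone_zero[OF cone]] .
  \<comment> \<open>Natural multiples come from repeated addition, and every smaller real multiple
    is a summand of such a multiple inside \<open>conv s\<close>.\<close>
  have scale: "r *\<^sub>R x \<in> t \<longleftrightarrow> x \<in> t" if x: "x \<in> conv s" and r: "r > 0" for x r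
  proof
    have sc: "a *\<^sub>R x \<in> conv s" if "a \<ge> 0" for a
      using cone x that by (auto simp: real_cone_def)
    have mult: "real n *\<^sub>R y \<in> t" if "y \<in> t" for n y
      by (induction n) (use that face mem cone zero in
          \<open>auto simp: scaleR_add_left real_cone_def\<close>)
    have le: "b *\<^sub>R x \<in> t" if "0 \<le> b" "b \<le> a" "a *\<^sub>R x \<in> t" for a b
    proof -
      have "b *\<^sub>R x + (a - b) *\<^sub>R x \<in> t"
        using that by (simp flip: scaleR_add_left)
      then show ?thesis
        using face sc that by (metis diff_ge_0_iff_ge)
    qed
    show "x \<in> t" if "r *\<^sub>R x \<in> t"
    proof -
      obtain n where "1 < real n * r"
        using reals_Archimedean3[OF r] by blast
      then show ?thesis
        using le[of 1 "real n * r"] mult[OF that, of n] by simp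
    qed
    show "r *\<^sub>R x \<in> t" if "x \<in> t"
    proof -
      obtain n where "r < real n"
        using reals_Archimedean2 by blast
      then show ?thesis
        using le[of r "real n"] mult[OF that, of n] r by simp
    qed
  qed
  show face0: "cone_face t0 s"
    unfolding cone_face_def
  proof (intro conjI ballI)
    have "0 \<in> t0"
      using s zero by (simp add: t0_def tensor_one_zero integral_cone_def)
    then show "t0 \<noteq> {}" by blast
    fix a b assume "a \<in> s" "b \<in> s"
    then show "a + b \<in> t0 \<longleftrightarrow> a \<in> t0 \<and> b \<in> t0"
      using s face[of "tensor_one a" "tensor_one b"]
      by (auto simp: t0_def tensor_one_add integral_cone_def tensor_one_in_conv)
  qed (auto simp: t0_def)
  have cone0: "real_cone (conv t0)"
    using real_cone_conv cone_face_integral_cone face0 s by blast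
  have conet: "real_cone t"
    using scale mem face zero by (intro real_coneI) auto
  show "conv t0 = t"
  proof
    show "conv t0 \<subseteq> t"
      by (rule conv_minimal[OF conet]) (simp add: t0_def)
    \<comment> \<open>Induction over the real cone generated by s: the set on the right contains the
      generators, and it is closed under sums because a sum lying in the face has its summands
      there.\<close>
    have "conv s \<subseteq> {x \<in> conv s. x \<in> t \<longrightarrow> x \<in> conv t0}"
    proof (rule conv_minimal)
      show "real_cone {x \<in> conv s. x \<in> t \<longrightarrow> x \<in> conv t0}"
      proof (rule real_coneI)
        fix x y assume "x \<in> {x \<in> conv s. x \<in> t \<longrightarrow> x \<in> conv t0}"
          "y \<in> {x \<in> conv s. x \<in> t \<longrightarrow> x \<in> conv t0}"
        then show "x + y \<in> {x \<in> conv s. x \<in> t \<longrightarrow> x \<in> conv t0}"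
          using face[of x y] cone cone0 by (auto simp: real_cone_def)
      next
        fix x r assume "x \<in> {x \<in> conv s. x \<in> t \<longrightarrow> x \<in> conv t0}" "(r::real) > 0"
        then show "r *\<^sub>R x \<in> {x \<in> conv s. x \<in> t \<longrightarrow> x \<in> conv t0}"
          using scale[of x r] cone cone0 by (auto simp: real_cone_def)
      qed (use real_cone_zero cone cone0 in auto)
    qed (auto simp: tensor_one_in_conv t0_def)
    then show "t \<subseteq> conv t0"
      using mem by blast
  qed
qed

lemma real_cofan_realification:
  assumes F: "integral_cofan F"
  shows "real_cofan (realification F)"
proof -
  have cone: "\<And>s. s \<in> F \<Longrightarrow> integral_cone s"
    and face: "\<And>s t. s \<in> F \<Longrightarrow> cone_face t s \<Longrightarrow> s \<ominus>\<^sub>M t \<in> F"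
    and sum: "\<And>s s'. s \<in> F \<Longrightarrow> s' \<in> F \<Longrightarrow> \<exists>t. cone_face t s \<and> s + s' = s \<ominus>\<^sub>M t"
    using F by (auto simp: cofan_def)
  have face': "conv s \<ominus>\<^sub>M t \<in> realification F" if s: "s \<in> F" and t: "cone_face t (conv s)" for s t
  proof -
    let ?t0 = "{x \<in> s. tensor_one x \<in> t}"
    have t0: "cone_face ?t0 s" "conv ?t0 = t"
      using face_of_conv[OF cone[OF s] t] by auto
    have "conv s \<ominus>\<^sub>M t = conv (s \<ominus>\<^sub>M ?t0)"
      using conv_minkowski_diff cone_face_integral_cone cone s t0 by metis
    then show ?thesis
      using face[OF s t0(1)] by (simp add: realification_def)
  qed
  have sum': "\<exists>t. cone_face t (conv s) \<and> conv s + conv s' = conv s \<ominus>\<^sub>M t"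
    if s: "s \<in> F" "s' \<in> F" for s s'
  proof -
    obtain t where t: "cone_face t s" "s + s' = s \<ominus>\<^sub>M t"
      using sum[OF s] by blast
    have ct: "integral_cone t"
      using t cone s cone_face_integral_cone by blast
    have "conv s + conv s' = conv s \<ominus>\<^sub>M conv t"
      using t conv_plus[of s s'] conv_minkowski_diff[OF cone[OF s(1)] ct] by simp
    moreover have "conv t \<subseteq> conv s"
      using t unfolding conv_def cone_face_def by (intro hull_mono image_mono) auto
    \<comment> \<open>\<open>conv t\<close> enters only as a subcone of \<open>conv s\<close>;
      \<open>cofaces_eq_faces\<close> then supplies a face with the same difference.\<close>
    then have "conv s \<ominus>\<^sub>M conv t \<in> cofaces (conv s)"
      using real_cone_integral_cone[OF real_cone_conv[OF ct]] unfolding cofaces_def by blast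
    ultimately show ?thesis
      using cofaces_eq_faces[OF real_cone_integral_cone[OF real_cone_conv[OF cone[OF s(1)]]]]
      by auto
  qed
  show ?thesis
    using real_cone_conv cone face' sum' unfolding cofan_def
    by (auto simp: realification_def)
qed

section \<open>Preadditive categories\<close>

lemma (in category) iso_arrow_id: "X \<in> Ob C \<Longrightarrow> iso_arrow C X X (Id C X)"
  using id_in_hom id_left unfolding iso_arrow_def by blast

lemma (in category) isomorphic_refl: "X \<in> Ob C \<Longrightarrow> isomorphic_in C X X"
  using iso_arrow_id unfolding isomorphic_in_def by blast

lemma isomorphic_sym: "isomorphic_in C X Y \<Longrightarrow> isomorphic_in C Y X"
  unfolding isomorphic_in_def iso_arrow_def by blast

text \<open>The part of \<open>additive_category\<close> that is inherited by every full
  subcategory, so that it applies to a heart before anything about zero objects or biproducts there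
  is known.\<close>

locale preadditive_category = category C
  for C :: "('o, 'm, 'z) add_cat_scheme" (structure) +
  assumes comm_group_hom: "\<lbrakk>X \<in> Ob C; Y \<in> Ob C\<rbrakk> \<Longrightarrow> comm_group (hom_group C X Y)"
    and comp_distrib_left:
      "\<lbrakk>X \<in> Ob C; Y \<in> Ob C; Z \<in> Ob C; f \<in> Hom C X Y; g \<in> Hom C Y Z; g' \<in> Hom C Y Z\<rbrakk>
        \<Longrightarrow> (g \<boxplus> g') \<odot> f = (g \<odot> f) \<boxplus> (g' \<odot> f)"
    and comp_distrib_right:
      "\<lbrakk>X \<in> Ob C; Y \<in> Ob C; Z \<in> Ob C; f \<in> Hom C X Y; f' \<in> Hom C X Y; g \<in> Hom C Y Z\<rbrakk>
        \<Longrightarrow> g \<odot> (f \<boxplus> f') = (g \<odot> f) \<boxplus> (g \<odot> f')"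

sublocale additive_category \<subseteq> preadditive_category
  by (intro preadditive_category.intro category_axioms preadditive_category_axioms.intro)
    (fact hom_group comp_add_left comp_add_right)+

lemma hom_group_simps [simp]:
  "carrier (hom_group C X Y) = Hom C X Y"
  "monoid.mult (hom_group C X Y) = Add C"
  "one (hom_group C X Y) = Zero C X Y"
  by (simp_all add: hom_group_def)

text \<open>Only an inclusion in {0}, which is what gets used and proved; for objects it agrees with
  the equation in \<open>t_structure\<close> by \<open>hom_zero_iff\<close>.\<close>

definition hom_zero :: "('o, 'm, 'z) add_cat_scheme \<Rightarrow> 'o \<Rightarrow> 'o \<Rightarrow> bool" where
  "hom_zero C X Y \<longleftrightarrow> (\<forall>f \<in> Hom C X Y. f = Zero C X Y)"

lemma hom_zeroD: "hom_zero C X Y \<Longrightarrow> f \<in> Hom C X Y \<Longrightarrow> f = Zero C X Y"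
  by (simp add: hom_zero_def)

context preadditive_category
begin

lemma zero_hom: "X \<in> Ob C \<Longrightarrow> Y \<in> Ob C \<Longrightarrow> Zero C X Y \<in> Hom C X Y"
  using monoid.one_closed[of "hom_group C X Y"] comm_group_hom[of X Y]
  by (simp add: comm_group_def comm_monoid_def)

lemma add_hom:
  "X \<in> Ob C \<Longrightarrow> Y \<in> Ob C \<Longrightarrow> f \<in> Hom C X Y \<Longrightarrow> g \<in> Hom C X Y \<Longrightarrow> f \<boxplus> g \<in> Hom C X Y"
  using monoid.m_closed[of "hom_group C X Y" f g] comm_group_hom[of X Y]
  by (simp add: comm_group_def comm_monoid_def)

lemma group_hom: "X \<in> Ob C \<Longrightarrow> Y \<in> Ob C \<Longrightarrow> group (hom_group C X Y)"
  using comm_group_hom by (simp add: comm_group_def)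

lemma neg_hom:
  "X \<in> Ob C \<Longrightarrow> Y \<in> Ob C \<Longrightarrow> f \<in> Hom C X Y \<Longrightarrow> neg_arrow C X Y f \<in> Hom C X Y"
  using group.inv_closed[OF group_hom[of X Y], of f] by simp

lemma neg_neg:
  "X \<in> Ob C \<Longrightarrow> Y \<in> Ob C \<Longrightarrow> f \<in> Hom C X Y \<Longrightarrow> neg_arrow C X Y (neg_arrow C X Y f) = f"
  using group.inv_inv[OF group_hom[of X Y], of f] by simp

lemma neg_zero: "X \<in> Ob C \<Longrightarrow> Y \<in> Ob C \<Longrightarrow> neg_arrow C X Y (Zero C X Y) = Zero C X Y"
  using group_hom[of X Y] by (metis group.is_monoid hom_group_simps(3) monoid.inv_one)

lemma add_neg:
  "X \<in> Ob C \<Longrightarrow> Y \<in> Ob C \<Longrightarrow> f \<in> Hom C X Y \<Longrightarrow> f \<boxplus> neg_arrow C X Y f = Zero C X Y"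
  using group.r_inv[OF group_hom[of X Y], of f] by simp

lemma neg_unique:
  assumes "X \<in> Ob C" "Y \<in> Ob C" "f \<in> Hom C X Y" "g \<in> Hom C X Y" "f \<boxplus> g = Zero C X Y"
  shows "g = neg_arrow C X Y f"
  using group.inv_equality[OF group_hom[of X Y], of f g] assms
    group.inv_inv[OF group_hom[of X Y], of g] by simp

lemma idempotent_zero:
  assumes "X \<in> Ob C" "Y \<in> Ob C" "f \<in> Hom C X Y" "f \<boxplus> f = f"
  shows "f = Zero C X Y"
  using group.l_cancel_one[OF group_hom[of X Y], of f f] assms by simp

lemma comp_zero_left:
  assumes "X \<in> Ob C" "Y \<in> Ob C" "Z \<in> Ob C" "f \<in> Hom C X Y"
  shows "Zero C Y Z \<odot> f = Zero C X Z"
proof (rule idempotent_zero)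
  have "Zero C Y Z \<boxplus> Zero C Y Z = Zero C Y Z"
    using add_neg neg_zero zero_hom assms by metis
  then show "Zero C Y Z \<odot> f \<boxplus> Zero C Y Z \<odot> f = Zero C Y Z \<odot> f"
    using comp_distrib_left[OF assms] zero_hom assms by metis
qed (use assms zero_hom comp_in_hom in auto)

lemma comp_zero_right:
  assumes "X \<in> Ob C" "Y \<in> Ob C" "Z \<in> Ob C" "g \<in> Hom C Y Z"
  shows "g \<odot> Zero C X Y = Zero C X Z"
proof (rule idempotent_zero)
  have "Zero C X Y \<boxplus> Zero C X Y = Zero C X Y"
    using add_neg neg_zero zero_hom assms by metis
  then show "g \<odot> Zero C X Y \<boxplus> g \<odot> Zero C X Y = g \<odot> Zero C X Y"
    using comp_distrib_right zero_hom assms by metis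
qed (use assms zero_hom comp_in_hom in auto)

lemma neg_comp:
  assumes "X \<in> Ob C" "Y \<in> Ob C" "Z \<in> Ob C" "f \<in> Hom C X Y" "g \<in> Hom C Y Z"
  shows "neg_arrow C Y Z g \<odot> f = neg_arrow C X Z (g \<odot> f)"
proof (rule neg_unique)
  show "g \<odot> f \<boxplus> neg_arrow C Y Z g \<odot> f = Zero C X Z"
    using comp_distrib_left[of X Y Z f g "neg_arrow C Y Z g"] assms neg_hom add_neg comp_zero_left
    by metis
qed (use assms neg_hom comp_in_hom in auto)

lemma comp_neg:
  assumes "X \<in> Ob C" "Y \<in> Ob C" "Z \<in> Ob C" "f \<in> Hom C X Y" "g \<in> Hom C Y Z"
  shows "g \<odot> neg_arrow C X Y f = neg_arrow C X Z (g \<odot> f)"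
proof (rule neg_unique)
  show "g \<odot> f \<boxplus> g \<odot> neg_arrow C X Y f = Zero C X Z"
    using comp_distrib_right[of X Y Z f "neg_arrow C X Y f" g] assms neg_hom add_neg comp_zero_right
    by metis
qed (use assms neg_hom comp_in_hom in auto)

lemma neg_inj:
  assumes "X \<in> Ob C" "Y \<in> Ob C" "f \<in> Hom C X Y" "g \<in> Hom C X Y"
    "neg_arrow C X Y f = neg_arrow C X Y g"
  shows "f = g"
  using assms neg_neg by metis

text \<open>Cancellation tested by differences. The test object W is fixed, because a triangle gives
  cancellation only against those W for which some Hom group vanishes.\<close>

lemma left_cancel:
  assumes X: "W \<in> Ob C" "A \<in> Ob C" "X \<in> Ob C" "m \<in> Hom C A X"
    and z: "\<And>u. u \<in> Hom C W A \<Longrightarrow> m \<odot> u = Zero C W X \<Longrightarrow> u = Zero C W A"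
    and uv: "u \<in> Hom C W A" "v \<in> Hom C W A" "m \<odot> u = m \<odot> v"
  shows "u = v"
proof -
  let ?n = "neg_arrow C W A v"
  have n: "?n \<in> Hom C W A"
    using neg_hom X uv by blast
  have "m \<odot> (u \<boxplus> ?n) = m \<odot> u \<boxplus> neg_arrow C W X (m \<odot> v)"
    using comp_distrib_right[OF X(1-3) uv(1) n X(4)] comp_neg[OF X(1-3) uv(2) X(4)] by simp
  also have "\<dots> = Zero C W X"
    using uv(3) add_neg[OF X(1,3)] comp_in_hom[OF X(1-3) uv(2) X(4)] by simp
  finally have "u \<boxplus> ?n = Zero C W A"
    using z[OF add_hom[OF X(1,2) uv(1) n]] by blast
  then have "?n = neg_arrow C W A u"
    by (rule neg_unique[OF X(1,2) uv(1) n])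
  then show ?thesis
    using neg_inj[OF X(1,2) uv(1,2)] by simp
qed

lemma right_cancel:
  assumes X: "W \<in> Ob C" "A \<in> Ob C" "X \<in> Ob C" "m \<in> Hom C X A"
    and z: "\<And>u. u \<in> Hom C A W \<Longrightarrow> u \<odot> m = Zero C X W \<Longrightarrow> u = Zero C A W"
    and uv: "u \<in> Hom C A W" "v \<in> Hom C A W" "u \<odot> m = v \<odot> m"
  shows "u = v"
proof -
  let ?n = "neg_arrow C A W v"
  have n: "?n \<in> Hom C A W"
    using neg_hom X uv by blast
  have "(u \<boxplus> ?n) \<odot> m = u \<odot> m \<boxplus> neg_arrow C X W (v \<odot> m)"
    using comp_distrib_left[OF X(3,2,1,4) uv(1) n] neg_comp[OF X(3,2,1,4) uv(2)] by simp
  also have "\<dots> = Zero C X W"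
    using uv(3) add_neg[OF X(3,1)] comp_in_hom[OF X(3,2,1,4) uv(2)] by simp
  finally have "u \<boxplus> ?n = Zero C A W"
    using z[OF add_hom[OF X(2,1) uv(1) n]] by blast
  then have "?n = neg_arrow C A W u"
    by (rule neg_unique[OF X(2,1) uv(1) n])
  then show ?thesis
    using neg_inj[OF X(2,1) uv(1,2)] by simp
qed

lemma mono_arrow_iff:
  assumes "A \<in> Ob C" "X \<in> Ob C"
  shows "mono_arrow C A X m \<longleftrightarrow> m \<in> Hom C A X \<and>
    (\<forall>W \<in> Ob C. \<forall>u \<in> Hom C W A. m \<odot> u = Zero C W X \<longrightarrow> u = Zero C W A)"
    (is "_ \<longleftrightarrow> ?mono")
proof
  assume m: "mono_arrow C A X m"
  then have h: "m \<in> Hom C A X"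
    by (simp add: mono_arrow_def)
  show ?mono
  proof (intro conjI ballI impI h)
    fix W u assume "W \<in> Ob C" "u \<in> Hom C W A" "m \<odot> u = Zero C W X"
    then show "u = Zero C W A"
      using m comp_zero_right[of W A X m] zero_hom[of W A] assms h unfolding mono_arrow_def by auto
  qed
next
  assume ?mono
  then show "mono_arrow C A X m"
    unfolding mono_arrow_def using left_cancel assms by blast
qed

lemma hom_zero_iff: "X \<in> Ob C \<Longrightarrow> Y \<in> Ob C \<Longrightarrow> hom_zero C X Y \<longleftrightarrow> Hom C X Y = {Zero C X Y}"
  using zero_hom unfolding hom_zero_def by blast

text \<open>If End N is trivial, the identity of N is zero, and every arrow into or out of N is a
  composite with it.\<close>

lemma zero_object_iff: "zero_object C N \<longleftrightarrow> N \<in> Ob C \<and> hom_zero C N N"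
proof
  assume N: "zero_object C N"
  then have "N \<in> Ob C" "\<exists>!f. f \<in> Hom C N N"
    unfolding zero_object_def by auto
  then show "N \<in> Ob C \<and> hom_zero C N N"
    using zero_hom unfolding hom_zero_def by metis
next
  assume N: "N \<in> Ob C \<and> hom_zero C N N"
  then have id0: "Id C N = Zero C N N"
    using id_in_hom hom_zeroD by metis
  have "f = Zero C X N" if "X \<in> Ob C" "f \<in> Hom C X N" for X f
    using that N id0 id_left comp_zero_left by metis
  moreover have "f = Zero C N X" if "X \<in> Ob C" "f \<in> Hom C N X" for X f
    using that N id0 id_right comp_zero_right by metis
  ultimately show "zero_object C N"
    using N zero_hom unfolding zero_object_def by (intro conjI ballI ex1I) blast+
qed

lemma hom_zero_from_zero:
  assumes "X \<in> Ob C" "Y \<in> Ob C" "hom_zero C X X \<or> hom_zero C Y Y"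
  shows "hom_zero C X Y"
  using assms zero_object_iff zero_hom unfolding zero_object_def hom_zero_def by metis

lemma hom_zero_iso:
  assumes ob: "X \<in> Ob C" "X' \<in> Ob C" "Y \<in> Ob C" "Y' \<in> Ob C"
    and iso: "isomorphic_in C X X'" "isomorphic_in C Y Y'" and z: "hom_zero C X Y"
  shows "hom_zero C X' Y'"
  unfolding hom_zero_def
proof
  fix f assume f: "f \<in> Hom C X' Y'"
  obtain a a' where a: "a \<in> Hom C X X'" "a' \<in> Hom C X' X" "a \<odot> a' = Id C X'"
    using iso unfolding isomorphic_in_def iso_arrow_def by blast
  obtain b b' where b: "b \<in> Hom C Y Y'" "b' \<in> Hom C Y' Y" "b \<odot> b' = Id C Y'"
    using iso unfolding isomorphic_in_def iso_arrow_def by blast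
  have fa: "f \<odot> a \<in> Hom C X Y'" "b' \<odot> (f \<odot> a) \<in> Hom C X Y"
    using f a b ob comp_in_hom by metis+
  then have "b' \<odot> (f \<odot> a) = Zero C X Y"
    using z hom_zeroD by metis
  then have "b \<odot> (b' \<odot> (f \<odot> a)) = Zero C X Y'"
    using b ob comp_zero_right by metis
  then have "f \<odot> a = Zero C X Y'"
    using comp_assoc[of X Y' Y Y' "f \<odot> a" b' b] fa b ob id_left by metis
  then have "(f \<odot> a) \<odot> a' = Zero C X' Y'"
    using a ob comp_zero_left by metis
  then show "f = Zero C X' Y'"
    using comp_assoc[of X' X X' Y' a' a f] a f ob id_right by metis
qed

end

section \<open>Additive and fully faithful functors\<close>

lemma
  assumes "additive_functor C D Fo Fm"
  shows additive_functor_ob: "X \<in> Ob C \<Longrightarrow> Fo X \<in> Ob D"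
    and additive_functor_id: "X \<in> Ob C \<Longrightarrow> Fm (Id C X) = Id D (Fo X)"
    and additive_functor_hom:
      "X \<in> Ob C \<Longrightarrow> Y \<in> Ob C \<Longrightarrow> f \<in> Hom C X Y \<Longrightarrow> Fm f \<in> Hom D (Fo X) (Fo Y)"
    and additive_functor_comp:
      "X \<in> Ob C \<Longrightarrow> Y \<in> Ob C \<Longrightarrow> Z \<in> Ob C \<Longrightarrow> f \<in> Hom C X Y \<Longrightarrow> g \<in> Hom C Y Z \<Longrightarrow>
        Fm (Comp C g f) = Comp D (Fm g) (Fm f)"
    and additive_functor_add:
      "X \<in> Ob C \<Longrightarrow> Y \<in> Ob C \<Longrightarrow> f \<in> Hom C X Y \<Longrightarrow> g \<in> Hom C X Y \<Longrightarrow>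
        Fm (Add C f g) = Add D (Fm f) (Fm g)"
  using assms unfolding additive_functor_def by blast+

lemma additive_functor_zero:
  assumes "preadditive_category C" "preadditive_category D" "additive_functor C D Fo Fm"
    "X \<in> Ob C" "Y \<in> Ob C"
  shows "Fm (Zero C X Y) = Zero D (Fo X) (Fo Y)"
proof -
  interpret C: preadditive_category C by fact
  interpret D: preadditive_category D by fact
  have z: "Zero C X Y \<in> Hom C X Y"
    using C.zero_hom assms by blast
  have "Add C (Zero C X Y) (Zero C X Y) = Zero C X Y"
    using C.add_neg[OF _ _ z] C.neg_zero assms by metis
  then have "Add D (Fm (Zero C X Y)) (Fm (Zero C X Y)) = Fm (Zero C X Y)"
    using additive_functor_add[OF assms(3-5) z z] by simp
  then show ?thesis
    by (rule D.idempotent_zero[rotated -1])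
      (intro additive_functor_ob[OF assms(3)] additive_functor_hom[OF assms(3)] assms z)+
qed

lemma fully_faithfulD:
  "fully_faithful C D Fo Fm \<Longrightarrow> X \<in> Ob C \<Longrightarrow> Y \<in> Ob C \<Longrightarrow>
    bij_betw Fm (Hom C X Y) (Hom D (Fo X) (Fo Y))"
  by (simp add: fully_faithful_def)

lemma fully_faithful_inj:
  assumes "fully_faithful C D Fo Fm" "X \<in> Ob C" "Y \<in> Ob C"
    and "f \<in> Hom C X Y" "g \<in> Hom C X Y" "Fm f = Fm g"
  shows "f = g"
  using bij_betw_imp_inj_on[OF fully_faithfulD[OF assms(1-3)]] assms(4-6) by (auto dest: inj_onD)

lemma fully_faithful_surj:
  assumes "fully_faithful C D Fo Fm" "X \<in> Ob C" "Y \<in> Ob C" "f \<in> Hom D (Fo X) (Fo Y)"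
  obtains g where "g \<in> Hom C X Y" "Fm g = f"
  using bij_betw_imp_surj_on[OF fully_faithfulD[OF assms(1-3)]] assms(4) that
  by (auto elim!: equalityE)

section \<open>Triangulated categories\<close>

text \<open>X lies in A * B, the extensions of B by A. Most arguments need only that a triangle
  exists, which also makes the signs of rotations disappear.\<close>

definition is_ext :: "('o, 'm, 'z) tri_cat_scheme \<Rightarrow> 'o \<Rightarrow> 'o \<Rightarrow> 'o \<Rightarrow> bool" where
  "is_ext D A X B \<longleftrightarrow> (\<exists>f g h. Tri D A X B f g h)"

context triangulated_category
begin

abbreviation sh :: "int \<Rightarrow> 'o \<Rightarrow> 'o" where "sh \<equiv> shift_obj D"

abbreviation hz :: "'o \<Rightarrow> 'o \<Rightarrow> bool" where "hz \<equiv> hom_zero D"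

abbreviation ext :: "'o \<Rightarrow> 'o \<Rightarrow> 'o \<Rightarrow> bool" where "ext \<equiv> is_ext D"

section \<open>Shifts of objects and arrows\<close>

lemma ShO_ob: "X \<in> Ob D \<Longrightarrow> ShO D X \<in> Ob D"
  using shift_bij bij_betwE by blast

lemma ShO_inj: "X \<in> Ob D \<Longrightarrow> Y \<in> Ob D \<Longrightarrow> ShO D X = ShO D Y \<Longrightarrow> X = Y"
  using shift_bij by (meson bij_betw_imp_inj_on inj_onD)

lemma ShM_hom:
  "X \<in> Ob D \<Longrightarrow> Y \<in> Ob D \<Longrightarrow> f \<in> Hom D X Y \<Longrightarrow> ShM D f \<in> Hom D (ShO D X) (ShO D Y)"
  using additive_functor_hom[OF shift_functor] .

lemmas ShM_inj = fully_faithful_inj[OF shift_fully_faithful]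
  and ShM_surj = fully_faithful_surj[OF shift_fully_faithful]

lemma ShM_comp:
  "X \<in> Ob D \<Longrightarrow> Y \<in> Ob D \<Longrightarrow> Z \<in> Ob D \<Longrightarrow> f \<in> Hom D X Y \<Longrightarrow> g \<in> Hom D Y Z \<Longrightarrow>
    ShM D (g \<odot> f) = ShM D g \<odot> ShM D f"
  using additive_functor_comp[OF shift_functor] .

lemma ShM_id: "X \<in> Ob D \<Longrightarrow> ShM D (Id D X) = Id D (ShO D X)"
  using additive_functor_id[OF shift_functor] .

lemma ShM_zero: "X \<in> Ob D \<Longrightarrow> Y \<in> Ob D \<Longrightarrow> ShM D (Zero D X Y) = Zero D (ShO D X) (ShO D Y)"
  using additive_functor_zero[OF preadditive_category_axioms preadditive_category_axioms shift_functor] .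

lemma hz_ShO: "X \<in> Ob D \<Longrightarrow> Y \<in> Ob D \<Longrightarrow> hz (ShO D X) (ShO D Y) \<longleftrightarrow> hz X Y"
  unfolding hom_zero_def
  by (metis ShM_hom ShM_inj ShM_surj ShM_zero zero_hom)

lemma sh_ob: "X \<in> Ob D \<Longrightarrow> sh n X \<in> Ob D"
proof -
  assume X: "X \<in> Ob D"
  have "(ShO D ^^ k) X \<in> Ob D" for k
    by (induction k) (auto simp: X ShO_ob)
  moreover have "(inv_into (Ob D) (ShO D) ^^ k) X \<in> Ob D" for k
    by (induction k) (use X shift_bij in \<open>auto simp: bij_betw_def inv_into_into\<close>)
  ultimately show ?thesis
    by (simp add: shift_obj_def)
qed

lemma sh_0 [simp]: "sh 0 X = X"
  by (simp add: shift_obj_def)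

lemma sh_succ:
  assumes X: "X \<in> Ob D"
  shows "sh (n + 1) X = ShO D (sh n X)"
proof (cases "n \<ge> 0")
  case True
  then have "nat (n + 1) = Suc (nat n)"
    by simp
  then show ?thesis
    using True by (simp add: shift_obj_def)
next
  case False
  \<comment> \<open>Here n = - k - 1: one shift cancels one of the k + 1 inverse shifts, and n + 1
    is 0 or still negative, which are different cases of \<open>shift_obj\<close>.\<close>
  define k where "k = nat (- n - 1)"
  have n: "n = - int k - 1" and k: "nat (- n) = Suc k"
    using False by (auto simp: k_def)
  let ?i = "inv_into (Ob D) (ShO D)"
  have "(?i ^^ k) X \<in> Ob D"
    by (induction k) (use X shift_bij in \<open>auto simp: bij_betw_def inv_into_into\<close>)
  then have "ShO D (?i ((?i ^^ k) X)) = (?i ^^ k) X"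
    using shift_bij by (metis bij_betw_inv_into_right)
  moreover have "sh n X = ?i ((?i ^^ k) X)"
    using False k by (simp add: shift_obj_def)
  moreover have "sh (n + 1) X = (?i ^^ k) X"
    using n by (cases k) (auto simp: shift_obj_def nat_add_distrib)
  ultimately show ?thesis
    by simp
qed

lemma sh_1: "X \<in> Ob D \<Longrightarrow> sh 1 X = ShO D X"
  using sh_succ[of X 0] by simp

lemma sh_sh: "X \<in> Ob D \<Longrightarrow> sh m (sh n X) = sh (m + n) X"
proof (induction m rule: int_induct[where k = 0])
  case base
  then show ?case by simp
next
  case (step1 i)
  then show ?case
    using sh_succ[of "sh n X" i] sh_succ[of X "i + n"] sh_ob[of X n] by (simp add: algebra_simps)
next
  case (step2 i)
  have "ShO D (sh (i - 1) (sh n X)) = ShO D (sh (i - 1 + n) X)"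
    using step2 sh_succ[of "sh n X" "i - 1"] sh_succ[of X "i - 1 + n"] sh_ob[of X n]
    by (simp add: algebra_simps)
  then show ?case
    using ShO_inj sh_ob step2 by metis
qed

lemma hz_sh: "X \<in> Ob D \<Longrightarrow> Y \<in> Ob D \<Longrightarrow> hz (sh n X) (sh n Y) \<longleftrightarrow> hz X Y"
proof (induction n rule: int_induct[where k = 0])
  case base
  then show ?case by simp
next
  case (step1 i)
  then show ?case
    using sh_succ hz_ShO sh_ob by metis
next
  case (step2 i)
  then show ?case
    using sh_succ[of X "i - 1"] sh_succ[of Y "i - 1"] hz_ShO[of "sh (i - 1) X" "sh (i - 1) Y"] sh_ob
    by simp
qed

lemma hz_sh_add:
  "X \<in> Ob D \<Longrightarrow> Y \<in> Ob D \<Longrightarrow> hz (sh (n + m) X) (sh (n + k) Y) \<longleftrightarrow> hz (sh m X) (sh k Y)"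
  using hz_sh[of "sh m X" "sh k Y" n] by (simp add: sh_sh sh_ob)

section \<open>Rotation of triangles and exactness of Hom\<close>

lemma tri_rot: "Tri D X Y Z f g h \<Longrightarrow> Tri D Y Z (ShO D X) g h (neg_arrow D (ShO D X) (ShO D Y) (ShM D f))"
  using tri_rotate tri_typed by blast

text \<open>Undoing a rotation needs an arrow k out of a desuspension W of Z with - k[1] = h;
  fullness of the shift supplies it.\<close>

lemma tri_unrot:
  assumes T: "Tri D X Y Z f g h" and W: "W \<in> Ob D" "ShO D W = Z"
  obtains k where "k \<in> Hom D W X" "Tri D W X Y k f g" "neg_arrow D (ShO D W) (ShO D X) (ShM D k) = h"
proof -
  have ob: "X \<in> Ob D" "Y \<in> Ob D" "Z \<in> Ob D" "f \<in> Hom D X Y" "g \<in> Hom D Y Z"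
    "h \<in> Hom D Z (ShO D X)"
    using tri_typed[OF T] by auto
  have "neg_arrow D Z (ShO D X) h \<in> Hom D (ShO D W) (ShO D X)"
    using neg_hom ob ShO_ob W by metis
  then obtain k where k: "k \<in> Hom D W X" "ShM D k = neg_arrow D Z (ShO D X) h"
    using ShM_surj W ob by metis
  then have "neg_arrow D (ShO D W) (ShO D X) (ShM D k) = h"
    using neg_neg ob ShO_ob W by metis
  moreover from this have "Tri D W X Y k f g"
    using tri_rotate[of W X Y k f g] T W ob k by simp
  ultimately show ?thesis
    using that k by blast
qed

text \<open>The triangle X -> X -> 0 maps to the given one by (Id, f), so the composite factors
  through a zero object.\<close>

lemma tri_comp_zero:
  assumes T: "Tri D X Y Z f g h"
  shows "g \<odot> f = Zero D X Z"
proof -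
  have ob: "X \<in> Ob D" "Y \<in> Ob D" "Z \<in> Ob D" "f \<in> Hom D X Y" "g \<in> Hom D Y Z"
    using tri_typed[OF T] by auto
  obtain N where N: "zero_object D N"
    using has_zero_object by blast
  then have NO: "N \<in> Ob D"
    by (simp add: zero_object_def)
  obtain c where c: "c \<in> Hom D N Z" "g \<odot> f = c \<odot> Zero D X N"
    using tri_morphism[OF tri_id[OF ob(1) N] T id_in_hom[OF ob(1)] ob(4) refl] by blast
  then show ?thesis
    using comp_zero_right ob NO by metis
qed

text \<open>Exactness of Hom(W, -) at Y. The rotated triangle W -> 0 -> W[1] maps to Y -> Z -> X[1]
  by (u, 0); the third arrow W[1] -> X[1] is the shift of v, and the two rotation signs
  cancel.\<close>

lemma tri_factor:
  assumes T: "Tri D X Y Z f g h" and u: "W \<in> Ob D" "u \<in> Hom D W Y" "g \<odot> u = Zero D W Z"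
  obtains v where "v \<in> Hom D W X" "f \<odot> v = u"
proof -
  have ob: "X \<in> Ob D" "Y \<in> Ob D" "Z \<in> Ob D" "f \<in> Hom D X Y" "g \<in> Hom D Y Z"
    using tri_typed[OF T] by auto
  obtain N where N: "zero_object D N"
    using has_zero_object by blast
  then have NO: "N \<in> Ob D"
    by (simp add: zero_object_def)
  let ?nf = "neg_arrow D (ShO D X) (ShO D Y) (ShM D f)"
  let ?ni = "neg_arrow D (ShO D W) (ShO D W) (ShM D (Id D W))"
  have W1: "ShO D W \<in> Ob D" "ShO D X \<in> Ob D" "ShO D Y \<in> Ob D"
    using ShO_ob u ob by auto
  have "Zero D N Z \<odot> Zero D W N = g \<odot> u"
    using u comp_zero_right zero_hom NO ob by metis
  then obtain c where c: "c \<in> Hom D (ShO D W) (ShO D X)" "?nf \<odot> c = ShM D u \<odot> ?ni"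
    using tri_morphism[OF tri_rot[OF tri_id[OF u(1) N]] tri_rot[OF T] u(2) zero_hom[OF NO ob(3)]]
    by metis
  obtain v where v: "v \<in> Hom D W X" "ShM D v = c"
    using ShM_surj c u ob by metis
  have h: "ShM D f \<in> Hom D (ShO D X) (ShO D Y)" "ShM D u \<in> Hom D (ShO D W) (ShO D Y)"
    using ShM_hom u ob by auto
  have "?nf \<odot> c = neg_arrow D (ShO D W) (ShO D Y) (ShM D f \<odot> c)"
    using neg_comp[OF W1(1,2,3) c(1) h(1)] .
  moreover have "ShM D u \<odot> ?ni = neg_arrow D (ShO D W) (ShO D Y) (ShM D u)"
    using comp_neg[OF W1(1,1,3) id_in_hom[OF W1(1)] h(2)] ShM_id u id_right W1 h by simp
  ultimately have "ShM D f \<odot> c = ShM D u"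
    using neg_inj[OF W1(1,3)] c(2) comp_in_hom[OF W1(1,2,3) c(1) h(1)] h(2) by metis
  then have "ShM D (f \<odot> v) = ShM D u"
    using ShM_comp[OF u(1) ob(1,2) v(1) ob(4)] v by simp
  then have "f \<odot> v = u"
    using ShM_inj[OF u(1) ob(2)] comp_in_hom[OF u(1) ob(1,2) v(1) ob(4)] u by blast
  then show ?thesis
    using that v by blast
qed

text \<open>Exactness of Hom(-, W) at Y: the given triangle maps to 0 -> W -> W by (0, u), and the
  third arrow is v. The triangle 0 -> W -> W is an identity triangle rotated back, for which the
  zero object must be shifted.\<close>

lemma tri_cofactor:
  assumes T: "Tri D X Y Z f g h" and u: "W \<in> Ob D" "u \<in> Hom D Y W" "u \<odot> f = Zero D X W"
  obtains v where "v \<in> Hom D Z W" "v \<odot> g = u"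
proof -
  have ob: "X \<in> Ob D" "Y \<in> Ob D" "Z \<in> Ob D" "f \<in> Hom D X Y" "g \<in> Hom D Y Z"
    using tri_typed[OF T] by auto
  obtain N where N: "zero_object D N"
    using has_zero_object by blast
  then have NO: "N \<in> Ob D"
    by (simp add: zero_object_def)
  then have N1: "zero_object D (ShO D N)" "ShO D N \<in> Ob D"
    using N zero_object_iff hz_ShO ShO_ob by metis+
  have "Tri D N W W (Zero D N W) (Id D W) (Zero D W (ShO D N))"
    using tri_rotate[of N W W "Zero D N W" "Id D W" "Zero D W (ShO D N)"] tri_id[OF u(1) N1(1)]
      NO N1 u zero_hom id_in_hom ShM_zero neg_zero ShO_ob by simp
  moreover have "Zero D N W \<odot> Zero D X N = u \<odot> f"
    using comp_zero_right zero_hom NO u ob by metis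
  ultimately obtain c where "c \<in> Hom D Z W" "Id D W \<odot> u = c \<odot> g"
    using tri_morphism[OF T _ zero_hom[OF ob(1) NO] u(2)] by blast
  then show ?thesis
    using that id_left ob u by metis
qed

section \<open>Extensions\<close>

lemma ext_ob: "ext A X B \<Longrightarrow> A \<in> Ob D \<and> X \<in> Ob D \<and> B \<in> Ob D"
  unfolding is_ext_def using tri_typed by blast

lemma ext_rot: "ext A X B \<Longrightarrow> ext X B (sh 1 A)"
  using tri_rot sh_1 ext_ob unfolding is_ext_def by metis

lemma ext_unrot: "ext A X B \<Longrightarrow> ext (sh (- 1) B) A X"
proof -
  assume e: "ext A X B"
  then have "sh (- 1) B \<in> Ob D" "ShO D (sh (- 1) B) = B"
    using ext_ob sh_ob sh_succ[of B "- 1"] by auto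
  then show ?thesis
    using e tri_unrot unfolding is_ext_def by metis
qed

text \<open>Three rotations shift a triangle once; the signs they introduce are hidden by
  \<open>is_ext\<close>.\<close>

lemma ext_sh: "ext A X B \<Longrightarrow> ext (sh n A) (sh n X) (sh n B)"
proof (induction n rule: int_induct[where k = 0])
  case base
  then show ?case by simp
next
  case (step1 i)
  then show ?case
    using ext_rot[OF ext_rot[OF ext_rot[OF step1(2)]]] ext_ob[OF step1(3)]
    by (simp add: sh_sh add.commute)
next
  case (step2 i)
  then show ?case
    using ext_unrot[OF ext_unrot[OF ext_unrot[OF step2(2)]]] ext_ob[OF step2(3)]
    by (simp add: sh_sh)
qed

lemma ext_hz_from: "ext A X B \<Longrightarrow> W \<in> Ob D \<Longrightarrow> hz A W \<Longrightarrow> hz B W \<Longrightarrow> hz X W"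
  unfolding hom_zero_def
proof
  fix u assume W: "W \<in> Ob D" and e: "ext A X B" and z: "\<forall>f\<in>Hom D A W. f = Zero D A W"
    "\<forall>f\<in>Hom D B W. f = Zero D B W" and u: "u \<in> Hom D X W"
  obtain f g h where T: "Tri D A X B f g h"
    using e by (auto simp: is_ext_def)
  note ty = tri_typed[OF T]
  have "u \<odot> f = Zero D A W"
    using z comp_in_hom ty u W by blast
  then obtain v where "v \<in> Hom D B W" "v \<odot> g = u"
    using tri_cofactor[OF T W u] by blast
  then show "u = Zero D X W"
    using z comp_zero_left ty W by metis
qed

lemma ext_hz_to: "ext A X B \<Longrightarrow> W \<in> Ob D \<Longrightarrow> hz W A \<Longrightarrow> hz W B \<Longrightarrow> hz W X"
  unfolding hom_zero_def
proof
  fix u assume W: "W \<in> Ob D" and e: "ext A X B" and z: "\<forall>f\<in>Hom D W A. f = Zero D W A"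
    "\<forall>f\<in>Hom D W B. f = Zero D W B" and u: "u \<in> Hom D W X"
  obtain f g h where T: "Tri D A X B f g h"
    using e by (auto simp: is_ext_def)
  note ty = tri_typed[OF T]
  have "g \<odot> u = Zero D W B"
    using z comp_in_hom ty u W by blast
  then obtain v where "v \<in> Hom D W A" "f \<odot> v = u"
    using tri_factor[OF T W u] by blast
  then show "u = Zero D W X"
    using z comp_zero_right ty W by metis
qed

text \<open>An arrow killed by f factors through Z[-1] -> X, and Hom(W, Z[-1]) vanishes.\<close>

lemma tri_left_cancel_zero:
  assumes T: "Tri D X Y Z f g h" and W: "W \<in> Ob D" "hz W (sh (- 1) Z)"
    and u: "u \<in> Hom D W X" "f \<odot> u = Zero D W Y"
  shows "u = Zero D W X"
proof -
  note ty = tri_typed[OF T]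
  have Z: "sh (- 1) Z \<in> Ob D" "ShO D (sh (- 1) Z) = Z"
    using ty sh_ob sh_succ[of Z "- 1"] by auto
  obtain k where k: "k \<in> Hom D (sh (- 1) Z) X" "Tri D (sh (- 1) Z) X Y k f g"
    using tri_unrot[OF T Z] by blast
  obtain v where v: "v \<in> Hom D W (sh (- 1) Z)" "k \<odot> v = u"
    using tri_factor[OF k(2) W(1) u] by blast
  then show ?thesis
    using hom_zeroD[OF W(2) v(1)] comp_zero_right[OF W(1) Z(1) _ k(1)] ty by auto
qed

lemma tri_right_cancel_zero:
  assumes T: "Tri D X Y Z f g h" and W: "W \<in> Ob D" "hz (sh 1 X) W"
    and u: "u \<in> Hom D Z W" "u \<odot> g = Zero D Y W"
  shows "u = Zero D Z W"
proof -
  note ty = tri_typed[OF T]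
  obtain v where v: "v \<in> Hom D (ShO D X) W" "v \<odot> h = u"
    using tri_cofactor[OF tri_rot[OF T] W(1) u] by blast
  then have "v = Zero D (ShO D X) W"
    using hom_zeroD[OF W(2)] sh_1 ty by simp
  then show ?thesis
    using v comp_zero_left[OF _ ShO_ob W(1)] ty by auto
qed

text \<open>Since g = 0, the identity of X factors through f, which gives a section; left
  cancellation of f against A makes it a two-sided inverse.\<close>

lemma ext_trivial_right:
  assumes e: "ext A X B" and z: "hz B B"
  shows "isomorphic_in D A X"
proof -
  obtain f g h where T: "Tri D A X B f g h"
    using e by (auto simp: is_ext_def)
  note ty = tri_typed[OF T]
  have A: "A \<in> Ob D" and X: "X \<in> Ob D" and f: "f \<in> Hom D A X"
    using ty by auto
  have "hz X B" "hz A (sh (- 1) B)"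
    using hom_zero_from_zero[of X B] hom_zero_from_zero[of A "sh (- 1) B"] hz_sh[of B B "-1"]
      ty z sh_ob[of B "- 1"] by blast+
  then have "g \<odot> Id D X = Zero D X B"
    using hom_zeroD[of D X B g] id_right[of X B g] ty by simp
  then obtain s where s: "s \<in> Hom D X A" "f \<odot> s = Id D X"
    using tri_factor[OF T X id_in_hom[OF X]] by blast
  have "f \<odot> (s \<odot> f) = f \<odot> Id D A"
    using comp_assoc[OF A X A X f s(1) f] s id_left[OF A X f] id_right[OF A X f] by simp
  then have "s \<odot> f = Id D A"
    using left_cancel[OF A A X f tri_left_cancel_zero[OF T A \<open>hz A (sh (- 1) B)\<close>]]
      comp_in_hom[OF A X A f s(1)] id_in_hom[OF A] by blast
  then show ?thesis
    using s f unfolding isomorphic_in_def iso_arrow_def by blast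
qed

lemma ext_trivial_left: "ext A X B \<Longrightarrow> hz A A \<Longrightarrow> isomorphic_in D X B"
  using ext_trivial_right[OF ext_rot] hz_sh[of A A 1] ext_ob by blast

lemma ext_iso:
  assumes e: "ext A X B" and ob: "A' \<in> Ob D" "X' \<in> Ob D" "B' \<in> Ob D"
    and iso: "isomorphic_in D A A'" "isomorphic_in D X X'" "isomorphic_in D B B'"
  shows "ext A' X' B'"
proof -
  obtain f g h where T: "Tri D A X B f g h"
    using e by (auto simp: is_ext_def)
  have A: "A \<in> Ob D" and X: "X \<in> Ob D" and B: "B \<in> Ob D" and f: "f \<in> Hom D A X"
    and g: "g \<in> Hom D X B" and h: "h \<in> Hom D B (ShO D A)" and A1: "ShO D A \<in> Ob D"
    and A1': "ShO D A' \<in> Ob D"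
    using tri_typed[OF T] ShO_ob ob by auto
  obtain a a' where a: "iso_arrow D A A' a" "a \<in> Hom D A A'" "a' \<in> Hom D A' A" "a' \<odot> a = Id D A"
    using iso unfolding isomorphic_in_def iso_arrow_def by blast
  obtain b b' where b: "iso_arrow D X X' b" "b \<in> Hom D X X'" "b' \<in> Hom D X' X" "b' \<odot> b = Id D X"
    using iso unfolding isomorphic_in_def iso_arrow_def by blast
  obtain c c' where c: "iso_arrow D B B' c" "c \<in> Hom D B B'" "c' \<in> Hom D B' B" "c' \<odot> c = Id D B"
    using iso unfolding isomorphic_in_def iso_arrow_def by blast
  have sa: "ShM D a \<in> Hom D (ShO D A) (ShO D A')"
    using ShM_hom a A ob by blast
  have cancel: "(p \<odot> q') \<odot> q = p"
    if "Y \<in> Ob D" "Y' \<in> Ob D" "Z \<in> Ob D" "q \<in> Hom D Y Y'" "q' \<in> Hom D Y' Y" "q' \<odot> q = Id D Y"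
      "p \<in> Hom D Y Z" for p q q' Y Y' Z
    using that comp_assoc id_right by metis
  have bf: "b \<odot> f \<in> Hom D A X'" and cg: "c \<odot> g \<in> Hom D X B'" and ah: "ShM D a \<odot> h \<in> Hom D B (ShO D A')"
    using comp_in_hom A X B ob f g h b c sa A1 A1' by blast+
  have "Tri D A' X' B' ((b \<odot> f) \<odot> a') ((c \<odot> g) \<odot> b') ((ShM D a \<odot> h) \<odot> c')"
  proof (rule tri_iso[OF T])
    show "((b \<odot> f) \<odot> a') \<odot> a = b \<odot> f"
      using cancel a A ob bf by blast
    show "((c \<odot> g) \<odot> b') \<odot> b = c \<odot> g"
      using cancel b X ob cg by blast
    show "((ShM D a \<odot> h) \<odot> c') \<odot> c = ShM D a \<odot> h"
      using cancel c B ob ah A1' by blast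
    show "(b \<odot> f) \<odot> a' \<in> Hom D A' X'" "(c \<odot> g) \<odot> b' \<in> Hom D X' B'"
      "(ShM D a \<odot> h) \<odot> c' \<in> Hom D B' (ShO D A')"
      using comp_in_hom bf cg ah a b c ob A X B A1' by blast+
  qed (use a b c ob in auto)
  then show ?thesis
    by (auto simp: is_ext_def)
qed

lemma ext_id_right: "X \<in> Ob D \<Longrightarrow> zero_object D N \<Longrightarrow> ext X X N"
  unfolding is_ext_def using tri_id by blast

lemma zero_object_sh: "zero_object D N \<Longrightarrow> zero_object D (sh n N)"
  using hz_sh[of N N n] sh_ob[of N n] by (simp add: zero_object_iff)

lemma ext_id_left:
  assumes X: "X \<in> Ob D" and N: "zero_object D N"
  shows "ext N X X"
proof -
  have "N \<in> Ob D"
    using N zero_object_iff by blast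
  then show ?thesis
    using ext_unrot[OF ext_id_right[OF X zero_object_sh[OF N, of 1]]] sh_sh[of N "-1" 1] by simp
qed

text \<open>The octahedral axiom, read as the inclusion of (P * Q) * R in P * (Q * R).\<close>

lemma ext_assoc1:
  assumes "ext P Y Q" "ext Y Z R"
  obtains W where "ext P Z W" "ext Q W R"
proof -
  obtain f i d where T1: "Tri D P Y Q f i d"
    using assms by (auto simp: is_ext_def)
  obtain g j e where T2: "Tri D Y Z R g j e"
    using assms by (auto simp: is_ext_def)
  have "P \<in> Ob D" "Z \<in> Ob D" "g \<odot> f \<in> Hom D P Z"
    using tri_typed[OF T1] tri_typed[OF T2] comp_in_hom by blast+
  then obtain W k l where T3: "Tri D P Z W (g \<odot> f) k l"
    using tri_cone by blast
  then show ?thesis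
    using octahedral[OF T1 T2 T3] that unfolding is_ext_def by blast
qed

text \<open>The converse inclusion: apply \<open>ext_assoc1\<close> to the rotated triangles and
  shift the result back by one.\<close>

lemma ext_assoc2:
  assumes "ext P Z W" "ext Q W R"
  obtains Y where "ext P Y Q" "ext Y Z R"
proof -
  have ob: "P \<in> Ob D" "Q \<in> Ob D" "Z \<in> Ob D" "R \<in> Ob D"
    using assms ext_ob by auto
  obtain V where V: "ext Z R V" "ext (sh 1 P) V (sh 1 Q)"
    using ext_assoc1[OF ext_rot[OF assms(1)] ext_rot[OF assms(2)]] by blast
  have "ext P (sh (- 1) V) Q"
    using ext_sh[OF V(2), of "-1"] ob by (simp add: sh_sh)
  moreover have "ext (sh (- 1) V) Z R"
    using ext_unrot[OF V(1)] .
  ultimately show ?thesis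
    using that by blast
qed

lemma strictly_fullD: "strictly_full D S \<Longrightarrow> X \<in> S \<Longrightarrow> Y \<in> Ob D \<Longrightarrow> isomorphic_in D X Y \<Longrightarrow> Y \<in> S"
  unfolding strictly_full_def by blast

end

section \<open>Bounded t-structures\<close>

locale bounded_t_category = triangulated_category D
  for D :: "('o, 'm, 'z) tri_cat_scheme" (structure) +
  fixes U V :: "'o set"
  assumes bounded_t: "bounded_t_structure D U V"
begin

lemma t_struct: "t_structure D U V"
  using bounded_t by (simp add: bounded_t_structure_def)

lemma U_full: "strictly_full D U" and V_full: "strictly_full D V"
  using t_struct by (simp_all add: t_structure_def)

lemma U_ob: "X \<in> U \<Longrightarrow> X \<in> Ob D" and V_ob: "X \<in> V \<Longrightarrow> X \<in> Ob D"
  using U_full V_full by (auto simp: strictly_full_def)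

lemma U_sh_nat: "X \<in> U \<Longrightarrow> sh (int n) X \<in> U"
proof (induction n)
  case (Suc n)
  then have "sh 1 (sh (int n) X) \<in> shift_sub D 1 U"
    by blast
  then have "sh 1 (sh (int n) X) \<in> U"
    using t_struct unfolding t_structure_def by blast
  then show ?case
    using sh_sh[OF U_ob[OF Suc.prems], of 1 "int n"] by simp
qed simp

lemma U_sh: "X \<in> U \<Longrightarrow> n \<ge> 0 \<Longrightarrow> sh n X \<in> U"
  using U_sh_nat[of X "nat n"] by simp

lemma V_sh_nat: "X \<in> V \<Longrightarrow> sh (- int n) X \<in> V"
proof (induction n)
  case (Suc n)
  then have "sh (- 1) (sh (- int n) X) \<in> shift_sub D (- 1) V"
    by blast
  then have "sh (- 1) (sh (- int n) X) \<in> V"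
    using t_struct unfolding t_structure_def by blast
  then show ?case
    using sh_sh[OF V_ob[OF Suc.prems], of "- 1" "- int n"] by simp
qed simp

lemma V_sh: "X \<in> V \<Longrightarrow> n \<le> 0 \<Longrightarrow> sh n X \<in> V"
  using V_sh_nat[of X "nat (- n)"] by simp

lemma UV_hz:
  assumes X: "X \<in> U" and Y: "Y \<in> V" and mn: "m > n"
  shows "hz (sh m X) (sh n Y)"
proof -
  have ob: "X \<in> Ob D" "Y \<in> Ob D"
    using X Y U_ob V_ob by auto
  \<comment> \<open>The axiom compares U with V[-1]. Taking out a common shift by n + 1 leaves
    X[m - n - 1], which is in U because m > n.\<close>
  have "sh (m - n - 1) X \<in> U"
    using U_sh[OF X] mn by simp
  moreover have "sh (- 1) Y \<in> shift_sub D (- 1) V"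
    using Y by blast
  ultimately have "Hom D (sh (m - n - 1) X) (sh (- 1) Y) = {Zero D (sh (m - n - 1) X) (sh (- 1) Y)}"
    using t_struct unfolding t_structure_def by blast
  then have "hz (sh (m - n - 1) X) (sh (- 1) Y)"
    by (simp add: hom_zero_def)
  then show ?thesis
    using hz_sh_add[OF ob, of "n + 1" "m - n - 1" "- 1"] by simp
qed

text \<open>The decomposition axiom for X[n], shifted back: A and B are the truncations of X to
  degrees at most n and at least n + 1.\<close>

lemma truncation:
  assumes X: "X \<in> Ob D"
  obtains A B where "ext A X B" "sh n A \<in> U" "sh (n + 1) B \<in> V"
proof -
  have "sh n X \<in> Ob D"
    using sh_ob X by blast
  then obtain A C where A: "A \<in> U" and C: "C \<in> shift_sub D (- 1) V" and e: "ext A (sh n X) C"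
    using t_struct unfolding t_structure_def is_ext_def by blast
  then obtain B where B: "B \<in> V" "C = sh (- 1) B"
    by blast
  have ob: "A \<in> Ob D" "C \<in> Ob D" "B \<in> Ob D"
    using e B ext_ob V_ob by auto
  have "ext (sh (- n) A) X (sh (- n) C)"
    using ext_sh[OF e, of "- n"] X by (simp add: sh_sh)
  moreover have "sh n (sh (- n) A) \<in> U"
    using A ob by (simp add: sh_sh)
  moreover have "sh (n + 1) (sh (- n) C) \<in> V"
    using B ob by (simp add: sh_sh)
  ultimately show ?thesis
    using that by blast
qed

text \<open>U is the left orthogonal of V[-1]. If X is orthogonal to V[-1], then neither X nor A[1]
  maps nontrivially to its truncation B, so End B = 0 and X is isomorphic to A in U.\<close>

lemma U_iff: "X \<in> U \<longleftrightarrow> X \<in> Ob D \<and> (\<forall>Y \<in> V. hz (sh 1 X) Y)"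
proof
  assume "X \<in> U"
  then show "X \<in> Ob D \<and> (\<forall>Y \<in> V. hz (sh 1 X) Y)"
    using U_ob UV_hz[of X _ 0 1] by simp
next
  assume X: "X \<in> Ob D \<and> (\<forall>Y \<in> V. hz (sh 1 X) Y)"
  obtain A B where e: "ext A X B" and A: "A \<in> U" and B: "sh 1 B \<in> V"
    using truncation[of X 0] X by auto
  have ob: "A \<in> Ob D" "B \<in> Ob D"
    using e ext_ob by auto
  have "hz X B"
    using X B hz_sh[of X B 1] ob by blast
  moreover have "hz (sh 1 A) B"
    using UV_hz[OF A B, of "- 1" 1] ob by (simp add: sh_sh)
  ultimately have "hz B B"
    using ext_hz_from[OF ext_rot[OF e]] ob by blast
  then have "isomorphic_in D A X"
    by (rule ext_trivial_right[OF e])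
  then show "X \<in> U"
    using strictly_fullD[OF U_full A] X by blast
qed

lemma V_iff: "Y \<in> V \<longleftrightarrow> Y \<in> Ob D \<and> (\<forall>X \<in> U. hz (sh 1 X) Y)"
proof
  assume "Y \<in> V"
  then show "Y \<in> Ob D \<and> (\<forall>X \<in> U. hz (sh 1 X) Y)"
    using V_ob UV_hz[of _ Y 0 1] by simp
next
  assume Y: "Y \<in> Ob D \<and> (\<forall>X \<in> U. hz (sh 1 X) Y)"
  obtain A B where e: "ext A Y B" and A: "sh (- 1) A \<in> U" and B: "B \<in> V"
    using truncation[of Y "- 1"] Y by auto
  have ob: "A \<in> Ob D" "B \<in> Ob D"
    using e ext_ob by auto
  have A1: "sh 1 (sh (- 1) A) = A"
    using ob by (simp add: sh_sh)
  have "hz A Y"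
    using Y A A1 by metis
  moreover have "hz A (sh (- 1) B)"
    using UV_hz[OF A B, of "- 1" 1] A1 by simp
  ultimately have "hz A A"
    using ext_hz_to[OF ext_unrot[OF e]] ob by blast
  then have "isomorphic_in D B Y"
    by (rule isomorphic_sym[OF ext_trivial_left[OF e]])
  then show "Y \<in> V"
    using strictly_fullD[OF V_full B] Y by blast
qed

lemma U_ext: "ext A X B \<Longrightarrow> A \<in> U \<Longrightarrow> B \<in> U \<Longrightarrow> X \<in> U"
  using ext_hz_from[OF ext_sh[of A X B 1]] ext_ob V_ob unfolding U_iff by blast

lemma V_ext: "ext A X B \<Longrightarrow> A \<in> V \<Longrightarrow> B \<in> V \<Longrightarrow> X \<in> V"
  using ext_hz_to[of A X B] ext_ob[of A X B] sh_ob U_ob unfolding V_iff by blast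

lemma U_cone: "ext A X B \<Longrightarrow> X \<in> U \<Longrightarrow> sh 1 A \<in> U \<Longrightarrow> B \<in> U"
  using U_ext[OF ext_rot] .

lemma V_fibre: "ext A X B \<Longrightarrow> X \<in> V \<Longrightarrow> sh (- 1) B \<in> V \<Longrightarrow> A \<in> V"
  using V_ext[OF ext_unrot] by blast

lemma zero_in_UV: "zero_object D N \<Longrightarrow> N \<in> U \<and> N \<in> V"
proof -
  assume N: "zero_object D N"
  then have *: "N \<in> Ob D" "hz N N"
    by (auto simp: zero_object_iff)
  then have "hz (sh 1 N) (sh 1 N)"
    using hz_sh by blast
  then have "hz (sh 1 N) Y" "hz Y N" if "Y \<in> Ob D" for Y
    using * hom_zero_from_zero that sh_ob by blast+
  then show ?thesis
    unfolding U_iff[of N] V_iff[of N] using * sh_ob[of _ 1] U_ob V_ob by blast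
qed

lemma bounded:
  assumes X: "X \<in> Ob D"
  obtains n :: nat where "sh (int n) X \<in> U" "sh (- int n) X \<in> V"
proof -
  obtain n :: nat and u v where n: "u \<in> U" "X = sh (- int n) u" "v \<in> V" "X = sh (int n) v"
    using bounded_t X unfolding bounded_t_structure_def by blast
  then have "sh (int n) X = u" "sh (- int n) X = v"
    using sh_sh[OF U_ob[OF n(1)], of "int n" "- int n"] sh_sh[OF V_ob[OF n(3)], of "- int n" "int n"]
    by simp_all
  then show ?thesis
    using that n by blast
qed

text \<open>U is generated under extensions by the non-negative shifts of the heart. The induction
  is on n with X[-n] in V, which boundedness provides; it is generalised over m because the lower
  truncation A enters the induction hypothesis as A[-1], at the cost of one more shift.\<close>

lemma U_filtration:
  assumes Q_ext: "\<And>A Y B. ext A Y B \<Longrightarrow> Q A \<Longrightarrow> Q B \<Longrightarrow> Q Y"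
    and Q_gen: "\<And>Y k. Y \<in> U \<inter> V \<Longrightarrow> k \<ge> 0 \<Longrightarrow> Q (sh k Y)" and X: "X \<in> U"
  shows "Q X"
proof -
  have *: "X \<in> U \<Longrightarrow> sh (- int n) X \<in> V \<Longrightarrow> m \<ge> 0 \<Longrightarrow> Q (sh m X)" for n m X
  proof (induction n arbitrary: X m)
    case 0
    then show ?case
      using Q_gen by simp
  next
    case (Suc n)
    obtain A B where e: "ext A X B" and A: "sh (- 1) A \<in> U" and B: "B \<in> V"
      using truncation[of X "- 1"] U_ob[OF Suc.prems(1)] by auto
    have ob: "A \<in> Ob D" "B \<in> Ob D" "X \<in> Ob D"
      using e ext_ob by auto
    have "sh 1 A \<in> U"
      using U_sh[OF A, of 2] ob by (simp add: sh_sh)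
    then have "B \<in> U \<inter> V"
      using U_cone[OF e] Suc.prems B by blast
    then have QB: "Q (sh m B)"
      using Q_gen Suc.prems by blast
    have "sh (- 1) (sh (- int (Suc n)) B) \<in> V"
      using V_sh[OF B, of "- 1 - int (Suc n)"] ob by (simp add: sh_sh)
    then have "sh (- int (Suc n)) A \<in> V"
      using V_fibre[OF ext_sh[OF e]] Suc.prems by blast
    then have "sh (- int n) (sh (- 1) A) \<in> V"
      using ob by (simp add: sh_sh algebra_simps)
    then have "Q (sh (m + 1) (sh (- 1) A))"
      using Suc.IH[OF A, of "m + 1"] Suc.prems by simp
    then have "Q (sh m A)"
      using ob by (simp add: sh_sh)
    then show ?case
      using Q_ext[OF ext_sh[OF e]] QB by blast
  qed
  obtain n :: nat where "sh (- int n) X \<in> V"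
    using bounded[OF U_ob[OF X]] by blast
  then show ?thesis
    using *[OF X, of n 0] by simp
qed

lemma V_filtration:
  assumes Q_ext: "\<And>A Y B. ext A Y B \<Longrightarrow> Q A \<Longrightarrow> Q B \<Longrightarrow> Q Y"
    and Q_gen: "\<And>Y k. Y \<in> U \<inter> V \<Longrightarrow> k \<ge> 0 \<Longrightarrow> Q (sh (- k) Y)" and X: "X \<in> V"
  shows "Q X"
proof -
  have *: "X \<in> V \<Longrightarrow> sh (int n) X \<in> U \<Longrightarrow> m \<ge> 0 \<Longrightarrow> Q (sh (- m) X)" for n m X
  proof (induction n arbitrary: X m)
    case 0
    then show ?case
      using Q_gen by simp
  next
    case (Suc n)
    obtain A B where e: "ext A X B" and A: "A \<in> U" and B: "sh 1 B \<in> V"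
      using truncation[of X 0] V_ob[OF Suc.prems(1)] by auto
    have ob: "A \<in> Ob D" "B \<in> Ob D" "X \<in> Ob D"
      using e ext_ob by auto
    have "sh (- 1) B \<in> V"
      using V_sh[OF B, of "- 2"] ob by (simp add: sh_sh)
    then have "A \<in> U \<inter> V"
      using V_fibre[OF e] Suc.prems A by blast
    then have QA: "Q (sh (- m) A)"
      using Q_gen Suc.prems by blast
    have "sh 1 (sh (int (Suc n)) A) \<in> U"
      using U_sh[OF A, of "1 + int (Suc n)"] ob by (simp add: sh_sh)
    then have "sh (int (Suc n)) B \<in> U"
      using U_cone[OF ext_sh[OF e]] Suc.prems by blast
    then have "sh (int n) (sh 1 B) \<in> U"
      using ob by (simp add: sh_sh add.commute)
    then have "Q (sh (- (m + 1)) (sh 1 B))"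
      using Suc.IH[OF B, of "m + 1"] Suc.prems by simp
    then have "Q (sh (- m) B)"
      using ob by (simp add: sh_sh)
    then show ?case
      using Q_ext[OF ext_sh[OF e]] QA by blast
  qed
  obtain n :: nat where "sh (int n) X \<in> U"
    using bounded[OF V_ob[OF X]] by blast
  then show ?thesis
    using *[OF X, of n 0] by simp
qed

lemma heart_ext: "ext A X B \<Longrightarrow> A \<in> U \<inter> V \<Longrightarrow> B \<in> U \<inter> V \<Longrightarrow> X \<in> U \<inter> V"
  using U_ext V_ext by blast

end

text \<open>Devissage in both arguments: first X is filtered by shifts of the first heart against a
  fixed object of the second, then Y by shifts of the second. All n >= 0 are carried along, since
  the filtrations introduce arbitrary shifts of the right sign.\<close>

lemma (in triangulated_category) hearts_hz:
  assumes 1: "bounded_t_structure D U1 V1" and 2: "bounded_t_structure D U2 V2"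
    and z: "\<And>n X Y. n \<ge> 0 \<Longrightarrow> X \<in> U1 \<inter> V1 \<Longrightarrow> Y \<in> U2 \<inter> V2 \<Longrightarrow> hz (sh (n + p) X) Y"
    and X: "X \<in> U1" and Y: "Y \<in> V2"
  shows "hz (sh p X) Y"
proof -
  interpret t1: bounded_t_category D U1 V1
    by unfold_locales (rule 1)
  interpret t2: bounded_t_category D U2 V2
    by unfold_locales (rule 2)
  have *: "hz (sh (n + p) X) Y" if "n \<ge> 0" "Y \<in> U2 \<inter> V2" for n Y
  proof -
    have YO: "Y \<in> Ob D"
      using that t2.U_ob by blast
    have "\<forall>n \<ge> 0. hz (sh (n + p) X) Y"
    proof (rule t1.U_filtration[OF _ _ X])
      fix A Z B assume "ext A Z B" "\<forall>n \<ge> 0. hz (sh (n + p) A) Y" "\<forall>n \<ge> 0. hz (sh (n + p) B) Y"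
      then show "\<forall>n \<ge> 0. hz (sh (n + p) Z) Y"
        using ext_hz_from[OF ext_sh YO] by blast
    next
      fix Z and k :: int assume Z: "Z \<in> U1 \<inter> V1" "k \<ge> 0"
      have "Z \<in> Ob D"
        using Z t1.U_ob by blast
      then have "sh (n + p) (sh k Z) = sh ((n + k) + p) Z" for n
        by (simp add: sh_sh ac_simps)
      then show "\<forall>n \<ge> 0. hz (sh (n + p) (sh k Z)) Y"
        using z[of "_ + k" Z Y] Z \<open>Y \<in> U2 \<inter> V2\<close> by simp
    qed
    then show ?thesis
      using that by blast
  qed
  have XO: "X \<in> Ob D"
    using X t1.U_ob by blast
  have "\<forall>n \<ge> 0. hz (sh (n + p) X) Y"
  proof (rule t2.V_filtration[OF _ _ Y])
    fix A Z B assume "ext A Z B" "\<forall>n \<ge> 0. hz (sh (n + p) X) A" "\<forall>n \<ge> 0. hz (sh (n + p) X) B"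
    then show "\<forall>n \<ge> 0. hz (sh (n + p) X) Z"
      using ext_hz_to[of A Z B] sh_ob XO by blast
  next
    fix Z and k :: int assume Z: "Z \<in> U2 \<inter> V2" "k \<ge> 0"
    have "Z \<in> Ob D"
      using Z t2.U_ob by blast
    then have "hz (sh (n + p) X) (sh (- k) Z) \<longleftrightarrow> hz (sh ((n + k) + p) X) Z" for n
      using hz_sh_add[OF XO, of Z "- k" "n + k + p" 0] by (simp add: algebra_simps)
    then show "\<forall>n \<ge> 0. hz (sh (n + p) X) (sh (- k) Z)"
      using *[of "_ + k" Z] Z by simp
  qed
  then show ?thesis
    by force
qed

section \<open>Torsion pairs and intermediate hearts\<close>

definition tors_pair :: "('o, 'm, 'z) tri_cat_scheme \<Rightarrow> 'o set \<Rightarrow> 'o set \<Rightarrow> 'o set \<Rightarrow> bool" where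
  "tors_pair D H T F \<longleftrightarrow> T \<subseteq> H \<and> F \<subseteq> H \<and> strictly_full D T \<and> strictly_full D F \<and>
    (\<forall>X \<in> T. \<forall>Y \<in> F. hom_zero D X Y) \<and> (\<forall>X \<in> H. \<exists>A \<in> T. \<exists>B \<in> F. is_ext D A X B)"

definition tilt :: "('o, 'm, 'z) tri_cat_scheme \<Rightarrow> 'o set \<Rightarrow> 'o set \<Rightarrow> 'o set" where
  "tilt D T F = {X. \<exists>B \<in> F. \<exists>A \<in> T. is_ext D (shift_obj D 1 B) X A}"

context bounded_t_category
begin

abbreviation Heart :: "'o set" where "Heart \<equiv> U \<inter> V"

lemma heart_full: "strictly_full D Heart"
  using U_full V_full unfolding strictly_full_def by blast

lemma heart_ob: "X \<in> Heart \<Longrightarrow> X \<in> Ob D"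
  using U_ob by blast

lemma heart_hz: "X \<in> Heart \<Longrightarrow> Y \<in> Heart \<Longrightarrow> m > n \<Longrightarrow> hz (sh m X) (sh n Y)"
  using UV_hz by blast

lemma heart_hz_1: "X \<in> Heart \<Longrightarrow> Y \<in> Heart \<Longrightarrow> hz (sh 1 X) Y"
  "X \<in> Heart \<Longrightarrow> Y \<in> Heart \<Longrightarrow> hz X (sh (- 1) Y)"
  using heart_hz[of X Y 0 1] heart_hz[of X Y "- 1" 0] by simp_all

text \<open>The argument of \<open>U_iff\<close> inside the heart: Hom(A[1], B) = 0 for heart
  objects, so a torsion-free quotient B without maps from X has End B = 0.\<close>

lemma tors_pair_T_iff:
  assumes tp: "tors_pair D Heart T F"
  shows "X \<in> T \<longleftrightarrow> X \<in> Heart \<and> (\<forall>Y \<in> F. hz X Y)"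
proof
  assume "X \<in> T"
  then show "X \<in> Heart \<and> (\<forall>Y \<in> F. hz X Y)"
    using tp unfolding tors_pair_def by blast
next
  assume X: "X \<in> Heart \<and> (\<forall>Y \<in> F. hz X Y)"
  then obtain A B where AB: "A \<in> T" "B \<in> F" "ext A X B"
    using tp unfolding tors_pair_def by blast
  then have "A \<in> Heart" "B \<in> Heart"
    using tp unfolding tors_pair_def by blast+
  then have "hz B B"
    using ext_hz_from[OF ext_rot[OF AB(3)]] X AB(2) heart_hz_1 heart_ob by blast
  then show "X \<in> T"
    using tp AB ext_trivial_right[OF AB(3)] strictly_fullD[of T A X] ext_ob[OF AB(3)]
    unfolding tors_pair_def by blast
qed

lemma tors_pair_F_iff:
  assumes tp: "tors_pair D Heart T F"
  shows "Y \<in> F \<longleftrightarrow> Y \<in> Heart \<and> (\<forall>X \<in> T. hz X Y)"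
proof
  assume "Y \<in> F"
  then show "Y \<in> Heart \<and> (\<forall>X \<in> T. hz X Y)"
    using tp unfolding tors_pair_def by blast
next
  assume Y: "Y \<in> Heart \<and> (\<forall>X \<in> T. hz X Y)"
  then obtain A B where AB: "A \<in> T" "B \<in> F" "ext A Y B"
    using tp unfolding tors_pair_def by blast
  then have "A \<in> Heart" "B \<in> Heart"
    using tp unfolding tors_pair_def by blast+
  then have "hz A A"
    using ext_hz_to[OF ext_unrot[OF AB(3)]] Y AB(1) heart_hz_1 heart_ob by blast
  then show "Y \<in> F"
    using tp AB isomorphic_sym[OF ext_trivial_left[OF AB(3)]] strictly_fullD[of F B Y]
      ext_ob[OF AB(3)]
    unfolding tors_pair_def by blast
qed

lemma tors_pair_zero:
  assumes "tors_pair D Heart T F" "zero_object D N"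
  shows "N \<in> T \<and> N \<in> F"
proof -
  have N: "N \<in> Heart" "N \<in> Ob D" "hz N N"
    using zero_in_UV assms zero_object_iff by auto
  moreover have "T \<subseteq> Ob D" "F \<subseteq> Ob D"
    using assms heart_ob unfolding tors_pair_def by blast+
  then have "\<forall>Y \<in> F. hz N Y" "\<forall>Y \<in> T. hz Y N"
    using hom_zero_from_zero N by blast+
  ultimately show ?thesis
    unfolding tors_pair_T_iff[OF assms(1), of N] tors_pair_F_iff[OF assms(1), of N] by blast
qed

lemma heart_geD:
  assumes "heart_ge D K H" "n > 0" "X \<in> K" "Y \<in> H"
  shows "hz (sh n X) Y"
proof -
  have "sh n X \<in> shift_sub D n K"
    using assms by blast
  then have "Hom D (sh n X) Y = {Zero D (sh n X) Y}"
    using assms unfolding heart_ge_def by blast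
  then show ?thesis
    by (simp add: hom_zero_def)
qed

text \<open>Turns the order on hearts into inclusions of aisles and coaisles. By
  \<open>hearts_hz\<close> the vanishing between hearts spreads to U', V and to U, V', and
  orthogonality (\<open>U_iff\<close>, \<open>V_iff\<close>) converts it into inclusions.\<close>

lemma intermediate_t_structure:
  assumes K: "K \<in> intermediate_hearts D Heart"
  obtains U' V' where "bounded_t_structure D U' V'" "K = U' \<inter> V'" "U' \<subseteq> U" "V \<subseteq> V'"
    "\<And>X. X \<in> U \<Longrightarrow> sh 1 X \<in> U'" "\<And>Y. Y \<in> V' \<Longrightarrow> sh (- 1) Y \<in> V"
proof -
  obtain U' V' where b: "bounded_t_structure D U' V'" and KUV: "K = U' \<inter> V'"
    using K unfolding intermediate_hearts_def bounded_heart_def by blast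
  interpret k: bounded_t_category D U' V'
    by unfold_locales (rule b)
  have ge: "heart_ge D (shift_sub D 1 Heart) K" "heart_ge D K Heart"
    using K unfolding intermediate_hearts_def by auto
  have z1: "hz (sh 1 X) Y" if "X \<in> U'" "Y \<in> V" for X Y
  proof (rule hearts_hz[OF b bounded_t _ that])
    fix n :: int and X Y assume "n \<ge> 0" "X \<in> U' \<inter> V'" "Y \<in> Heart"
    then show "hz (sh (n + 1) X) Y"
      using heart_geD[OF ge(2), of "n + 1"] KUV by simp
  qed
  have z2: "hz (sh 2 X) Y" if "X \<in> U" "Y \<in> V'" for X Y
  proof (rule hearts_hz[OF bounded_t b _ that])
    fix n :: int and X Y assume *: "n \<ge> 0" "X \<in> Heart" "Y \<in> U' \<inter> V'"
    have "hz (sh (n + 1) (sh 1 X)) Y"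
      using heart_geD[OF ge(1), of "n + 1" "sh 1 X" Y] KUV * by simp
    then show "hz (sh (n + 2) X) Y"
      using sh_sh[OF heart_ob[OF *(2)], of "n + 1" 1] by (simp add: add.assoc)
  qed
  have "U' \<subseteq> U"
    using z1 k.U_ob by (auto simp: U_iff)
  moreover have "V \<subseteq> V'"
    using z1 V_ob by (auto simp: k.V_iff)
  moreover have "sh 1 X \<in> U'" if "X \<in> U" for X
    using z2[OF that] sh_ob[of X 1] sh_sh[of X 1 1] U_ob[OF that] by (simp add: k.U_iff)
  moreover have "sh (- 1) Y \<in> V" if Y: "Y \<in> V'" for Y
  proof -
    have YO: "Y \<in> Ob D"
      using k.V_ob Y by blast
    have "hz (sh 1 X) (sh (- 1) Y)" if "X \<in> U" for X
      using z2[OF that Y] hz_sh_add[OF U_ob[OF that] YO, of "- 1" 2 0] by simp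
    then show ?thesis
      using sh_ob[OF YO] by (auto simp: V_iff)
  qed
  ultimately show ?thesis
    using that b KUV by blast
qed

text \<open>Two truncations do the work: an object of the heart truncated for the t-structure of K
  yields its torsion sequence, and an object of K truncated at degree -1 for (U, V) is exhibited in
  F[1] * T.\<close>

lemma intermediate_tors_pair:
  assumes K: "K \<in> intermediate_hearts D Heart"
  defines "T \<equiv> K \<inter> Heart" and "F \<equiv> {Y \<in> Heart. sh 1 Y \<in> K}"
  shows "tors_pair D Heart T F" and "K = tilt D T F"
proof -
  obtain U' V' where b: "bounded_t_structure D U' V'" and KUV: "K = U' \<inter> V'"
    and U': "U' \<subseteq> U" "\<And>X. X \<in> U \<Longrightarrow> sh 1 X \<in> U'"
    and V': "V \<subseteq> V'" "\<And>Y. Y \<in> V' \<Longrightarrow> sh (- 1) Y \<in> V"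
    using intermediate_t_structure[OF K] by metis
  interpret k: bounded_t_category D U' V'
    by unfold_locales (rule b)
  have T_full: "strictly_full D T"
    using k.heart_full heart_full unfolding T_def KUV strictly_full_def by blast
  have F_full: "strictly_full D F"
    unfolding strictly_full_def
  proof (intro conjI ballI impI)
    show "F \<subseteq> Ob D"
      using heart_ob by (auto simp: F_def)
    fix X Y assume X: "X \<in> F" and Y: "Y \<in> Ob D" and iso: "isomorphic_in D X Y"
    have XO: "X \<in> Ob D"
      using X heart_ob by (auto simp: F_def)
    obtain N where N: "zero_object D N"
      using has_zero_object by blast
    \<comment> \<open>An isomorphism recorded as an extension by a zero object can be shifted with
      \<open>ext_sh\<close>.\<close>
    have "ext X Y N"
      using ext_iso[OF ext_id_right[OF XO N]] XO Y iso N isomorphic_refl zero_object_iff by blast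
    then have "ext (sh 1 X) (sh 1 Y) (sh 1 N)"
      by (rule ext_sh)
    then have "isomorphic_in D (sh 1 X) (sh 1 Y)"
      using ext_trivial_right zero_object_sh[OF N] zero_object_iff by blast
    then have "sh 1 Y \<in> K"
      using X strictly_fullD[OF k.heart_full, of "sh 1 X"] sh_ob[OF Y] KUV by (auto simp: F_def)
    moreover have "Y \<in> Heart"
      using X strictly_fullD[OF heart_full _ Y iso] by (auto simp: F_def)
    ultimately show "Y \<in> F"
      by (simp add: F_def)
  qed
  have TF_hz: "hz X Y" if "X \<in> T" "Y \<in> F" for X Y
  proof -
    have "hz (sh 1 X) (sh 1 Y)"
      using that k.heart_hz_1 KUV by (auto simp: T_def F_def)
    then show ?thesis
      using hz_sh heart_ob that by (auto simp: T_def F_def)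
  qed
  have seq: "\<exists>A \<in> T. \<exists>B \<in> F. ext A X B" if X: "X \<in> Heart" for X
  proof -
    obtain A B where e: "ext A X B" and A: "A \<in> U'" and B: "sh 1 B \<in> V'"
      using k.truncation[of X 0] heart_ob[OF X] by auto
    have ob: "A \<in> Ob D" "B \<in> Ob D"
      using e ext_ob by auto
    have BV: "B \<in> V"
      using V'(2)[OF B] ob by (simp add: sh_sh)
    have AU: "A \<in> U"
      using A U' by blast
    have AV: "A \<in> V"
      using V_fibre[OF e] V_sh[OF BV, of "- 1"] X by simp
    have BU: "B \<in> U"
      using U_cone[OF e] U_sh[OF AU, of 1] X by simp
    have "A \<in> T"
      using A AU AV V' KUV by (auto simp: T_def)
    moreover have "B \<in> F"
      using B BU BV U' KUV by (auto simp: F_def)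
    ultimately show ?thesis
      using e by blast
  qed
  show "tors_pair D Heart T F"
    unfolding tors_pair_def using T_full F_full TF_hz seq by (auto simp: T_def F_def)
  show "K = tilt D T F"
  proof
    show "K \<subseteq> tilt D T F"
    proof
      fix X assume X: "X \<in> K"
      have XO: "X \<in> Ob D"
        using X k.heart_ob KUV by blast
      obtain A B where e: "ext A X B" and A: "sh (- 1) A \<in> U" and B: "B \<in> V"
        using truncation[of X "- 1"] XO by auto
      have ob: "A \<in> Ob D" "B \<in> Ob D"
        using e ext_ob by auto
      have A1: "sh 1 (sh (- 1) A) = A"
        using ob by (simp add: sh_sh)
      have AU': "A \<in> U'"
        using U'(2)[OF A] A1 by simp
      have "sh (- 1) B \<in> V'"
        using V_sh[OF B, of "- 1"] V' by auto
      then have AV': "A \<in> V'"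
        using k.V_fibre[OF e] X KUV by blast
      have BU': "B \<in> U'"
        using k.U_cone[OF e] k.U_sh[OF AU', of 1] X KUV by simp
      have "sh (- 1) A \<in> F"
        using A V'(2)[OF AV'] A1 AU' AV' KUV by (simp add: F_def)
      moreover have "B \<in> T"
        using B BU' U' V' KUV by (auto simp: T_def)
      ultimately show "X \<in> tilt D T F"
        using e A1 unfolding tilt_def by force
    qed
    show "tilt D T F \<subseteq> K"
      using k.heart_ext KUV by (auto simp: tilt_def T_def F_def)
  qed
qed

text \<open>The Happel--Reiten--Smalo tilt: with \<open>X * Y\<close> for the extensions of \<open>Y\<close> by \<open>X\<close>, the new
  t-structure is \<open>(U[1] * T, F[1] * V)\<close>, and \<open>D = U[1] * T * F * V[-1]\<close> by associativity of \<open>*\<close>.\<close>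

lemma tilt_t_structure:
  assumes tp: "tors_pair D Heart T F"
  defines "U' \<equiv> {X. \<exists>a \<in> U. \<exists>t \<in> T. ext (sh 1 a) X t}"
    and "V' \<equiv> {X. \<exists>f \<in> F. \<exists>b \<in> V. ext (sh 1 f) X b}"
  shows "bounded_t_structure D U' V'" and "U' \<subseteq> U" and "\<And>Y. Y \<in> V' \<Longrightarrow> sh (- 1) Y \<in> V"
proof -
  have TH: "T \<subseteq> Heart" and FH: "F \<subseteq> Heart" and hzTF: "\<And>X Y. X \<in> T \<Longrightarrow> Y \<in> F \<Longrightarrow> hz X Y"
    and seq: "\<And>X. X \<in> Heart \<Longrightarrow> \<exists>A \<in> T. \<exists>B \<in> F. ext A X B"
    using tp unfolding tors_pair_def by blast+
  obtain N where N: "zero_object D N"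
    using has_zero_object by blast
  have NT: "N \<in> T" "N \<in> F" and NO: "N \<in> Ob D"
    using tors_pair_zero[OF tp N] N by (auto simp: zero_object_iff)
  have U'U: "U' \<subseteq> U"
    using U_ext U_sh[of _ 1] TH by (auto simp: U'_def)
  have UU': "sh 1 X \<in> U'" if "X \<in> U" for X
    using ext_id_right[OF sh_ob[OF U_ob[OF that]] N] that NT by (auto simp: U'_def)
  have V'V: "sh (- 1) Y \<in> V" if "Y \<in> V'" for Y
  proof -
    obtain f b where fb: "f \<in> F" "b \<in> V" "ext (sh 1 f) Y b"
      using \<open>Y \<in> V'\<close> by (auto simp: V'_def)
    then have "f \<in> V" "f \<in> Ob D"
      using FH heart_ob by auto
    then show ?thesis
      using ext_sh[OF fb(3), of "- 1"] V_sh[OF fb(2), of "- 1"] V_ext by (simp add: sh_sh)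
  qed
  have VV': "Y \<in> V'" if "Y \<in> V" for Y
    using ext_id_left[OF V_ob[OF that] zero_object_sh[OF N]] that NT by (auto simp: V'_def)
  have full: "strictly_full D U'" "strictly_full D V'"
    unfolding strictly_full_def U'_def V'_def
    using ext_iso isomorphic_refl ext_ob by blast+
  have hz': "hz X (sh (- 1) Y)" if X: "X \<in> U'" and Y: "Y \<in> V'" for X Y
  proof -
    obtain a t where at: "a \<in> U" "t \<in> T" "ext (sh 1 a) X t"
      using X by (auto simp: U'_def)
    obtain f b where fb: "f \<in> F" "b \<in> V" "ext (sh 1 f) Y b"
      using Y by (auto simp: V'_def)
    have t: "t \<in> U" and f: "f \<in> V" and ob: "f \<in> Ob D" "t \<in> Ob D" "sh (- 1) b \<in> Ob D"
      using at fb TH FH heart_ob V_ob sh_ob by blast+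
    have e: "ext f (sh (- 1) Y) (sh (- 1) b)"
      using ext_sh[OF fb(3), of "- 1"] ob by (simp add: sh_sh)
    have "hz X f"
      using ext_hz_from[OF at(3) ob(1)] UV_hz[OF at(1) f, of 0 1] hzTF at fb by simp
    moreover have "hz X (sh (- 1) b)"
      using ext_hz_from[OF at(3) ob(3)] UV_hz[OF at(1) fb(2), of "- 1" 1]
        UV_hz[OF t fb(2), of "- 1" 0] by simp
    ultimately show ?thesis
      using ext_hz_to[OF e] ext_ob[OF at(3)] by blast
  qed
  have trunc: "\<exists>A \<in> U'. \<exists>B \<in> shift_sub D (- 1) V'. \<exists>f g h. Tri D A X B f g h"
    if X: "X \<in> Ob D" for X
  proof -
    obtain A B where e: "ext A X B" and A: "A \<in> U" and B: "sh 1 B \<in> V"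
      using truncation[of X 0] X by auto
    \<comment> \<open>h is the degree-zero cohomology of X, a heart object, so it has a torsion
      sequence that can be spliced in between A1 and B.\<close>
    obtain A1 h where e1: "ext A1 A h" and A1: "sh (- 1) A1 \<in> U" and h: "h \<in> V"
      using truncation[of A "- 1"] U_ob[OF A] by auto
    have ob: "A1 \<in> Ob D" "h \<in> Ob D"
      using e1 ext_ob by auto
    have "sh 1 A1 \<in> U"
      using U_sh[OF A1, of 2] ob by (simp add: sh_sh)
    then have "h \<in> Heart"
      using U_cone[OF e1 A] h by blast
    then obtain t f where tf: "t \<in> T" "f \<in> F" "ext t h f"
      using seq by blast
    obtain Y where Y: "ext A1 Y t" "ext Y A f"
      using ext_assoc2[OF e1 tf(3)] by blast
    obtain W where W: "ext Y X W" "ext f W B"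
      using ext_assoc1[OF Y(2) e] by blast
    have "sh 1 (sh (- 1) A1) = A1"
      using ob by (simp add: sh_sh)
    then have "Y \<in> U'"
      using Y(1) A1 tf(1) unfolding U'_def by force
    moreover have "sh 1 W \<in> V'"
      using ext_sh[OF W(2), of 1] tf(2) B by (auto simp: V'_def)
    then have "sh (- 1) (sh 1 W) \<in> shift_sub D (- 1) V'"
      by blast
    then have "W \<in> shift_sub D (- 1) V'"
      using ext_ob[OF W(1)] by (simp add: sh_sh)
    ultimately show ?thesis
      using W(1) unfolding is_ext_def by blast
  qed
  have "t_structure D U' V'"
    unfolding t_structure_def
  proof (intro conjI ballI)
    show "shift_sub D 1 U' \<subseteq> U'"
      using U'U UU' by blast
    show "shift_sub D (- 1) V' \<subseteq> V'"
      using V'V VV' by blast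
    fix X Y assume X: "X \<in> U'" and Y: "Y \<in> shift_sub D (- 1) V'"
    then have "hz X Y" "X \<in> Ob D" "Y \<in> Ob D"
      using hz' V'V V_ob U'U U_ob by blast+
    then show "Hom D X Y = {Zero D X Y}"
      using hom_zero_iff by blast
  qed (use full trunc in auto)
  moreover have "\<exists>n :: nat. X \<in> shift_sub D (- int n) U' \<and> X \<in> shift_sub D (int n) V'"
    if X: "X \<in> Ob D" for X
  proof -
    obtain n :: nat where n: "sh (int n) X \<in> U" "sh (- int n) X \<in> V"
      using bounded[OF X] .
    \<comment> \<open>The extra shift is for U', which contains U[1] but in general not U.\<close>
    have "sh (int (Suc n)) X \<in> U'"
      using UU'[OF n(1)] X by (simp add: sh_sh)
    moreover have "sh (- int (Suc n)) X \<in> V'"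
      using VV'[OF V_sh[OF n(2), of "- 1"]] X by (simp add: sh_sh)
    moreover have "X = sh (- int (Suc n)) (sh (int (Suc n)) X)"
      "X = sh (int (Suc n)) (sh (- int (Suc n)) X)"
      using X by (simp_all add: sh_sh)
    ultimately show ?thesis
      by blast
  qed
  ultimately show "bounded_t_structure D U' V'"
    by (simp add: bounded_t_structure_def)
  show "U' \<subseteq> U" by (rule U'U)
  show "\<And>Y. Y \<in> V' \<Longrightarrow> sh (- 1) Y \<in> V" by (rule V'V)
qed

text \<open>That U' \<inter> V' equals F[1] * T is not computed directly. Once K = U' \<inter> V' is
  known to be intermediate, it is the tilt at the pair (K \<inter> H, K[-1] \<inter> H), and
  orthogonality identifies that pair with (T, F).\<close>

lemma tors_pair_intermediate:
  assumes tp: "tors_pair D Heart T F"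
  shows "tilt D T F \<in> intermediate_hearts D Heart"
proof -
  have TH: "T \<subseteq> Heart" and FH: "F \<subseteq> Heart" and hzTF: "\<And>X Y. X \<in> T \<Longrightarrow> Y \<in> F \<Longrightarrow> hz X Y"
    using tp unfolding tors_pair_def by blast+
  define U' V' where U'_def: "U' = {X. \<exists>a \<in> U. \<exists>t \<in> T. ext (sh 1 a) X t}"
    and V'_def: "V' = {X. \<exists>f \<in> F. \<exists>b \<in> V. ext (sh 1 f) X b}"
  define K where "K = U' \<inter> V'"
  have b: "bounded_t_structure D U' V'" and U': "U' \<subseteq> U" and V': "\<And>Y. Y \<in> V' \<Longrightarrow> sh (- 1) Y \<in> V"
    using tilt_t_structure[OF tp] unfolding U'_def V'_def by blast+
  interpret k: bounded_t_category D U' V'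
    by unfold_locales (rule b)
  have ge1: "heart_ge D (shift_sub D 1 Heart) K"
    unfolding heart_ge_def
  proof (intro allI impI ballI)
    fix n :: int and X Y assume n: "n > 0" and X: "X \<in> shift_sub D n (shift_sub D 1 Heart)" and Y: "Y \<in> K"
    obtain Z where Z: "Z \<in> Heart" "X = sh n (sh 1 Z)"
      using X by blast
    then have X': "X = sh (n + 1) Z" and ZO: "Z \<in> Ob D" and YO: "Y \<in> Ob D"
      using heart_ob Y k.heart_ob by (auto simp: sh_sh K_def)
    have "hz (sh n Z) (sh 0 (sh (- 1) Y))"
      using UV_hz[of Z "sh (- 1) Y" 0 n] Z V' Y n by (auto simp: K_def)
    then have "hz X Y"
      using hz_sh_add[OF ZO YO, of 1 n "- 1"] X' by (simp add: add.commute)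
    then show "Hom D X Y = {Zero D X Y}"
      using hom_zero_iff X' ZO YO sh_ob by blast
  qed
  have ge2: "heart_ge D K Heart"
    unfolding heart_ge_def
  proof (intro allI impI ballI)
    fix n :: int and X Y assume n: "n > 0" and X: "X \<in> shift_sub D n K" and Y: "Y \<in> Heart"
    obtain Z where Z: "Z \<in> K" "X = sh n Z"
      using X by blast
    then have "hz X Y"
      using UV_hz[of Z Y 0 n] U' Y n by (auto simp: K_def)
    then show "Hom D X Y = {Zero D X Y}"
      using hom_zero_iff Z Y sh_ob heart_ob k.heart_ob by (simp add: K_def)
  qed
  have K: "K \<in> intermediate_hearts D Heart"
    using ge1 ge2 b unfolding intermediate_hearts_def bounded_heart_def K_def by blast
  obtain N where N: "zero_object D N"
    using has_zero_object by blast
  have NUV: "N \<in> U" "N \<in> V" "N \<in> T" "N \<in> F"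
    using zero_in_UV[OF N] tors_pair_zero[OF tp N] by auto
  have "K \<inter> Heart = T"
  proof
    show "K \<inter> Heart \<subseteq> T"
    proof
      fix X assume X: "X \<in> K \<inter> Heart"
      then obtain a t where at: "a \<in> U" "t \<in> T" "ext (sh 1 a) X t"
        by (auto simp: K_def U'_def)
      have "hz X f" if f: "f \<in> F" for f
      proof -
        have "f \<in> Ob D" "f \<in> V"
          using f FH heart_ob by blast+
        then show ?thesis
          using ext_hz_from[OF at(3)] UV_hz[OF at(1), of f 0 1] hzTF[OF at(2) f] by simp
      qed
      then show "X \<in> T"
        using X tors_pair_T_iff[OF tp] by blast
    qed
    have "X \<in> K" if X: "X \<in> T" for X
    proof -
      have XO: "X \<in> Ob D" and XV: "X \<in> V"
        using X TH heart_ob by blast+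
      have "ext (sh 1 N) X X"
        using ext_id_left[OF XO zero_object_sh[OF N]] .
      then show ?thesis
        using X XV NUV by (auto simp: K_def U'_def V'_def)
    qed
    then show "T \<subseteq> K \<inter> Heart"
      using TH by blast
  qed
  moreover have "{Y \<in> Heart. sh 1 Y \<in> K} = F"
  proof
    show "{Y \<in> Heart. sh 1 Y \<in> K} \<subseteq> F"
    proof
      fix Y assume Y: "Y \<in> {Y \<in> Heart. sh 1 Y \<in> K}"
      then obtain f b where fb: "f \<in> F" "b \<in> V" "ext (sh 1 f) (sh 1 Y) b"
        by (auto simp: K_def V'_def)
      have "hz t Y" if t: "t \<in> T" for t
      proof -
        have ob: "t \<in> Ob D" "f \<in> Ob D" "Y \<in> Ob D" and tU: "t \<in> U"
          using t fb TH FH heart_ob Y by blast+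
        have "hz (sh 1 t) (sh 1 f)"
          using hz_sh[OF ob(1,2)] hzTF[OF t fb(1)] by blast
        moreover have "hz (sh 1 t) b"
          using UV_hz[OF tU fb(2), of 0 1] by simp
        ultimately have "hz (sh 1 t) (sh 1 Y)"
          using ext_hz_to[OF fb(3) sh_ob[OF ob(1)]] by blast
        then show ?thesis
          using hz_sh[OF ob(1,3)] by blast
      qed
      then show "Y \<in> F"
        using Y tors_pair_F_iff[OF tp] by blast
    qed
    have "sh 1 Y \<in> K" if Y: "Y \<in> F" for Y
    proof -
      have YO: "sh 1 Y \<in> Ob D" and YU: "Y \<in> U"
        using Y FH heart_ob sh_ob by blast+
      have "ext (sh 1 Y) (sh 1 Y) N"
        using ext_id_right[OF YO N] .
      then show ?thesis
        using Y YU NUV by (auto simp: K_def U'_def V'_def)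
    qed
    then show "F \<subseteq> {Y \<in> Heart. sh 1 Y \<in> K}"
      using FH by blast
  qed
  ultimately show ?thesis
    using intermediate_tors_pair(2)[OF K] K by simp
qed

lemma intermediate_hearts_eq_tilts:
  "intermediate_hearts D Heart = {tilt D T F | T F. tors_pair D Heart T F}"
  using intermediate_tors_pair tors_pair_intermediate by blast

end

section \<open>The heart as a category\<close>

lemma (in preadditive_category) preadditive_full_subcategory:
  assumes S: "S \<subseteq> Ob C"
  shows "preadditive_category (C\<lparr>Ob := S\<rparr>)"
proof -
  have hom_group_eq: "hom_group (C\<lparr>Ob := S\<rparr>) X Y = hom_group C X Y" for X Y
    by (simp add: hom_group_def)
  show ?thesis
  proof (intro preadditive_category.intro category.intro preadditive_category_axioms.intro, goal_cases)
    case (1 X Y X' Y' f)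
    then show ?case using hom_disjoint[of X Y X' Y' f] S by (simp add: subset_iff)
  next
    case (2 X)
    then show ?case using id_in_hom[of X] S by (simp add: subset_iff)
  next
    case (3 X Y Z f g)
    then show ?case using comp_in_hom[of X Y Z f g] S by (simp add: subset_iff)
  next
    case (4 X Y f)
    then show ?case using id_left[of X Y f] S by (simp add: subset_iff)
  next
    case (5 X Y f)
    then show ?case using id_right[of X Y f] S by (simp add: subset_iff)
  next
    case (6 W X Y Z f g h)
    then show ?case using comp_assoc[of W X Y Z f g h] S by (simp add: subset_iff)
  next
    case (7 X Y)
    then show ?case using comm_group_hom[of X Y] S by (simp add: subset_iff hom_group_eq)
  next
    case (8 X Y Z f g g')
    then show ?case using comp_distrib_left[of X Y Z f g g'] S by (simp add: subset_iff)
  next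
    case (9 X Y Z f f' g)
    then show ?case using comp_distrib_right[of X Y Z f f' g] S by (simp add: subset_iff)
  qed
qed

section \<open>Monomorphisms, cokernels and chain conditions\<close>

lemma (in category) mono_arrow_comp:
  assumes ob: "A \<in> Ob C" "B \<in> Ob C" "X \<in> Ob C" and n: "mono_arrow C A B n" and m: "mono_arrow C B X m"
  shows "mono_arrow C A X (m \<odot> n)"
proof -
  have h: "n \<in> Hom C A B" "m \<in> Hom C B X"
    using n m by (auto simp: mono_arrow_def)
  have "u = v" if W: "W \<in> Ob C" "u \<in> Hom C W A" "v \<in> Hom C W A" "(m \<odot> n) \<odot> u = (m \<odot> n) \<odot> v" for W u v
  proof -
    have "m \<odot> (n \<odot> u) = m \<odot> (n \<odot> v)"
      using comp_assoc[OF W(1) ob W(2) h] comp_assoc[OF W(1) ob W(3) h] W(4) by simp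
    moreover have "n \<odot> u \<in> Hom C W B" "n \<odot> v \<in> Hom C W B"
      using comp_in_hom[OF W(1) ob(1,2)] W h by blast+
    ultimately have "n \<odot> u = n \<odot> v"
      using m W(1) unfolding mono_arrow_def by blast
    then show ?thesis
      using n W unfolding mono_arrow_def by blast
  qed
  then show ?thesis
    using comp_in_hom[OF ob h] unfolding mono_arrow_def by blast
qed

lemma (in category) iso_mono:
  assumes ob: "X \<in> Ob C" "Y \<in> Ob C" and e: "iso_arrow C X Y e"
  shows "mono_arrow C X Y e"
proof -
  obtain d where d: "e \<in> Hom C X Y" "d \<in> Hom C Y X" "d \<odot> e = Id C X"
    using e unfolding iso_arrow_def by blast
  have "u = v" if W: "W \<in> Ob C" "u \<in> Hom C W X" "v \<in> Hom C W X" "e \<odot> u = e \<odot> v" for W u v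
  proof -
    have "(d \<odot> e) \<odot> u = (d \<odot> e) \<odot> v"
      using comp_assoc[OF W(1) ob ob(1) W(2) d(1,2)] comp_assoc[OF W(1) ob ob(1) W(3) d(1,2)] W(4)
      by simp
    then show ?thesis
      using d id_left[OF W(1) ob(1) W(2)] id_left[OF W(1) ob(1) W(3)] by simp
  qed
  then show ?thesis
    using d unfolding mono_arrow_def by blast
qed

definition cokernel_arrow ::
    "('o, 'm, 'z) add_cat_scheme \<Rightarrow> 'o \<Rightarrow> 'o \<Rightarrow> 'o \<Rightarrow> 'm \<Rightarrow> 'm \<Rightarrow> bool" where
  "cokernel_arrow C A X B f g \<longleftrightarrow> g \<in> Hom C X B \<and> Comp C g f = Zero C A B \<and>
    (\<forall>W \<in> Ob C. \<forall>u \<in> Hom C X W. Comp C u f = Zero C A W \<longrightarrow>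
      (\<exists>!v. v \<in> Hom C B W \<and> Comp C v g = u))"

lemma (in preadditive_category) cokernel_arrow_unique:
  assumes ob: "A \<in> Ob C" "X \<in> Ob C" "B \<in> Ob C" "B' \<in> Ob C"
    and g: "cokernel_arrow C A X B f g" and g': "cokernel_arrow C A X B' f g'"
  shows "isomorphic_in C B B'"
proof -
  have ex: "\<exists>v. v \<in> Hom C B2 W \<and> v \<odot> g2 = u"
    if "cokernel_arrow C A X B2 f g2" "W \<in> Ob C" "u \<in> Hom C X W" "u \<odot> f = Zero C A W" for B2 g2 W u
    using that unfolding cokernel_arrow_def by blast
  have uniq: "v = Id C B2"
    if c: "cokernel_arrow C A X B2 f g2" and B2: "B2 \<in> Ob C" and v: "v \<in> Hom C B2 B2" "v \<odot> g2 = g2"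
    for B2 g2 v
  proof -
    have "g2 \<in> Hom C X B2" "g2 \<odot> f = Zero C A B2"
      using c unfolding cokernel_arrow_def by blast+
    moreover from this have "Id C B2 \<odot> g2 = g2"
      using id_left ob B2 by blast
    ultimately show ?thesis
      using c B2 v id_in_hom[OF B2] unfolding cokernel_arrow_def by blast
  qed
  have h: "g \<in> Hom C X B" "g' \<in> Hom C X B'" "g \<odot> f = Zero C A B" "g' \<odot> f = Zero C A B'"
    using g g' unfolding cokernel_arrow_def by blast+
  obtain v where v: "v \<in> Hom C B B'" "v \<odot> g = g'"
    using ex[OF g ob(4) h(2,4)] by blast
  obtain v' where v': "v' \<in> Hom C B' B" "v' \<odot> g' = g"
    using ex[OF g' ob(3) h(1,3)] by blast
  have "(v' \<odot> v) \<odot> g = g"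
    using comp_assoc[OF ob(2,3,4,3) h(1) v(1) v'(1)] v v' by simp
  then have 1: "v' \<odot> v = Id C B"
    using uniq[OF g ob(3)] comp_in_hom[OF ob(3,4,3) v(1) v'(1)] by blast
  have "(v \<odot> v') \<odot> g' = g'"
    using comp_assoc[OF ob(2,4,3,4) h(2) v'(1) v(1)] v v' by simp
  then have 2: "v \<odot> v' = Id C B'"
    using uniq[OF g' ob(4)] comp_in_hom[OF ob(4,3,4) v'(1) v(1)] by blast
  show ?thesis
    using 1 2 v v' unfolding isomorphic_in_def iso_arrow_def by blast
qed

text \<open>In an abelian category, a monomorphism with its cokernel is a short exact sequence, so these are
  the usual torsion pairs; nothing here refers to an ambient triangulated category.\<close>

definition torsion_pair_in :: "('o, 'm, 'z) add_cat_scheme \<Rightarrow> 'o set \<Rightarrow> 'o set \<Rightarrow> bool" where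
  "torsion_pair_in C T F \<longleftrightarrow> strictly_full C T \<and> strictly_full C F \<and>
    (\<forall>X \<in> T. \<forall>Y \<in> F. hom_zero C X Y) \<and>
    (\<forall>X \<in> Ob C. \<exists>A \<in> T. \<exists>B \<in> F. \<exists>f g. mono_arrow C A X f \<and> cokernel_arrow C A X B f g)"

text \<open>Without a maximal element, iterating a choice of strictly larger elements gives a chain
  that never stabilises. The relation is arbitrary so that reversing it yields minimal elements from
  the artinian condition.\<close>

lemma chain_condition_maximal:
  assumes chain: "\<And>a :: nat \<Rightarrow> 'a. (\<forall>n. a n \<in> S) \<Longrightarrow> (\<forall>n. R (a n) (a (Suc n))) \<Longrightarrow>
      \<exists>N. \<forall>n \<ge> N. R (a n) (a N)"
    and ne: "S \<noteq> {}"
  obtains a where "a \<in> S" "\<And>b. b \<in> S \<Longrightarrow> R a b \<Longrightarrow> R b a"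
proof (rule ccontr)
  assume "\<not> thesis"
  then have "\<forall>a \<in> S. \<exists>b \<in> S. R a b \<and> \<not> R b a"
    using that by blast
  then obtain nxt where nxt: "\<And>a. a \<in> S \<Longrightarrow> nxt a \<in> S \<and> R a (nxt a) \<and> \<not> R (nxt a) a"
    by metis
  obtain a0 where a0: "a0 \<in> S"
    using ne by blast
  define a where "a n = (nxt ^^ n) a0" for n
  have aS: "a n \<in> S" for n
    by (induction n) (auto simp: a_def a0 nxt)
  then have step: "R (a n) (a (Suc n))" "\<not> R (a (Suc n)) (a n)" for n
    using nxt[of "a n"] by (auto simp: a_def)
  then show False
    using chain[of a] aS by (meson le_SucI order_refl)
qed

lemma noetherian_maximal:
  assumes "noetherian_cat C" "X \<in> Ob C" "S \<subseteq> subobjects C X" "S \<noteq> {}"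
  obtains a where "a \<in> S" "\<And>b. b \<in> S \<Longrightarrow> subobject_le C a b \<Longrightarrow> subobject_le C b a"
  by (rule chain_condition_maximal[of S "subobject_le C"])
    (use assms in \<open>unfold noetherian_cat_def, blast+\<close>)

lemma artinian_minimal:
  assumes "artinian_cat C" "X \<in> Ob C" "S \<subseteq> subobjects C X" "S \<noteq> {}"
  obtains a where "a \<in> S" "\<And>b. b \<in> S \<Longrightarrow> subobject_le C b a \<Longrightarrow> subobject_le C a b"
  by (rule chain_condition_maximal[of S "\<lambda>a b. subobject_le C b a"])
    (use assms in \<open>unfold artinian_cat_def, blast+\<close>)

context bounded_t_category
begin

abbreviation HC :: "('o, 'm, 'z) tri_cat_scheme" where "HC \<equiv> D\<lparr>Ob := Heart\<rparr>"

sublocale heart: preadditive_category HC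
  by (rule preadditive_full_subcategory) (use heart_ob in blast)

section \<open>Short exact sequences in a heart\<close>

lemma heart_mono_iff:
  assumes "A \<in> Heart" "X \<in> Heart"
  shows "mono_arrow HC A X m \<longleftrightarrow> m \<in> Hom D A X \<and>
    (\<forall>W \<in> Heart. \<forall>u \<in> Hom D W A. m \<odot> u = Zero D W X \<longrightarrow> u = Zero D W A)"
  using heart.mono_arrow_iff[of A X m] assms by simp

text \<open>A triangle with its three terms in the heart is a short exact sequence: cancellation
  comes from Hom(W, B[-1]) = 0 here, and uniqueness of factorisations from Hom(A[1], W) = 0 in
  \<open>heart_tri_cokernel\<close>.\<close>

lemma heart_tri_mono:
  assumes T: "Tri D A X B f g h" and ob: "A \<in> Heart" "X \<in> Heart" "B \<in> Heart"
  shows "mono_arrow HC A X f"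
proof -
  have "u = Zero D W A" if "W \<in> Heart" "u \<in> Hom D W A" "f \<odot> u = Zero D W X" for W u
    using tri_left_cancel_zero[OF T heart_ob[OF that(1)] heart_hz_1(2)[OF that(1) ob(3)] that(2,3)] .
  then show ?thesis
    using tri_typed[OF T] heart_mono_iff[OF ob(1,2)] by blast
qed

lemma heart_tri_cokernel:
  assumes T: "Tri D A X B f g h" and ob: "A \<in> Heart" "X \<in> Heart" "B \<in> Heart"
  shows "cokernel_arrow HC A X B f g"
proof -
  note ty = tri_typed[OF T]
  have "\<exists>!v. v \<in> Hom D B W \<and> v \<odot> g = u"
    if W: "W \<in> Heart" and u: "u \<in> Hom D X W" "u \<odot> f = Zero D A W" for W u
  proof (rule ex_ex1I)
    show "\<exists>v. v \<in> Hom D B W \<and> v \<odot> g = u"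
      using tri_cofactor[OF T heart_ob[OF W] u] by blast
    fix v v' assume v: "v \<in> Hom D B W \<and> v \<odot> g = u" "v' \<in> Hom D B W \<and> v' \<odot> g = u"
    show "v = v'"
    proof (rule right_cancel[of W B X g])
      show "r = Zero D B W" if "r \<in> Hom D B W" "r \<odot> g = Zero D X W" for r
        using tri_right_cancel_zero[OF T heart_ob[OF W] heart_hz_1(1)[OF ob(1) W] that] .
    qed (use v ty heart_ob[OF W] in auto)
  qed
  then show ?thesis
    using ty tri_comp_zero[OF T] by (simp add: cokernel_arrow_def)
qed

text \<open>The point is C in V, that is, every u : W[1] -> C with W in U vanishes. The composite of
  u with C -> A[1] is the shift of some v : W -> A killed by f. If v = 0, then u lifts to W[1] -> X,
  which is zero. As f is a monomorphism only against heart objects, v = 0 requires passing from W to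
  its truncation in the heart.\<close>

lemma mono_cone_in_heart:
  assumes m: "mono_arrow HC A X f" and ob: "A \<in> Heart" "X \<in> Heart" and T: "Tri D A X C f g h"
  shows "C \<in> Heart"
proof -
  note ty = tri_typed[OF T]
  have AO: "A \<in> Ob D" and XO: "X \<in> Ob D" and CO: "C \<in> Ob D" and f: "f \<in> Hom D A X"
    and g: "g \<in> Hom D X C" and h: "h \<in> Hom D C (ShO D A)"
    and A1: "ShO D A \<in> Ob D" and X1: "ShO D X \<in> Ob D"
    using ty ShO_ob by auto
  have e: "ext A X C"
    using T by (auto simp: is_ext_def)
  have fh: "ShM D f \<odot> h = Zero D C (ShO D X)"
  proof -
    have sf: "ShM D f \<in> Hom D (ShO D A) (ShO D X)"
      using ShM_hom[OF AO XO f] .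
    have "neg_arrow D (ShO D A) (ShO D X) (ShM D f) \<odot> h = Zero D C (ShO D X)"
      using tri_comp_zero[OF tri_rot[OF tri_rot[OF T]]] .
    then have "neg_arrow D C (ShO D X) (ShM D f \<odot> h) = neg_arrow D C (ShO D X) (Zero D C (ShO D X))"
      using neg_comp[OF CO A1 X1 h sf] neg_zero[OF CO X1] by simp
    then show ?thesis
      using neg_inj[OF CO X1] comp_in_hom[OF CO A1 X1 h sf] zero_hom[OF CO X1] by blast
  qed
  have "hz (sh 1 W) C" if W: "W \<in> U" for W
    unfolding hom_zero_def
  proof
    fix u assume u': "u \<in> Hom D (sh 1 W) C"
    have WO: "W \<in> Ob D" and W1: "ShO D W \<in> Ob D" and shW: "sh 1 W = ShO D W"
      using W U_ob ShO_ob sh_1 by auto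
    have u: "u \<in> Hom D (ShO D W) C"
      using u' shW by simp
    have hu: "h \<odot> u \<in> Hom D (ShO D W) (ShO D A)"
      using comp_in_hom[OF W1 CO A1 u h] .
    then obtain v where v: "v \<in> Hom D W A" "ShM D v = h \<odot> u"
      using ShM_surj[OF WO AO] by blast
    have fv: "f \<odot> v \<in> Hom D W X"
      using comp_in_hom[OF WO AO XO v(1) f] .
    have "ShM D (f \<odot> v) = (ShM D f \<odot> h) \<odot> u"
      using ShM_comp[OF WO AO XO v(1) f] v comp_assoc[OF W1 CO A1 X1 u h ShM_hom[OF AO XO f]] by simp
    also have "\<dots> = ShM D (Zero D W X)"
      using fh comp_zero_left[OF W1 CO X1 u] ShM_zero[OF WO XO] by simp
    finally have fv0: "f \<odot> v = Zero D W X"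
      using ShM_inj[OF WO XO fv zero_hom[OF WO XO]] by blast
    \<comment> \<open>W0 is the degree-zero cohomology of W. Both v and the relation f v = 0 descend
      to it, since W1' has no maps to A and its shift none to X.\<close>
    obtain W1' W0 where eW: "ext W1' W W0" and W1': "sh (- 1) W1' \<in> U" and W0: "W0 \<in> V"
      using truncation[of W "- 1"] WO by auto
    then obtain a b c where TW: "Tri D W1' W W0 a b c"
      by (auto simp: is_ext_def)
    have tyW: "W1' \<in> Ob D" "W0 \<in> Ob D" "a \<in> Hom D W1' W" "b \<in> Hom D W W0"
      using tri_typed[OF TW] by auto
    have sW: "sh 1 (sh (- 1) W1') = W1'" "sh 2 (sh (- 1) W1') = sh 1 W1'"
      using tyW by (simp_all add: sh_sh)
    have "sh 1 W1' \<in> U"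
      using U_sh[OF W1', of 2] sW by simp
    then have W0H: "W0 \<in> Heart"
      using U_cone[OF eW W] W0 by blast
    have hzW: "hz W1' A" "hz (sh 1 W1') X"
      using UV_hz[OF W1', of A 0 1] UV_hz[OF W1', of X 0 2] ob sW by auto
    have "v \<odot> a = Zero D W1' A"
      using hom_zeroD[OF hzW(1)] comp_in_hom[OF tyW(1) WO AO tyW(3) v(1)] by blast
    then obtain v0 where v0: "v0 \<in> Hom D W0 A" "v0 \<odot> b = v"
      using tri_cofactor[OF TW AO v(1)] by blast
    have "(f \<odot> v0) \<odot> b = Zero D W X"
      using comp_assoc[OF WO tyW(2) AO XO tyW(4) v0(1) f] v0 fv0 by simp
    then have "f \<odot> v0 = Zero D W0 X"
      using tri_right_cancel_zero[OF TW XO hzW(2)] comp_in_hom[OF tyW(2) AO XO v0(1) f] by blast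
    then have "v0 = Zero D W0 A"
      using m heart_mono_iff[OF ob] W0H v0 by blast
    then have "v = Zero D W A"
      using v0 comp_zero_left[OF WO tyW(2) AO tyW(4)] by simp
    then have "h \<odot> u = Zero D (ShO D W) (ShO D A)"
      using v ShM_zero[OF WO AO] by simp
    then obtain w where w: "w \<in> Hom D (ShO D W) X" "g \<odot> w = u"
      using tri_factor[OF tri_rot[OF T] W1 u] by blast
    have "hz (ShO D W) X"
      using UV_hz[OF W, of X 0 1] ob shW by simp
    then have "w = Zero D (ShO D W) X"
      using w hom_zeroD[of D "ShO D W" X w] by simp
    then show "u = Zero D (sh 1 W) C"
      using w comp_zero_right[OF W1 XO CO g] shW by simp
  qed
  then have "C \<in> V"
    using CO by (simp add: V_iff)
  moreover have "C \<in> U"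
    using U_cone[OF e] U_sh[of A 1] ob by simp
  ultimately show ?thesis
    by blast
qed

text \<open>From left to right, the given cokernel B is replaced by the cone of the monomorphism: it
  lies in the heart, is a cokernel as well, hence is isomorphic to B and belongs to F.\<close>

lemma torsion_pair_in_heart_iff:
  "torsion_pair_in HC T F \<longleftrightarrow> tors_pair D Heart T F"
proof
  have full: "strictly_full HC S \<longleftrightarrow> S \<subseteq> Heart \<and> strictly_full D S" for S
  proof
    assume S: "strictly_full HC S"
    then have "S \<subseteq> Heart"
      by (simp add: strictly_full_def)
    moreover have "Y \<in> S" if "X \<in> S" "Y \<in> Ob D" "isomorphic_in D X Y" for X Y
    proof -
      have "Y \<in> Heart"
        using strictly_fullD[OF heart_full] that \<open>S \<subseteq> Heart\<close> by blast
      then show ?thesis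
        using S that by (simp add: strictly_full_def isomorphic_in_def iso_arrow_def)
    qed
    ultimately show "S \<subseteq> Heart \<and> strictly_full D S"
      using heart_ob unfolding strictly_full_def by blast
  next
    assume S: "S \<subseteq> Heart \<and> strictly_full D S"
    then show "strictly_full HC S"
      using strictly_fullD[of S] heart_ob
      by (simp add: strictly_full_def isomorphic_in_def iso_arrow_def)
  qed
  have hz: "hom_zero HC X Y \<longleftrightarrow> hz X Y" for X Y
    by (simp add: hom_zero_def)
  show "tors_pair D Heart T F" if tp: "torsion_pair_in HC T F"
  proof -
    have TF: "T \<subseteq> Heart" "F \<subseteq> Heart" "strictly_full D T" "strictly_full D F"
      using tp full unfolding torsion_pair_in_def by blast+
    have "\<exists>A \<in> T. \<exists>B \<in> F. ext A X B" if X: "X \<in> Heart" for X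
    proof -
      have "X \<in> Ob HC"
        using X by simp
      then obtain A B f g where A: "A \<in> T" and B: "B \<in> F" and f: "mono_arrow HC A X f"
        and g: "cokernel_arrow HC A X B f g"
        using tp unfolding torsion_pair_in_def by blast
      have H: "A \<in> Heart" "B \<in> Heart"
        using A B TF by blast+
      have "f \<in> Hom D A X"
        using f by (simp add: mono_arrow_def)
      then obtain C g0 h0 where T0: "Tri D A X C f g0 h0"
        using tri_cone heart_ob H X by blast
      have C: "C \<in> Heart"
        using mono_cone_in_heart[OF f H(1) X T0] .
      have "isomorphic_in HC B C"
        by (rule heart.cokernel_arrow_unique[OF _ _ _ _ g
              heart_tri_cokernel[OF T0 H(1) X C]]) (use H X C in simp_all)
      then have "C \<in> F"
        using strictly_fullD[OF TF(4) B heart_ob[OF C]] by (simp add: isomorphic_in_def iso_arrow_def)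
      then show ?thesis
        using A T0 unfolding is_ext_def by blast
    qed
    then show ?thesis
      using tp TF hz unfolding tors_pair_def torsion_pair_in_def by blast
  qed
  show "torsion_pair_in HC T F" if tp: "tors_pair D Heart T F"
  proof -
    have TF: "T \<subseteq> Heart" "F \<subseteq> Heart" "strictly_full D T" "strictly_full D F"
      using tp unfolding tors_pair_def by blast+
    have "\<exists>A \<in> T. \<exists>B \<in> F. \<exists>f g. mono_arrow HC A X f \<and> cokernel_arrow HC A X B f g"
      if X: "X \<in> Heart" for X
    proof -
      obtain A B f g h where A: "A \<in> T" "B \<in> F" and T0: "Tri D A X B f g h"
        using tp X unfolding tors_pair_def is_ext_def by blast
      have "A \<in> Heart" "B \<in> Heart"
        using A TF by blast+
      then show ?thesis
        using A heart_tri_mono[OF T0 _ X] heart_tri_cokernel[OF T0 _ X] by blast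
    qed
    then show ?thesis
      using tp TF hz full unfolding tors_pair_def torsion_pair_in_def by simp
  qed
qed

text \<open>For C the cone of the arrow, the kernel k is H^-1(C), the cokernel c is H^0(C), and the
  image I is the fibre of B -> c. The octahedral axiom for B -> C -> c yields A[1] -> I[1] -> k[2],
  which is rotated back to k -> A -> I.\<close>

lemma heart_image:
  assumes AB: "A \<in> Heart" "B \<in> Heart" and f0: "f0 \<in> Hom D A B"
  obtains k I c n p p' m q q' where "k \<in> Heart" "I \<in> Heart" "c \<in> Heart"
    "Tri D k A I n p p'" "Tri D I B c m q q'" "m \<odot> p = f0"
proof -
  have AO: "A \<in> Ob D" and BO: "B \<in> Ob D"
    using AB heart_ob by auto
  \<comment> \<open>Rotating a triangle back three times changes the sign of its arrows.\<close>
  define f where "f = neg_arrow D A B f0"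
  have f: "f \<in> Hom D A B"
    using neg_hom[OF AO BO f0] f_def by simp
  obtain C b d where TC: "Tri D A B C f b d"
    using tri_cone[OF AO BO f] by blast
  have CO: "C \<in> Ob D" and b: "b \<in> Hom D B C"
    using tri_typed[OF TC] by auto
  have eC: "ext A B C"
    using TC by (auto simp: is_ext_def)
  obtain A' c where ec: "ext A' C c" and A': "sh (- 1) A' \<in> U" and cV: "c \<in> V"
    using truncation[of C "- 1"] CO by auto
  obtain x q0 y where Tc: "Tri D A' C c x q0 y"
    using ec by (auto simp: is_ext_def)
  have A'O: "A' \<in> Ob D" and cO: "c \<in> Ob D" and q0: "q0 \<in> Hom D C c"
    using tri_typed[OF Tc] by auto
  have AO1: "ShO D A \<in> Ob D" and BO1: "ShO D B \<in> Ob D" and A'O1: "ShO D A' \<in> Ob D"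
    using AO BO A'O ShO_ob by auto
  obtain I1 k0 l where TI: "Tri D B c I1 (q0 \<odot> b) k0 l"
    using tri_cone[OF BO cO comp_in_hom[OF BO CO cO b q0]] by blast
  define I where "I = sh (- 1) I1"
  have I1O: "I1 \<in> Ob D"
    using tri_typed[OF TI] by auto
  then have IO: "I \<in> Ob D" and I1: "ShO D I = I1"
    using sh_ob sh_succ[of I1 "- 1"] by (auto simp: I_def)
  obtain u v where oct: "Tri D (ShO D A) (ShO D I) (ShO D A') u v
      (ShM D d \<odot> neg_arrow D (ShO D A') (ShO D C) (ShM D x))"
      "l \<odot> u = neg_arrow D (ShO D A) (ShO D B) (ShM D f)"
    using octahedral[OF tri_rot[OF TC] tri_rot[OF Tc] TI] I1 by blast
  obtain m where m: "m \<in> Hom D I B" "Tri D I B c m (q0 \<odot> b) k0"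
    "neg_arrow D (ShO D I) (ShO D B) (ShM D m) = l"
    using tri_unrot[OF TI IO I1] by blast
  obtain k1 where k1: "k1 \<in> Hom D A' (ShO D A)" "Tri D A' (ShO D A) (ShO D I) k1 u v"
    using tri_unrot[OF oct(1) A'O refl] by blast
  obtain k2 where k2: "k2 \<in> Hom D I A'" "Tri D I A' (ShO D A) k2 k1 u"
    using tri_unrot[OF k1(2) IO refl] by blast
  obtain p where p: "p \<in> Hom D A I" "Tri D A I A' p k2 k1"
    "neg_arrow D (ShO D A) (ShO D I) (ShM D p) = u"
    using tri_unrot[OF k2(2) AO refl] by blast
  define k where "k = sh (- 1) A'"
  have kO: "k \<in> Ob D" and k: "ShO D k = A'"
    using sh_ob sh_succ[of A' "- 1"] A'O by (auto simp: k_def)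
  obtain n where n: "Tri D k A I n p k2"
    using tri_unrot[OF p(2) kO k] by blast
  have "m \<odot> p = f0"
  proof -
    have s: "ShM D m \<in> Hom D (ShO D I) (ShO D B)" "ShM D p \<in> Hom D (ShO D A) (ShO D I)"
      using ShM_hom m p AO BO IO by blast+
    have IO1: "ShO D I \<in> Ob D"
      using I1 I1O by simp
    have mp: "m \<odot> p \<in> Hom D A B"
      using comp_in_hom[OF AO IO BO p(1) m(1)] .
    let ?N = "neg_arrow D (ShO D A) (ShO D B)"
    have un: "u \<in> Hom D (ShO D A) (ShO D I)"
      using p(3) neg_hom[OF AO1 IO1 s(2)] by simp
    have "l \<odot> u = ?N (ShM D m \<odot> u)"
      using neg_comp[OF AO1 IO1 BO1 un s(1)] m(3) by simp
    also have "ShM D m \<odot> u = ?N (ShM D m \<odot> ShM D p)"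
      using comp_neg[OF AO1 IO1 BO1 s(2,1)] p(3) by simp
    finally have "?N (?N (ShM D (m \<odot> p))) = ?N (ShM D f)"
      using oct(2) ShM_comp[OF AO IO BO p(1) m(1)] by simp
    moreover have "?N (ShM D (m \<odot> p)) \<in> Hom D (ShO D A) (ShO D B)" "ShM D f \<in> Hom D (ShO D A) (ShO D B)"
      using neg_hom[OF AO1 BO1] ShM_hom[OF AO BO] mp f by blast+
    ultimately have e1: "?N (ShM D (m \<odot> p)) = ShM D f"
      using neg_inj[OF AO1 BO1] by blast
    have sn: "ShM D (neg_arrow D A B f) = ?N (ShM D f)"
    proof (rule neg_unique[OF AO1 BO1])
      have nf: "neg_arrow D A B f \<in> Hom D A B"
        using neg_hom[OF AO BO f] .
      show "ShM D f \<boxplus> ShM D (neg_arrow D A B f) = Zero D (ShO D A) (ShO D B)"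
        using additive_functor_add[OF shift_functor AO BO f nf] add_neg[OF AO BO f] ShM_zero[OF AO BO]
        by simp
    qed (use ShM_hom[OF AO BO] neg_hom[OF AO BO f] f in blast)+
    have "ShM D (m \<odot> p) = ?N (ShM D f)"
      using e1 neg_neg[OF AO1 BO1 ShM_hom[OF AO BO mp]] by metis
    also have "\<dots> = ShM D f0"
      using sn neg_neg[OF AO BO f0] f_def by simp
    finally show ?thesis
      using ShM_inj[OF AO BO mp f0] by blast
  qed
  moreover have "c \<in> Heart"
  proof -
    have "C \<in> U"
      using U_cone[OF eC] U_sh[of A 1] AB by simp
    moreover have "sh 1 A' \<in> U"
      using U_sh[OF A', of 2] A'O by (simp add: sh_sh)
    ultimately show ?thesis
      using U_cone[OF ec] cV by blast
  qed
  moreover have IH: "I \<in> Heart"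
  proof -
    have "A' \<in> U"
      using U_sh[OF A', of 1] A'O by (simp add: sh_sh)
    moreover have "ext A I A'" "ext I B c"
      using p(2) m(2) by (auto simp: is_ext_def)
    ultimately show ?thesis
      using U_ext V_fibre V_sh[OF cV, of "- 1"] AB by auto
  qed
  moreover have "k \<in> Heart"
  proof -
    have "ext k A I"
      using n by (auto simp: is_ext_def)
    then show ?thesis
      using V_fibre[of k A I] V_sh[of I "- 1"] IH AB A' by (auto simp: k_def)
  qed
  ultimately show ?thesis
    using that m(2) n by blast
qed

text \<open>C is the preimage of B' in X, built as the fibre of X -> B -> Q with Q the cone of m.
  The octahedral axiom for this composite exhibits C as an extension of B' by A, compatibly with the
  maps to X.\<close>

lemma heart_pullback:
  assumes T: "Tri D A X B f g h" and ob: "A \<in> Heart" "X \<in> Heart" "B \<in> Heart"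
    and m: "mono_arrow HC B' B m" and B': "B' \<in> Heart"
  obtains C i a where "C \<in> Heart" "mono_arrow HC C X i" "a \<in> Hom D A C" "i \<odot> a = f" "ext A C B'"
proof -
  have O: "A \<in> Ob D" "X \<in> Ob D" "B \<in> Ob D" "B' \<in> Ob D"
    using ob B' heart_ob by auto
  have ty: "f \<in> Hom D A X" "g \<in> Hom D X B" "h \<in> Hom D B (ShO D A)"
    using tri_typed[OF T] by auto
  have mh: "m \<in> Hom D B' B"
    using m by (simp add: mono_arrow_def)
  obtain Q q r where TQ: "Tri D B' B Q m q r"
    using tri_cone[OF O(4,3) mh] by blast
  have Q: "Q \<in> Heart"
    using mono_cone_in_heart[OF m B' ob(3) TQ] .
  have QO: "Q \<in> Ob D" and q: "q \<in> Hom D B Q"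
    using tri_typed[OF TQ] by auto
  obtain E k l where TE: "Tri D X Q E (q \<odot> g) k l"
    using tri_cone[OF O(2) QO comp_in_hom[OF O(2,3) QO ty(2) q]] by blast
  define C where "C = sh (- 1) E"
  have EO: "E \<in> Ob D"
    using tri_typed[OF TE] by auto
  then have CO: "C \<in> Ob D" and E: "ShO D C = E"
    using sh_ob sh_succ[of E "- 1"] by (auto simp: C_def)
  obtain i where i: "i \<in> Hom D C X" "Tri D C X Q i (q \<odot> g) k"
    "neg_arrow D (ShO D C) (ShO D X) (ShM D i) = l"
    using tri_unrot[OF TE CO E] by blast
  have O1: "ShO D A \<in> Ob D" "ShO D X \<in> Ob D" "ShO D C \<in> Ob D"
    using O CO ShO_ob by auto
  obtain u v w where oct: "Tri D (ShO D A) (ShO D C) (ShO D B') u v w"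
    "l \<odot> u = neg_arrow D (ShO D A) (ShO D X) (ShM D f)"
    using octahedral[OF tri_rot[OF T] tri_rot[OF TQ] TE] E by blast
  then have "u \<in> Hom D (ShO D A) (ShO D C)"
    using tri_typed by blast
  then obtain a where a: "a \<in> Hom D A C" "ShM D a = u"
    using ShM_surj[OF O(1) CO] by blast
  have ia: "i \<odot> a \<in> Hom D A X"
    using comp_in_hom[OF O(1) CO O(2) a(1) i(1)] .
  let ?N = "neg_arrow D (ShO D A) (ShO D X)"
  have "?N (ShM D (i \<odot> a)) = ?N (ShM D f)"
    using oct(2) i(3) neg_comp[OF O1(1,3,2) ShM_hom[OF O(1) CO a(1)] ShM_hom[OF CO O(2) i(1)]] a(2)
      ShM_comp[OF O(1) CO O(2) a(1) i(1)] by simp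
  then have "ShM D (i \<odot> a) = ShM D f"
    using neg_inj[OF O1(1,2)] ShM_hom[OF O(1,2)] ia ty(1) by blast
  then have "i \<odot> a = f"
    using ShM_inj[OF O(1,2) ia ty(1)] by blast
  moreover have "ext (sh 1 A) (sh 1 C) (sh 1 B')"
    using oct(1) sh_1 O CO by (auto simp: is_ext_def)
  then have e: "ext A C B'"
    using ext_sh[of "sh 1 A" "sh 1 C" "sh 1 B'" "- 1"] O CO by (simp add: sh_sh)
  moreover have C: "C \<in> Heart"
    using heart_ext[OF e] ob B' by blast
  moreover have "mono_arrow HC C X i"
    using heart_tri_mono[OF i(2) C ob(2) Q] .
  ultimately show ?thesis
    using that a by blast
qed

end

section \<open>Torsion pairs from additive functions on length hearts\<close>

text \<open>w abstracts the map from X to the class of X in the lattice. Its composite with a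
  functional is again additive on triangles, which is how \<open>integer_additive\<close> is
  reached.\<close>

locale triangle_additive = bounded_t_category D U V
  for D :: "('o, 'm, 'z) tri_cat_scheme" (structure) and U V +
  fixes w :: "'o \<Rightarrow> 'a :: ab_group_add"
  assumes w_ext: "is_ext D A X B \<Longrightarrow> w X = w A + w B"
begin

lemma w_zero: "hz N N \<Longrightarrow> N \<in> Ob D \<Longrightarrow> w N = 0"
  using w_ext[OF ext_id_right[of N N]] zero_object_iff by auto

lemma w_iso: 
  assumes "X \<in> Ob D" "Y \<in> Ob D" "isomorphic_in D X Y"
  shows "w X = w Y"
proof -
  obtain N where N: "zero_object D N"
    using has_zero_object by blast
  then have NO: "N \<in> Ob D" "hz N N"
    using zero_object_iff by auto
  have "ext X Y N"
    using ext_iso[OF ext_id_right[OF assms(1) N] assms(1,2) NO(1)] assms isomorphic_refl NO by blast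
  then show ?thesis
    using w_ext w_zero NO by fastforce
qed

text \<open>Additivity on the rotated identity triangle X -> 0 -> X[1].\<close>

lemma w_sh: 
  assumes X: "X \<in> Ob D"
  shows "w (sh 1 X) = - w X"
proof -
  obtain N where N: "zero_object D N"
    using has_zero_object by blast
  then have "w N = 0"
    using zero_object_iff w_zero by auto
  moreover have "w N = w X + w (sh 1 X)"
    using w_ext[OF ext_rot[OF ext_id_right[OF X N]]] .
  ultimately show ?thesis
    by (simp add: eq_neg_iff_add_eq_0 add.commute)
qed

text \<open>A subobject of \<open>B = X/A\<close> pulls back to a subobject of \<open>X\<close> containing \<open>A\<close>.\<close>

lemma maximal_subobject_quotient:
  assumes X: "X \<in> Heart" and T: "Tri D A X B f g h" and A: "A \<in> Heart" "B \<in> Heart"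
    and max: "\<And>b. b \<in> subobjects HC X \<Longrightarrow> P (fst b) \<Longrightarrow> subobject_le HC (A, f) b \<Longrightarrow>
      subobject_le HC b (A, f)"
    and B': "(B', m) \<in> subobjects HC B" and P: "\<And>C. C \<in> Heart \<Longrightarrow> ext A C B' \<Longrightarrow> P C"
  shows "w B' = 0"
proof -
  have B'H: "B' \<in> Heart" and m: "mono_arrow HC B' B m"
    using B' by (auto simp: subobjects_def)
  obtain C i a where C: "C \<in> Heart" "mono_arrow HC C X i" "a \<in> Hom D A C" "i \<odot> a = f" "ext A C B'"
    using heart_pullback[OF T A(1) X A(2) m B'H] .
  have "(C, i) \<in> subobjects HC X" "subobject_le HC (A, f) (C, i)"
    using C by (auto simp: subobjects_def subobject_le_def)
  then have "subobject_le HC (C, i) (A, f)"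
    using max P C by simp
  then obtain s where s: "s \<in> Hom D C A" "i = f \<odot> s"
    by (auto simp: subobject_le_def)
  have O: "A \<in> Ob D" "C \<in> Ob D" "X \<in> Ob D"
    using A C X heart_ob by auto
  have h: "i \<in> Hom D C X" "f \<in> Hom D A X"
    using C tri_typed[OF T] by (auto simp: mono_arrow_def)
  have "i \<odot> (a \<odot> s) = i \<odot> Id D C"
    using comp_assoc[OF O(2,1,2,3) s(1) C(3) h(1)] C(4) s(2) id_right[OF O(2,3) h(1)] by simp
  then have "a \<odot> s = Id D C"
    using C(1,2) comp_in_hom[OF O(2,1,2) s(1) C(3)] id_in_hom[OF O(2)] by (auto simp: mono_arrow_def)
  moreover have "f \<odot> (s \<odot> a) = f \<odot> Id D A"
    using comp_assoc[OF O(1,2,1,3) C(3) s(1) h(2)] C(4) s(2) id_right[OF O(1,3) h(2)] by simp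
  then have "s \<odot> a = Id D A"
    using heart_tri_mono[OF T A(1) X A(2)] A comp_in_hom[OF O(1,2,1) C(3) s(1)] id_in_hom[OF O(1)]
    by (auto simp: mono_arrow_def)
  \<comment> \<open>By maximality the inclusion of A into C is invertible, so w C = w A and the
    quotient B' has value 0.\<close>
  ultimately have "isomorphic_in D A C"
    using s(1) C(3) unfolding isomorphic_in_def iso_arrow_def by blast
  then show ?thesis
    using w_iso[OF O(1,2)] w_ext[OF C(5)] by simp
qed

end

locale integer_additive = triangle_additive D U V w
  for D :: "('o, 'm, 'z) tri_cat_scheme" (structure) and U V and w :: "'o \<Rightarrow> int" +
  assumes length: "length_cat (D\<lparr>Ob := U \<inter> V\<rparr>)"
begin

definition Fw :: "'o set" where
  "Fw = {X \<in> Heart. \<forall>a \<in> subobjects HC X. w (fst a) \<le> 0}"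

definition Tw :: "'o set" where
  "Tw = {X \<in> Heart. \<forall>Y \<in> Fw. hz X Y}"

lemma Fw_le: "X \<in> Fw \<Longrightarrow> w X \<le> 0"
proof -
  assume X: "X \<in> Fw"
  then have XH: "X \<in> Heart"
    by (simp add: Fw_def)
  then have "iso_arrow HC X X (Id D X)"
    using heart.iso_arrow_id[of X] by simp
  then have "mono_arrow HC X X (Id D X)"
    using heart.iso_mono[of X X] XH by simp
  then have "(X, Id D X) \<in> subobjects HC X"
    using XH by (simp add: subobjects_def)
  then show ?thesis
    using X by (force simp: Fw_def)
qed

lemma Fw_full: "strictly_full D Fw"
  unfolding strictly_full_def
proof (intro conjI ballI impI)
  show "Fw \<subseteq> Ob D"
    using heart_ob by (auto simp: Fw_def)
  fix X Y assume X: "X \<in> Fw" and Y: "Y \<in> Ob D" and iso: "isomorphic_in D X Y"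
  have H: "X \<in> Heart" "Y \<in> Heart"
    using X strictly_fullD[OF heart_full _ Y iso] by (auto simp: Fw_def)
  obtain e where "iso_arrow D Y X e"
    using isomorphic_sym[OF iso] by (auto simp: isomorphic_in_def)
  then have "iso_arrow HC Y X e"
    by (simp add: iso_arrow_def)
  then have e: "mono_arrow HC Y X e"
    using heart.iso_mono[of Y X e] H by simp
  have "w A \<le> 0" if "(A, m) \<in> subobjects HC Y" for A m
  proof -
    have "A \<in> Heart" "mono_arrow HC A Y m"
      using that by (auto simp: subobjects_def)
    then have "(A, e \<odot> m) \<in> subobjects HC X"
      using heart.mono_arrow_comp[of A Y X m e] H e by (simp add: subobjects_def)
    then show ?thesis
      using X by (force simp: Fw_def)
  qed
  then show "Y \<in> Fw"
    using H by (auto simp: Fw_def)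
qed

lemma Tw_full: "strictly_full D Tw"
  unfolding strictly_full_def
proof (intro conjI ballI impI)
  show "Tw \<subseteq> Ob D"
    using heart_ob by (auto simp: Tw_def)
  fix X Y assume X: "X \<in> Tw" and Y: "Y \<in> Ob D" and iso: "isomorphic_in D X Y"
  have H: "X \<in> Heart" "Y \<in> Heart"
    using X strictly_fullD[OF heart_full _ Y iso] by (auto simp: Tw_def)
  have "hz Y Z" if Z: "Z \<in> Fw" for Z
  proof -
    have "Z \<in> Ob D" "X \<in> Ob D" "hz X Z"
      using Z H X heart_ob by (auto simp: Fw_def Tw_def)
    then show ?thesis
      using hom_zero_iso[of X Y Z Z] Y iso isomorphic_refl by blast
  qed
  then show "Y \<in> Tw"
    using H by (simp add: Tw_def)
qed

lemma Tw_ext: "ext A X B \<Longrightarrow> A \<in> Tw \<Longrightarrow> B \<in> Tw \<Longrightarrow> X \<in> Tw"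
  using ext_hz_from[of A X B] heart_ext[of A X B] heart_ob by (auto simp: Tw_def Fw_def)

text \<open>A minimal subobject of positive value is torsion, since the kernel of any nonzero map to
  \<open>Fw\<close> would be a smaller one.\<close>

lemma torsion_subobject:
  assumes B: "B \<in> Heart" "B \<notin> Fw"
  obtains B' m where "(B', m) \<in> subobjects HC B" "w B' > 0" "B' \<in> Tw"
proof -
  define S where "S = {a \<in> subobjects HC B. w (fst a) > 0}"
  have S: "S \<subseteq> subobjects HC B" "S \<noteq> {}"
    using B by (auto simp: S_def Fw_def not_le)
  have artin: "artinian_cat HC"
    using length by (simp add: length_cat_def)
  have BO: "B \<in> Ob HC"
    using B by simp
  obtain a where a: "a \<in> S"
    and min: "\<And>b. b \<in> S \<Longrightarrow> subobject_le HC b a \<Longrightarrow> subobject_le HC a b"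
    using artinian_minimal[OF artin BO S] by metis
  obtain B' m where Bm: "a = (B', m)"
    by (cases a)
  have B': "B' \<in> Heart" "mono_arrow HC B' B m" "w B' > 0"
    using a Bm by (auto simp: S_def subobjects_def)
  have mh: "m \<in> Hom D B' B"
    using B' by (simp add: mono_arrow_def)
  have "hz B' Y" if Y: "Y \<in> Fw" for Y
    unfolding hom_zero_def
  proof
    fix \<phi> assume \<phi>: "\<phi> \<in> Hom D B' Y"
    have YH: "Y \<in> Heart"
      using Y by (simp add: Fw_def)
    \<comment> \<open>The kernel and image of \<phi>. The image is a subobject of Y in
      \<open>Fw\<close>, so its value is at most 0 and that of the kernel is at least w B' >
      0.\<close>
    obtain k I c n p p' m' q q' where H: "k \<in> Heart" "I \<in> Heart" "c \<in> Heart"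
      and Tk: "Tri D k B' I n p p'" and TI: "Tri D I Y c m' q q'" and mp: "m' \<odot> p = \<phi>"
      using heart_image[OF B'(1) YH \<phi>] by blast
    have O: "k \<in> Ob D" "I \<in> Ob D" "Y \<in> Ob D" "B' \<in> Ob D" "B \<in> Ob D"
      using H YH B'(1) B(1) heart_ob by auto
    have n: "n \<in> Hom D k B'" and p: "p \<in> Hom D B' I" and m': "m' \<in> Hom D I Y"
      using tri_typed[OF Tk] tri_typed[OF TI] by auto
    have "(I, m') \<in> subobjects HC Y"
      using heart_tri_mono[OF TI H(2) YH H(3)] H by (simp add: subobjects_def)
    then have "w I \<le> 0"
      using Y by (force simp: Fw_def)
    moreover have "w B' = w k + w I"
      using Tk w_ext unfolding is_ext_def by blast
    ultimately have "w k > 0"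
      using B' by simp
    moreover have "mono_arrow HC k B (m \<odot> n)"
      using heart.mono_arrow_comp[of k B' B n m] heart_tri_mono[OF Tk H(1) B'(1) H(2)] B' B H by simp
    ultimately have "(k, m \<odot> n) \<in> S"
      using H by (simp add: S_def subobjects_def)
    moreover have "subobject_le HC (k, m \<odot> n) a"
      using n Bm by (auto simp: subobject_le_def)
    ultimately have "subobject_le HC a (k, m \<odot> n)"
      by (rule min)
    \<comment> \<open>By minimality m factors through the kernel, so n is a split epimorphism; since
      p n = 0 this forces p = 0, and with it \<phi> = 0.\<close>
    then obtain s where s: "s \<in> Hom D B' k" "m = (m \<odot> n) \<odot> s"
      using Bm by (auto simp: subobject_le_def)
    have ns: "n \<odot> s \<in> Hom D B' B'"
      using comp_in_hom[OF O(4,1,4) s(1) n] .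
    have "m \<odot> (n \<odot> s) = m \<odot> Id D B'"
      using comp_assoc[OF O(4,1,4,5) s(1) n mh] s(2) id_right[OF O(4,5) mh] by simp
    then have "n \<odot> s = Id D B'"
      using B' ns id_in_hom[OF O(4)] by (auto simp: mono_arrow_def)
    then have "p = (p \<odot> n) \<odot> s"
      using comp_assoc[OF O(4,1,4,2) s(1) n p] id_right[OF O(4,2) p] by simp
    then have "p = Zero D B' I"
      using tri_comp_zero[OF Tk] comp_zero_left[OF O(4,1,2) s(1)] by simp
    then show "\<phi> = Zero D B' Y"
      using mp comp_zero_right[OF O(4,2,3) m'] by simp
  qed
  then have "B' \<in> Tw"
    using B' by (simp add: Tw_def)
  then show ?thesis
    using that a Bm B' by (auto simp: S_def)
qed

text \<open>Take a maximal subobject A with property P. A quotient outside \<open>Fw\<close> would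
  have a torsion subobject of positive value, whose preimage in X again satisfies P, contradicting
  maximality. P is left open because two choices of it are used, w >= 0 and membership in
  \<open>Tw\<close>.\<close>

lemma quotient_torsion_free:
  assumes X: "X \<in> Heart" and N: "\<And>N. zero_object D N \<Longrightarrow> P N"
    and P: "\<And>A C B'. C \<in> Heart \<Longrightarrow> ext A C B' \<Longrightarrow> P A \<Longrightarrow> w B' > 0 \<Longrightarrow> B' \<in> Tw \<Longrightarrow> P C"
  obtains A B where "A \<in> Heart" "P A" "B \<in> Fw" "ext A X B"
proof -
  define S where "S = {a \<in> subobjects HC X. P (fst a)}"
  \<comment> \<open>The zero subobject makes S nonempty.\<close>
  obtain N where N0: "zero_object D N"
    using has_zero_object by blast
  have NH: "N \<in> Heart" "N \<in> Ob D" "hz N N"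
    using zero_in_UV[OF N0] N0 zero_object_iff by auto
  have "u = Zero D W N" if "W \<in> Heart" "u \<in> Hom D W N" for W u
  proof -
    have "hz W N"
      using hom_zero_from_zero[OF heart_ob[OF that(1)] NH(2)] NH(3) by simp
    then show ?thesis
      using that(2) by (rule hom_zeroD)
  qed
  then have "mono_arrow HC N X (Zero D N X)"
    using heart_mono_iff[OF NH(1) X] zero_hom[OF NH(2) heart_ob[OF X]] by simp
  then have "(N, Zero D N X) \<in> S"
    using N[OF N0] NH by (simp add: S_def subobjects_def)
  then have S: "S \<subseteq> subobjects HC X" "S \<noteq> {}"
    by (auto simp: S_def)
  have noeth: "noetherian_cat HC" and XO: "X \<in> Ob HC"
    using length X by (simp_all add: length_cat_def)
  obtain a where a: "a \<in> S"
    and max: "\<And>b. b \<in> S \<Longrightarrow> subobject_le HC a b \<Longrightarrow> subobject_le HC b a"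
    using noetherian_maximal[OF noeth XO S] by metis
  obtain A f where Af: "a = (A, f)"
    by (cases a)
  have A: "A \<in> Heart" "mono_arrow HC A X f" "P A"
    using a Af by (auto simp: S_def subobjects_def)
  then have "f \<in> Hom D A X"
    by (simp add: mono_arrow_def)
  then obtain B g h where T: "Tri D A X B f g h"
    using tri_cone heart_ob A X by blast
  have BH: "B \<in> Heart"
    using mono_cone_in_heart[OF A(2,1) X T] .
  have "B \<in> Fw"
  proof (rule ccontr)
    assume "B \<notin> Fw"
    then obtain B' m where B': "(B', m) \<in> subobjects HC B" "w B' > 0" "B' \<in> Tw"
      using torsion_subobject BH by blast
    have "w B' = 0"
    proof (rule maximal_subobject_quotient[OF X T A(1) BH _ B'(1)])
      show "subobject_le HC b (A, f)"
        if "b \<in> subobjects HC X" "P (fst b)" "subobject_le HC (A, f) b" for b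
        using max[of b] that Af by (simp add: S_def)
      show "P C" if "C \<in> Heart" "ext A C B'" for C
        using P that A(3) B' by blast
    qed
    then show False
      using B' by simp
  qed
  then show ?thesis
    using that A T unfolding is_ext_def by blast
qed

text \<open>Take P to be w >= 0 in \<open>quotient_torsion_free\<close>. The quotient B lies in
  \<open>Fw\<close>, so X in \<open>Tw\<close> has no nonzero map to it; hence B = 0 and w X = w
  A.\<close>

lemma Tw_ge:
  assumes X: "X \<in> Tw"
  shows "w X \<ge> 0"
proof -
  have XH: "X \<in> Heart"
    using X by (simp add: Tw_def)
  have N: "w N \<ge> 0" if "zero_object D N" for N
    using that w_zero[of N] zero_object_iff[of N] by simp
  have P: "w C \<ge> 0"
    if "C \<in> Heart" "ext A C B'" "w A \<ge> 0" "w B' > 0" "B' \<in> Tw" for A C B'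
    using w_ext[OF that(2)] that by simp
  obtain A B where A: "A \<in> Heart" "w A \<ge> 0" "B \<in> Fw" "ext A X B"
    by (rule quotient_torsion_free[OF XH N P])
  have B: "B \<in> Heart" "B \<in> Ob D" "hz X B"
    using A X heart_ob by (auto simp: Fw_def Tw_def)
  then have "hz B B"
    using ext_hz_from[OF ext_rot[OF A(4)] B(2)] heart_hz_1(1)[OF A(1) B(1)] by blast
  then show ?thesis
    using w_zero B w_ext[OF A(4)] A(2) by simp
qed

text \<open>Here P is membership in \<open>Tw\<close>, which \<open>Tw_ext\<close> makes stable
  under the extensions in question.\<close>

lemma Tw_Fw_tors_pair: "tors_pair D Heart Tw Fw"
proof -
  have "\<exists>A \<in> Tw. \<exists>B \<in> Fw. ext A X B" if X: "X \<in> Heart" for X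
  proof -
    have N: "N \<in> Tw" if "zero_object D N" for N
    proof -
      have "N \<in> Heart" "N \<in> Ob D" "hz N N"
        using that zero_in_UV zero_object_iff by auto
      moreover from this have "hz N Y" if "Y \<in> Fw" for Y
        using hom_zero_from_zero[of N Y] heart_ob[of Y] that by (simp add: Fw_def)
      ultimately show ?thesis
        by (simp add: Tw_def)
    qed
    have P: "C \<in> Tw"
      if "C \<in> Heart" "ext A C B'" "A \<in> Tw" "w B' > 0" "B' \<in> Tw" for A C B'
      using Tw_ext[OF that(2,3,5)] .
    obtain A B where "A \<in> Tw" "B \<in> Fw" "ext A X B"
      by (rule quotient_torsion_free[OF X N P])
    then show ?thesis
      by blast
  qed
  moreover have "Tw \<subseteq> Heart" "Fw \<subseteq> Heart" "\<forall>X \<in> Tw. \<forall>Y \<in> Fw. hz X Y"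
    by (simp_all add: Tw_def Fw_def subset_iff)
  ultimately show ?thesis
    unfolding tors_pair_def using Fw_full Tw_full by blast
qed

end

section \<open>Invariance under additive equivalences\<close>

text \<open>Unique factorisation split into existence and cancellation against zero, the two
  conditions that are transported separately along isomorphisms and functors.\<close>

lemma (in preadditive_category) cokernel_arrow_iff:
  assumes ob: "A \<in> Ob C" "X \<in> Ob C" "B \<in> Ob C" and f: "f \<in> Hom C A X"
  shows "cokernel_arrow C A X B f g \<longleftrightarrow> g \<in> Hom C X B \<and> g \<odot> f = Zero C A B \<and>
    (\<forall>W \<in> Ob C. (\<forall>u \<in> Hom C X W. u \<odot> f = Zero C A W \<longrightarrow> (\<exists>v \<in> Hom C B W. v \<odot> g = u)) \<and>
      (\<forall>v \<in> Hom C B W. v \<odot> g = Zero C X W \<longrightarrow> v = Zero C B W))"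
    (is "?l \<longleftrightarrow> ?r")
proof
  assume l: ?l
  then have g: "g \<in> Hom C X B" "g \<odot> f = Zero C A B"
    by (auto simp: cokernel_arrow_def)
  have "v = Zero C B W"
    if W: "W \<in> Ob C" and v: "v \<in> Hom C B W" "v \<odot> g = Zero C X W" for W v
  proof -
    have "Zero C X W \<odot> f = Zero C A W" "Zero C B W \<odot> g = Zero C X W"
      using comp_zero_left[OF ob(1,2) W f] comp_zero_left[OF ob(2,3) W g(1)] by auto
    then show ?thesis
      using l v W zero_hom[OF ob(2) W] zero_hom[OF ob(3) W] unfolding cokernel_arrow_def by blast
  qed
  moreover have "\<exists>v \<in> Hom C B W. v \<odot> g = u"
    if "W \<in> Ob C" "u \<in> Hom C X W" "u \<odot> f = Zero C A W" for W u
    using l that unfolding cokernel_arrow_def by blast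
  ultimately show ?r
    using g by blast
next
  assume r: ?r
  then have g: "g \<in> Hom C X B"
    by blast
  have "v = v'" if "W \<in> Ob C" "v \<in> Hom C B W" "v' \<in> Hom C B W" "v \<odot> g = v' \<odot> g" for W v v'
    using right_cancel[OF that(1) ob(3,2) g _ that(2,3,4)] r that(1) by blast
  then show ?l
    using r unfolding cokernel_arrow_def by (intro conjI ballI impI ex_ex1I) blast+
qed

section \<open>Cokernels under isomorphisms of their terms\<close>

lemma (in category) iso_arrow_comp:
  assumes ob: "X \<in> Ob C" "Y \<in> Ob C" "Z \<in> Ob C" and f: "iso_arrow C X Y f" and g: "iso_arrow C Y Z g"
  shows "iso_arrow C X Z (g \<odot> f)"
proof -
  obtain f' where f': "f \<in> Hom C X Y" "f' \<in> Hom C Y X" "f' \<odot> f = Id C X" "f \<odot> f' = Id C Y"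
    using f unfolding iso_arrow_def by blast
  obtain g' where g': "g \<in> Hom C Y Z" "g' \<in> Hom C Z Y" "g' \<odot> g = Id C Y" "g \<odot> g' = Id C Z"
    using g unfolding iso_arrow_def by blast
  have h: "g \<odot> f \<in> Hom C X Z" "f' \<odot> g' \<in> Hom C Z X"
    using comp_in_hom[OF ob f'(1) g'(1)] comp_in_hom[OF ob(3,2,1) g'(2) f'(2)] by auto
  have "(f' \<odot> g') \<odot> (g \<odot> f) = f' \<odot> ((g' \<odot> g) \<odot> f)"
    using comp_assoc[OF ob(1,3,2,1) h(1) g'(2) f'(2)] comp_assoc[OF ob(1,2,3,2) f'(1) g'(1,2)] by simp
  then have "(f' \<odot> g') \<odot> (g \<odot> f) = Id C X"
    using g' f' id_left[OF ob(1,2) f'(1)] by simp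
  moreover have "(g \<odot> f) \<odot> (f' \<odot> g') = g \<odot> ((f \<odot> f') \<odot> g')"
    using comp_assoc[OF ob(3,1,2,3) h(2) f'(1) g'(1)] comp_assoc[OF ob(3,2,1,2) g'(2) f'(2,1)] by simp
  then have "(g \<odot> f) \<odot> (f' \<odot> g') = Id C Z"
    using g' f' id_left[OF ob(3,2) g'(2)] by simp
  ultimately show ?thesis
    using h unfolding iso_arrow_def by blast
qed

lemma (in category) isomorphic_trans:
  "X \<in> Ob C \<Longrightarrow> Y \<in> Ob C \<Longrightarrow> Z \<in> Ob C \<Longrightarrow> isomorphic_in C X Y \<Longrightarrow> isomorphic_in C Y Z \<Longrightarrow>
    isomorphic_in C X Z"
  unfolding isomorphic_in_def using iso_arrow_comp by blast

lemma iso_arrowE: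
  assumes "isomorphic_in C X Y"
  obtains e e' where "iso_arrow C X Y e" "e \<in> Hom C X Y" "e' \<in> Hom C Y X"
    "Comp C e' e = Id C X" "Comp C e e' = Id C Y"
  using assms unfolding isomorphic_in_def iso_arrow_def by blast

context preadditive_category
begin

lemma comp_inverse_right:
  assumes ob: "X \<in> Ob C" "Y \<in> Ob C" "Z \<in> Ob C" and e: "e \<in> Hom C X Y" "e' \<in> Hom C Y X" "e' \<odot> e = Id C X"
    and u: "u \<in> Hom C X Z"
  shows "(u \<odot> e') \<odot> e = u"
  using comp_assoc[OF ob(1,2,1,3) e(1,2) u] e id_right[OF ob(1,3) u] by simp

lemma comp_inverse_left:
  assumes ob: "X \<in> Ob C" "Y \<in> Ob C" "Z \<in> Ob C" and e: "e \<in> Hom C X Y" "e' \<in> Hom C Y X" "e' \<odot> e = Id C X"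
    and u: "u \<in> Hom C Z X"
  shows "e' \<odot> (e \<odot> u) = u"
  using comp_assoc[OF ob(3,1,2,1) u e(1,2)] e id_left[OF ob(3,1) u] by simp

lemma cokernel_precomp_iso:
  assumes ob: "A' \<in> Ob C" "A \<in> Ob C" "X \<in> Ob C" "B \<in> Ob C"
    and f: "f \<in> Hom C A X" and d: "d \<in> Hom C A' A" "d' \<in> Hom C A A'" "d \<odot> d' = Id C A"
    and c: "cokernel_arrow C A X B f g"
  shows "cokernel_arrow C A' X B (f \<odot> d) g"
proof -
  have eq: "u \<odot> (f \<odot> d) = Zero C A' W \<longleftrightarrow> u \<odot> f = Zero C A W"
    if W: "W \<in> Ob C" and u: "u \<in> Hom C X W" for u W
  proof -
    have uf: "u \<odot> f \<in> Hom C A W"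
      using comp_in_hom[OF ob(2,3) W f u] .
    have as: "u \<odot> (f \<odot> d) = (u \<odot> f) \<odot> d"
      using comp_assoc[OF ob(1,2,3) W d(1) f u] by simp
    have "((u \<odot> f) \<odot> d) \<odot> d' = u \<odot> f"
      using comp_inverse_right[OF ob(2,1) W d(2,1,3) uf] .
    then show ?thesis
      using as comp_zero_left[OF ob(2,1) W d(2)] comp_zero_left[OF ob(1,2) W d(1)] by metis
  qed
  have g: "g \<in> Hom C X B"
    using c by (simp add: cokernel_arrow_def)
  show ?thesis
    using c eq[OF _ g] eq ob unfolding cokernel_arrow_def by metis
qed

lemma cokernel_comp_iso:
  assumes ob: "A \<in> Ob C" "X \<in> Ob C" "B \<in> Ob C" "B' \<in> Ob C"
    and f: "f \<in> Hom C A X" and b: "b \<in> Hom C B B'" "b' \<in> Hom C B' B" "b' \<odot> b = Id C B" "b \<odot> b' = Id C B'"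
    and c: "cokernel_arrow C A X B f g"
  shows "cokernel_arrow C A X B' f (b \<odot> g)"
proof -
  have g: "g \<in> Hom C X B" "g \<odot> f = Zero C A B"
    and ex: "\<And>W u. W \<in> Ob C \<Longrightarrow> u \<in> Hom C X W \<Longrightarrow> u \<odot> f = Zero C A W \<Longrightarrow> \<exists>v \<in> Hom C B W. v \<odot> g = u"
    and epi: "\<And>W v. W \<in> Ob C \<Longrightarrow> v \<in> Hom C B W \<Longrightarrow> v \<odot> g = Zero C X W \<Longrightarrow> v = Zero C B W"
    using c unfolding cokernel_arrow_iff[OF ob(1-3) f] by blast+
  have bg: "b \<odot> g \<in> Hom C X B'"
    using comp_in_hom[OF ob(2,3,4) g(1) b(1)] .
  moreover have "(b \<odot> g) \<odot> f = Zero C A B'"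
    using comp_assoc[OF ob(1-4) f g(1) b(1)] g(2) comp_zero_right[OF ob(1,3,4) b(1)] by simp
  moreover have "\<exists>v \<in> Hom C B' W. v \<odot> (b \<odot> g) = u"
    if W: "W \<in> Ob C" and u: "u \<in> Hom C X W" "u \<odot> f = Zero C A W" for W u
  proof -
    obtain v where v: "v \<in> Hom C B W" "v \<odot> g = u"
      using ex[OF W u] by blast
    have vb: "v \<odot> b' \<in> Hom C B' W"
      using comp_in_hom[OF ob(4,3) W b(2) v(1)] .
    have "(v \<odot> b') \<odot> (b \<odot> g) = u"
      using comp_assoc[OF ob(2,3,4) W g(1) b(1) vb]
        comp_inverse_right[OF ob(3,4) W b(1,2,3) v(1)] v(2) by simp
    then show ?thesis
      using vb by blast
  qed
  moreover have "v = Zero C B' W"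
    if W: "W \<in> Ob C" and v: "v \<in> Hom C B' W" "v \<odot> (b \<odot> g) = Zero C X W" for W v
  proof -
    have vb: "v \<odot> b \<in> Hom C B W"
      using comp_in_hom[OF ob(3,4) W b(1) v(1)] .
    have "(v \<odot> b) \<odot> g = Zero C X W"
      using comp_assoc[OF ob(2,3,4) W g(1) b(1) v(1)] v(2) by simp
    then have "v \<odot> b = Zero C B W"
      by (rule epi[OF W vb])
    then show ?thesis
      using comp_inverse_right[OF ob(4,3) W b(2,1,4) v(1)] comp_zero_left[OF ob(4,3) W b(2)] by simp
  qed
  ultimately show ?thesis
    unfolding cokernel_arrow_iff[OF ob(1,2,4) f] by blast
qed

lemma cokernel_middle_iso:
  assumes ob: "A \<in> Ob C" "X \<in> Ob C" "X' \<in> Ob C" "B \<in> Ob C"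
    and f: "f \<in> Hom C A X" and e: "e \<in> Hom C X X'" "e' \<in> Hom C X' X" "e' \<odot> e = Id C X" "e \<odot> e' = Id C X'"
    and c: "cokernel_arrow C A X B f g"
  shows "cokernel_arrow C A X' B (e \<odot> f) (g \<odot> e')"
proof -
  have ef: "e \<odot> f \<in> Hom C A X'"
    using comp_in_hom[OF ob(1-3) f e(1)] .
  have g: "g \<in> Hom C X B" "g \<odot> f = Zero C A B"
    and ex: "\<And>W u. W \<in> Ob C \<Longrightarrow> u \<in> Hom C X W \<Longrightarrow> u \<odot> f = Zero C A W \<Longrightarrow> \<exists>v \<in> Hom C B W. v \<odot> g = u"
    and epi: "\<And>W v. W \<in> Ob C \<Longrightarrow> v \<in> Hom C B W \<Longrightarrow> v \<odot> g = Zero C X W \<Longrightarrow> v = Zero C B W"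
    using c unfolding cokernel_arrow_iff[OF ob(1,2,4) f] by blast+
  have ge: "g \<odot> e' \<in> Hom C X' B"
    using comp_in_hom[OF ob(3,2,4) e(2) g(1)] .
  moreover have "(g \<odot> e') \<odot> (e \<odot> f) = Zero C A B"
    using comp_assoc[OF ob f e(1) ge] comp_inverse_right[OF ob(2,3,4) e(1-3) g(1)] g(2) by simp
  moreover have "\<exists>v \<in> Hom C B W. v \<odot> (g \<odot> e') = u"
    if W: "W \<in> Ob C" and u: "u \<in> Hom C X' W" "u \<odot> (e \<odot> f) = Zero C A W" for W u
  proof -
    have ue: "u \<odot> e \<in> Hom C X W" "(u \<odot> e) \<odot> f = Zero C A W"
      using comp_in_hom[OF ob(2,3) W e(1) u(1)] comp_assoc[OF ob(1-3) W f e(1) u(1)] u(2) by auto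
    obtain v where v: "v \<in> Hom C B W" "v \<odot> g = u \<odot> e"
      using ex[OF W ue] by blast
    have "v \<odot> (g \<odot> e') = u"
      using comp_assoc[OF ob(3,2,4) W e(2) g(1) v(1)] v(2)
        comp_inverse_right[OF ob(3,2) W e(2,1,4) u(1)] by simp
    then show ?thesis
      using v by blast
  qed
  moreover have "v = Zero C B W"
    if W: "W \<in> Ob C" and v: "v \<in> Hom C B W" "v \<odot> (g \<odot> e') = Zero C X' W" for W v
  proof -
    have vg: "v \<odot> g \<in> Hom C X W"
      using comp_in_hom[OF ob(2,4) W g(1) v(1)] .
    have "(v \<odot> g) \<odot> e' = Zero C X' W"
      using comp_assoc[OF ob(3,2,4) W e(2) g(1) v(1)] v(2) by simp
    then have "v \<odot> g = Zero C X W"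
      using comp_inverse_right[OF ob(2,3) W e(1-3) vg] comp_zero_left[OF ob(2,3) W e(1)] by simp
    then show ?thesis
      by (rule epi[OF W v(1)])
  qed
  ultimately show ?thesis
    unfolding cokernel_arrow_iff[OF ob(1,3,4) ef] by blast
qed

end

section \<open>Torsion pairs under an equivalence\<close>

locale additive_equiv = C: preadditive_category C + E: preadditive_category E
  for C :: "('o, 'm, 'z) add_cat_scheme" and E :: "('p, 'n, 'y) add_cat_scheme" +
  fixes Fo :: "'o \<Rightarrow> 'p" and Fm :: "'m \<Rightarrow> 'n"
  assumes equivalence: "additive_equivalence C E Fo Fm"
begin

lemma is_additive: "additive_functor C E Fo Fm" and ff: "fully_faithful C E Fo Fm"
  using equivalence by (simp_all add: additive_equivalence_def)

lemmas Fo_ob = additive_functor_ob[OF is_additive]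
  and Fm_hom = additive_functor_hom[OF is_additive]
  and Fm_comp = additive_functor_comp[OF is_additive]
  and Fm_id = additive_functor_id[OF is_additive]
  and Fm_zero = additive_functor_zero[OF C.preadditive_category_axioms E.preadditive_category_axioms is_additive]

lemmas Fm_inj = fully_faithful_inj[OF ff] and Fm_surj = fully_faithful_surj[OF ff]

lemma ess_surj:
  assumes "Y \<in> Ob E"
  obtains X where "X \<in> Ob C" "isomorphic_in E (Fo X) Y"
  using assms equivalence unfolding additive_equivalence_def by blast

lemma Fm_eq_zero:
  assumes "X \<in> Ob C" "Y \<in> Ob C" "f \<in> Hom C X Y"
  shows "Fm f = Zero E (Fo X) (Fo Y) \<longleftrightarrow> f = Zero C X Y"
  using Fm_inj[OF assms(1,2,3) C.zero_hom[OF assms(1,2)]] Fm_zero[OF assms(1,2)] by auto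

lemma hom_zero_Fo:
  assumes ob: "X \<in> Ob C" "Y \<in> Ob C"
  shows "hom_zero E (Fo X) (Fo Y) \<longleftrightarrow> hom_zero C X Y"
  unfolding hom_zero_def
proof (intro iffI ballI)
  fix f assume z: "\<forall>f \<in> Hom E (Fo X) (Fo Y). f = Zero E (Fo X) (Fo Y)" and f: "f \<in> Hom C X Y"
  then show "f = Zero C X Y"
    using Fm_hom[OF ob f] Fm_eq_zero[OF ob f] by blast
next
  fix f' assume z: "\<forall>f \<in> Hom C X Y. f = Zero C X Y" and f': "f' \<in> Hom E (Fo X) (Fo Y)"
  obtain f where "f \<in> Hom C X Y" "Fm f = f'"
    using Fm_surj[OF ob f'] .
  then show "f' = Zero E (Fo X) (Fo Y)"
    using z Fm_zero[OF ob] by simp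
qed

lemma isomorphic_Fo:
  assumes ob: "X \<in> Ob C" "Y \<in> Ob C" and iso: "isomorphic_in C X Y"
  shows "isomorphic_in E (Fo X) (Fo Y)"
proof -
  obtain e e' where e: "e \<in> Hom C X Y" "e' \<in> Hom C Y X" "Comp C e' e = Id C X" "Comp C e e' = Id C Y"
    using iso_arrowE[OF iso] by metis
  then have "Comp E (Fm e') (Fm e) = Id E (Fo X)" "Comp E (Fm e) (Fm e') = Id E (Fo Y)"
    using Fm_comp[OF ob ob(1) e(1,2)] Fm_comp[OF ob(2,1,2) e(2,1)] Fm_id ob by auto
  then show ?thesis
    using Fm_hom[OF ob e(1)] Fm_hom[OF ob(2,1) e(2)] unfolding isomorphic_in_def iso_arrow_def by blast
qed

text \<open>Test arrows are moved along the fully faithful functor; a test object of E must first be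
  replaced by an isomorphic object in the image of \<open>Fo\<close>. The same device serves in
  \<open>cokernel_Fo\<close>.\<close>

lemma mono_Fo:
  assumes ob: "A \<in> Ob C" "X \<in> Ob C" and f: "f \<in> Hom C A X"
  shows "mono_arrow E (Fo A) (Fo X) (Fm f) \<longleftrightarrow> mono_arrow C A X f"
proof
  assume m: "mono_arrow E (Fo A) (Fo X) (Fm f)"
  show "mono_arrow C A X f"
    unfolding C.mono_arrow_iff[OF ob]
  proof (intro conjI ballI impI f)
    fix W u assume u: "W \<in> Ob C" "u \<in> Hom C W A" "Comp C f u = Zero C W X"
    then have "Comp E (Fm f) (Fm u) = Zero E (Fo W) (Fo X)"
      using Fm_comp[OF u(1) ob u(2) f] Fm_zero[OF u(1) ob(2)] by simp
    then have "Fm u = Zero E (Fo W) (Fo A)"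
      using m Fo_ob[OF u(1)] Fm_hom[OF u(1) ob(1) u(2)]
      unfolding E.mono_arrow_iff[OF Fo_ob[OF ob(1)] Fo_ob[OF ob(2)]] by blast
    then show "u = Zero C W A"
      using Fm_eq_zero[OF u(1) ob(1) u(2)] by blast
  qed
next
  assume m: "mono_arrow C A X f"
  have FO: "Fo A \<in> Ob E" "Fo X \<in> Ob E" and Ff: "Fm f \<in> Hom E (Fo A) (Fo X)"
    using ob Fo_ob Fm_hom[OF ob f] by auto
  show "mono_arrow E (Fo A) (Fo X) (Fm f)"
    unfolding E.mono_arrow_iff[OF FO]
  proof (intro conjI ballI impI Ff)
    fix W' u' assume W': "W' \<in> Ob E" and u': "u' \<in> Hom E W' (Fo A)" "Comp E (Fm f) u' = Zero E W' (Fo X)"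
    obtain W where W: "W \<in> Ob C" "isomorphic_in E (Fo W) W'"
      using ess_surj[OF W'] .
    obtain e e' where e: "e \<in> Hom E (Fo W) W'" "e' \<in> Hom E W' (Fo W)" "Comp E e e' = Id E W'"
      using iso_arrowE[OF W(2)] by metis
    have FW: "Fo W \<in> Ob E"
      using Fo_ob[OF W(1)] .
    have "Comp E u' e \<in> Hom E (Fo W) (Fo A)"
      using E.comp_in_hom[OF FW W' FO(1) e(1) u'(1)] .
    then obtain u where u: "u \<in> Hom C W A" "Fm u = Comp E u' e"
      using Fm_surj[OF W(1) ob(1)] by blast
    have "Fm (Comp C f u) = Zero E (Fo W) (Fo X)"
      using Fm_comp[OF W(1) ob u(1) f] u(2) E.comp_assoc[OF FW W' FO e(1) u'(1) Ff] u'(2)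
        E.comp_zero_left[OF FW W' FO(2) e(1)] by simp
    then have "Comp C f u = Zero C W X"
      using Fm_eq_zero[OF W(1) ob(2) C.comp_in_hom[OF W(1) ob u(1) f]] by blast
    then have "u = Zero C W A"
      using m W(1) u(1) unfolding C.mono_arrow_iff[OF ob] by blast
    then have "Comp E u' e = Zero E (Fo W) (Fo A)"
      using u Fm_zero[OF W(1) ob(1)] by simp
    then show "u' = Zero E W' (Fo A)"
      using E.comp_inverse_right[OF W' FW FO(1) e(2,1,3) u'(1)]
        E.comp_zero_left[OF W' FW FO(1) e(2)] by simp
  qed
qed

lemma cokernel_Fo:
  assumes ob: "A \<in> Ob C" "X \<in> Ob C" "B \<in> Ob C" and f: "f \<in> Hom C A X" and g: "g \<in> Hom C X B"
  shows "cokernel_arrow E (Fo A) (Fo X) (Fo B) (Fm f) (Fm g) \<longleftrightarrow> cokernel_arrow C A X B f g"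
proof
  note FO = Fo_ob[OF ob(1)] Fo_ob[OF ob(2)] Fo_ob[OF ob(3)]
  note Ff = Fm_hom[OF ob(1,2) f] and Fg = Fm_hom[OF ob(2,3) g]
  have gf: "Comp E (Fm g) (Fm f) = Zero E (Fo A) (Fo B) \<longleftrightarrow> Comp C g f = Zero C A B"
    using Fm_comp[OF ob f g] Fm_eq_zero[OF ob(1,3) C.comp_in_hom[OF ob f g]] by simp
  show "cokernel_arrow C A X B f g"
    if c: "cokernel_arrow E (Fo A) (Fo X) (Fo B) (Fm f) (Fm g)"
  proof -
    note c' = c[unfolded E.cokernel_arrow_iff[OF FO Ff]]
    have "\<exists>v \<in> Hom C B W. Comp C v g = u"
      if W: "W \<in> Ob C" and u: "u \<in> Hom C X W" "Comp C u f = Zero C A W" for W u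
    proof -
      have "Comp E (Fm u) (Fm f) = Zero E (Fo A) (Fo W)"
        using Fm_comp[OF ob(1,2) W f u(1)] u(2) Fm_zero[OF ob(1) W] by simp
      then obtain v' where v': "v' \<in> Hom E (Fo B) (Fo W)" "Comp E v' (Fm g) = Fm u"
        using c' Fo_ob[OF W] Fm_hom[OF ob(2) W u(1)] by blast
      obtain v where v: "v \<in> Hom C B W" "Fm v = v'"
        using Fm_surj[OF ob(3) W v'(1)] .
      have "Comp C v g = u"
        using Fm_inj[OF ob(2) W C.comp_in_hom[OF ob(2,3) W g v(1)] u(1)]
          Fm_comp[OF ob(2,3) W g v(1)] v v' by simp
      then show ?thesis
        using v by blast
    qed
    moreover have "v = Zero C B W"
      if W: "W \<in> Ob C" and v: "v \<in> Hom C B W" "Comp C v g = Zero C X W" for W v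
    proof -
      have "Comp E (Fm v) (Fm g) = Zero E (Fo X) (Fo W)"
        using Fm_comp[OF ob(2,3) W g v(1)] v(2) Fm_zero[OF ob(2) W] by simp
      then have "Fm v = Zero E (Fo B) (Fo W)"
        using c' Fo_ob[OF W] Fm_hom[OF ob(3) W v(1)] by blast
      then show ?thesis
        using Fm_eq_zero[OF ob(3) W v(1)] by blast
    qed
    ultimately show ?thesis
      using g gf c' unfolding C.cokernel_arrow_iff[OF ob f] by blast
  qed
  show "cokernel_arrow E (Fo A) (Fo X) (Fo B) (Fm f) (Fm g)"
    if c: "cokernel_arrow C A X B f g"
  proof -
    note c' = c[unfolded C.cokernel_arrow_iff[OF ob f]]
    have ess: "\<exists>W e e'. W \<in> Ob C \<and> e \<in> Hom E (Fo W) W' \<and> e' \<in> Hom E W' (Fo W) \<and>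
        Comp E e' e = Id E (Fo W) \<and> Comp E e e' = Id E W'" if "W' \<in> Ob E" for W'
      using ess_surj[OF that] iso_arrowE by metis
    have "\<exists>v \<in> Hom E (Fo B) W'. Comp E v (Fm g) = u'"
      if W': "W' \<in> Ob E" and u': "u' \<in> Hom E (Fo X) W'" "Comp E u' (Fm f) = Zero E (Fo A) W'" for W' u'
    proof -
      obtain W e e' where W: "W \<in> Ob C" and e: "e \<in> Hom E (Fo W) W'" "e' \<in> Hom E W' (Fo W)"
        "Comp E e e' = Id E W'"
        using ess[OF W'] by blast
      have FW: "Fo W \<in> Ob E"
        using Fo_ob[OF W] .
      have eu: "Comp E e' u' \<in> Hom E (Fo X) (Fo W)"
        using E.comp_in_hom[OF FO(2) W' FW u'(1) e(2)] .
      then obtain u where u: "u \<in> Hom C X W" "Fm u = Comp E e' u'"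
        using Fm_surj[OF ob(2) W] by blast
      have "Fm (Comp C u f) = Zero E (Fo A) (Fo W)"
        using Fm_comp[OF ob(1,2) W f u(1)] u(2) E.comp_assoc[OF FO(1,2) W' FW Ff u'(1) e(2)] u'(2)
          E.comp_zero_right[OF FO(1) W' FW e(2)] by simp
      then have "Comp C u f = Zero C A W"
        using Fm_eq_zero[OF ob(1) W C.comp_in_hom[OF ob(1,2) W f u(1)]] by blast
      then obtain v where v: "v \<in> Hom C B W" "Comp C v g = u"
        using c' W u(1) by blast
      note Fv = Fm_hom[OF ob(3) W v(1)]
      have "Comp E (Comp E e (Fm v)) (Fm g) = Comp E e (Comp E e' u')"
        using E.comp_assoc[OF FO(2,3) FW W' Fg Fv e(1)] Fm_comp[OF ob(2,3) W g v(1)] v(2) u(2) by simp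
      also have "\<dots> = u'"
        using E.comp_inverse_left[OF W' FW FO(2) e(2,1,3) u'(1)] .
      finally show ?thesis
        using E.comp_in_hom[OF FO(3) FW W' Fv e(1)] by blast
    qed
    moreover have "v' = Zero E (Fo B) W'"
      if W': "W' \<in> Ob E" and v': "v' \<in> Hom E (Fo B) W'" "Comp E v' (Fm g) = Zero E (Fo X) W'" for W' v'
    proof -
      obtain W e e' where W: "W \<in> Ob C" and e: "e \<in> Hom E (Fo W) W'" "e' \<in> Hom E W' (Fo W)"
        "Comp E e e' = Id E W'"
        using ess[OF W'] by blast
      have FW: "Fo W \<in> Ob E"
        using Fo_ob[OF W] .
      have "Comp E e' v' \<in> Hom E (Fo B) (Fo W)"
        using E.comp_in_hom[OF FO(3) W' FW v'(1) e(2)] .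
      then obtain v where v: "v \<in> Hom C B W" "Fm v = Comp E e' v'"
        using Fm_surj[OF ob(3) W] by blast
      have "Fm (Comp C v g) = Zero E (Fo X) (Fo W)"
        using Fm_comp[OF ob(2,3) W g v(1)] v(2) E.comp_assoc[OF FO(2,3) W' FW Fg v'(1) e(2)] v'(2)
          E.comp_zero_right[OF FO(2) W' FW e(2)] by simp
      then have "Comp C v g = Zero C X W"
        using Fm_eq_zero[OF ob(2) W C.comp_in_hom[OF ob(2,3) W g v(1)]] by blast
      then have "v = Zero C B W"
        using c' W v(1) by blast
      then have "Comp E e' v' = Zero E (Fo B) (Fo W)"
        using v(2) Fm_zero[OF ob(3) W] by simp
      then show ?thesis
        using E.comp_inverse_left[OF W' FW FO(3) e(2,1,3) v'(1)] E.comp_zero_right[OF FO(3) FW W' e(1)]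
        by simp
    qed
    ultimately show ?thesis
      using Fg gf c' unfolding E.cokernel_arrow_iff[OF FO Ff] by blast
  qed
qed

text \<open>The middle term \<open>Fo X\<close> is already an image; only the outer terms of its
  torsion sequence are replaced by isomorphic images, after which the whole sequence lifts to
  C.\<close>

lemma torsion_pair_preimage:
  assumes tp: "torsion_pair_in E T F"
  defines "T0 \<equiv> {X \<in> Ob C. Fo X \<in> T}" and "F0 \<equiv> {X \<in> Ob C. Fo X \<in> F}"
  shows "torsion_pair_in C T0 F0"
proof -
  have fullTF: "strictly_full E T" "strictly_full E F"
    using tp by (auto simp: torsion_pair_in_def)
  have full: "strictly_full C {X \<in> Ob C. Fo X \<in> S}" if S: "strictly_full E S" for S
    unfolding strictly_full_def
  proof (intro conjI ballI impI)
    fix X Y assume X: "X \<in> {X \<in> Ob C. Fo X \<in> S}" and Y: "Y \<in> Ob C" "isomorphic_in C X Y"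
    then have "isomorphic_in E (Fo X) (Fo Y)" "Fo Y \<in> Ob E"
      using isomorphic_Fo[of X Y] Fo_ob[of Y] by simp_all
    then show "Y \<in> {X \<in> Ob C. Fo X \<in> S}"
      using X Y S by (auto simp: strictly_full_def)
  qed blast
  have hz: "hom_zero C X Y" if "X \<in> T0" "Y \<in> F0" for X Y
  proof -
    have "X \<in> Ob C" "Y \<in> Ob C" "hom_zero E (Fo X) (Fo Y)"
      using tp that by (auto simp: torsion_pair_in_def T0_def F0_def)
    then show ?thesis
      using hom_zero_Fo by blast
  qed
  have seq: "\<exists>A \<in> T0. \<exists>B \<in> F0. \<exists>f g. mono_arrow C A X f \<and> cokernel_arrow C A X B f g"
    if X: "X \<in> Ob C" for X
  proof -
    have FX: "Fo X \<in> Ob E"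
      using Fo_ob[OF X] .
    then obtain A' B' f' g' where A': "A' \<in> T" and B': "B' \<in> F"
      and m: "mono_arrow E A' (Fo X) f'" and c: "cokernel_arrow E A' (Fo X) B' f' g'"
      using tp unfolding torsion_pair_in_def by blast
    have ob': "A' \<in> Ob E" "B' \<in> Ob E"
      using A' B' fullTF by (auto simp: strictly_full_def)
    have f': "f' \<in> Hom E A' (Fo X)"
      using m by (simp add: mono_arrow_def)
    obtain A where A: "A \<in> Ob C" "isomorphic_in E (Fo A) A'"
      using ess_surj[OF ob'(1)] .
    obtain B where B: "B \<in> Ob C" "isomorphic_in E (Fo B) B'"
      using ess_surj[OF ob'(2)] .
    have FA: "Fo A \<in> Ob E" and FB: "Fo B \<in> Ob E"
      using Fo_ob A B by auto
    have AT: "A \<in> T0"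
      using A A' fullTF(1) FA isomorphic_sym[OF A(2)] by (auto simp: strictly_full_def T0_def)
    have BF: "B \<in> F0"
      using B B' fullTF(2) FB isomorphic_sym[OF B(2)] by (auto simp: strictly_full_def F0_def)
    obtain d d' where d: "iso_arrow E (Fo A) A' d" "d \<in> Hom E (Fo A) A'" "d' \<in> Hom E A' (Fo A)"
      "Comp E d d' = Id E A'"
      using iso_arrowE[OF A(2)] by metis
    obtain b b' where b: "b \<in> Hom E (Fo B) B'" "b' \<in> Hom E B' (Fo B)" "Comp E b' b = Id E (Fo B)"
      "Comp E b b' = Id E B'"
      using iso_arrowE[OF B(2)] by metis
    have f'd: "Comp E f' d \<in> Hom E (Fo A) (Fo X)"
      using E.comp_in_hom[OF FA ob'(1) FX d(2) f'] .
    have c2: "cokernel_arrow E (Fo A) (Fo X) (Fo B) (Comp E f' d) (Comp E b' g')"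
      using E.cokernel_comp_iso[OF FA FX ob'(2) FB f'd b(2,1,4,3)
          E.cokernel_precomp_iso[OF FA ob'(1) FX ob'(2) f' d(2,3,4) c]] .
    then have b'g': "Comp E b' g' \<in> Hom E (Fo X) (Fo B)"
      by (simp add: cokernel_arrow_def)
    have m2: "mono_arrow E (Fo A) (Fo X) (Comp E f' d)"
      using E.mono_arrow_comp[OF FA ob'(1) FX E.iso_mono[OF FA ob'(1) d(1)] m] .
    obtain f where f: "f \<in> Hom C A X" "Fm f = Comp E f' d"
      using Fm_surj[OF A(1) X f'd] .
    obtain g where g: "g \<in> Hom C X B" "Fm g = Comp E b' g'"
      using Fm_surj[OF X B(1) b'g'] .
    have "mono_arrow C A X f" "cokernel_arrow C A X B f g"
      using mono_Fo[OF A(1) X f(1)] cokernel_Fo[OF A(1) X B(1) f(1) g(1)] m2 c2 f(2) g(2) by auto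
    then show ?thesis
      using AT BF by blast
  qed
  show ?thesis
    unfolding torsion_pair_in_def T0_def F0_def
    using full fullTF hz seq unfolding T0_def F0_def by blast
qed

text \<open>Torsion classes must be closed under isomorphism, so the images are saturated. The outer
  terms are then images, and only the middle term is moved.\<close>

lemma torsion_pair_image:
  assumes tp: "torsion_pair_in C T F"
  defines "T1 \<equiv> {Y \<in> Ob E. \<exists>X \<in> T. isomorphic_in E (Fo X) Y}"
    and "F1 \<equiv> {Y \<in> Ob E. \<exists>X \<in> F. isomorphic_in E (Fo X) Y}"
  shows "torsion_pair_in E T1 F1"
proof -
  have TF: "T \<subseteq> Ob C" "F \<subseteq> Ob C"
    using tp by (auto simp: torsion_pair_in_def strictly_full_def)
  have full: "strictly_full E {Y \<in> Ob E. \<exists>X \<in> S. isomorphic_in E (Fo X) Y}" if S: "S \<subseteq> Ob C" for S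
    unfolding strictly_full_def
  proof (intro conjI ballI impI)
    fix Y Z assume Y: "Y \<in> {Y \<in> Ob E. \<exists>X \<in> S. isomorphic_in E (Fo X) Y}"
      and Z: "Z \<in> Ob E" "isomorphic_in E Y Z"
    then obtain X where X: "X \<in> S" "isomorphic_in E (Fo X) Y" "Y \<in> Ob E"
      by blast
    then have "isomorphic_in E (Fo X) Z"
      using E.isomorphic_trans[OF Fo_ob _ Z(1) _ Z(2)] S by blast
    then show "Z \<in> {Y \<in> Ob E. \<exists>X \<in> S. isomorphic_in E (Fo X) Y}"
      using X Z by blast
  qed blast
  have hz: "hom_zero E Y Z" if "Y \<in> T1" "Z \<in> F1" for Y Z
  proof -
    obtain X where X: "X \<in> T" "isomorphic_in E (Fo X) Y" "Y \<in> Ob E"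
      using \<open>Y \<in> T1\<close> by (auto simp: T1_def)
    obtain W where W: "W \<in> F" "isomorphic_in E (Fo W) Z" "Z \<in> Ob E"
      using \<open>Z \<in> F1\<close> by (auto simp: F1_def)
    have ob: "X \<in> Ob C" "W \<in> Ob C"
      using X W TF by auto
    have "hom_zero C X W"
      using tp X W by (auto simp: torsion_pair_in_def)
    then have "hom_zero E (Fo X) (Fo W)"
      using hom_zero_Fo ob by blast
    then show ?thesis
      using E.hom_zero_iso[OF Fo_ob[OF ob(1)] X(3) Fo_ob[OF ob(2)] W(3) X(2) W(2)] by blast
  qed
  have seq: "\<exists>A \<in> T1. \<exists>B \<in> F1. \<exists>f g. mono_arrow E A Y f \<and> cokernel_arrow E A Y B f g"
    if Y: "Y \<in> Ob E" for Y
  proof -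
    obtain X where X: "X \<in> Ob C" "isomorphic_in E (Fo X) Y"
      using ess_surj[OF Y] .
    obtain A B f g where AB: "A \<in> T" "B \<in> F" and m: "mono_arrow C A X f"
      and c: "cokernel_arrow C A X B f g"
      using tp X unfolding torsion_pair_in_def by blast
    have ob: "A \<in> Ob C" "B \<in> Ob C"
      using AB TF by auto
    have fg: "f \<in> Hom C A X" "g \<in> Hom C X B"
      using m c by (auto simp: mono_arrow_def cokernel_arrow_def)
    note FO = Fo_ob[OF ob(1)] Fo_ob[OF X(1)] Fo_ob[OF ob(2)]
    obtain e e' where e: "iso_arrow E (Fo X) Y e" "e \<in> Hom E (Fo X) Y" "e' \<in> Hom E Y (Fo X)"
      "Comp E e' e = Id E (Fo X)" "Comp E e e' = Id E Y"
      using iso_arrowE[OF X(2)] by metis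
    have m': "mono_arrow E (Fo A) (Fo X) (Fm f)"
      using mono_Fo[OF ob(1) X(1) fg(1)] m by blast
    have c': "cokernel_arrow E (Fo A) (Fo X) (Fo B) (Fm f) (Fm g)"
      using cokernel_Fo[OF ob(1) X(1) ob(2) fg] c by blast
    have "mono_arrow E (Fo A) Y (Comp E e (Fm f))"
      using E.mono_arrow_comp[OF FO(1,2) Y m' E.iso_mono[OF FO(2) Y e(1)]] .
    moreover have "cokernel_arrow E (Fo A) Y (Fo B) (Comp E e (Fm f)) (Comp E (Fm g) e')"
      using E.cokernel_middle_iso[OF FO(1,2) Y FO(3) Fm_hom[OF ob(1) X(1) fg(1)] e(2-5) c'] .
    moreover have "Fo A \<in> T1" "Fo B \<in> F1"
      using FO AB E.isomorphic_refl by (auto simp: T1_def F1_def)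
    ultimately show ?thesis
      by blast
  qed
  show ?thesis
    unfolding torsion_pair_in_def T1_def F1_def
    using full TF hz seq unfolding T1_def F1_def by blast
qed

end

text \<open>The tilt of a torsion pair \<open>(T, F)\<close> is \<open>F[1] * T\<close>, so its effective cone is generated by the classes
  of \<open>T\<close> and the negatives of those of \<open>F\<close>.\<close>

definition torsion_cone :: "('o \<Rightarrow> 'l::ab_group_add) \<Rightarrow> 'o set \<Rightarrow> 'o set \<Rightarrow> 'l set" where
  "torsion_cone w T F = integral_cone hull (w ` T \<union> uminus ` w ` F)"

text \<open>Built from the additive category and the class function alone, with no triangles; this
  is what makes the cofan independent of D.\<close>

definition torsion_cones :: "('o, 'm, 'z) add_cat_scheme \<Rightarrow> ('o \<Rightarrow> 'l::ab_group_add) \<Rightarrow> 'l set set" where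
  "torsion_cones C w = {torsion_cone w T F | T F. torsion_pair_in C T F}"

text \<open>Taking preimages or saturated images of torsion classes does not change the set of
  values, because w' is constant on isomorphism classes.\<close>

lemma (in additive_equiv) torsion_cones_eq:
  assumes w: "\<And>X. X \<in> Ob C \<Longrightarrow> w' (Fo X) = w X"
    and iso: "\<And>Y Z. Y \<in> Ob E \<Longrightarrow> Z \<in> Ob E \<Longrightarrow> isomorphic_in E Y Z \<Longrightarrow> w' Y = w' Z"
  shows "torsion_cones E w' = torsion_cones C w"
proof
  show "torsion_cones E w' \<subseteq> torsion_cones C w"
  proof
    fix s assume "s \<in> torsion_cones E w'"
    then obtain T F where tp: "torsion_pair_in E T F" and s: "s = torsion_cone w' T F"
      by (auto simp: torsion_cones_def)
    have im: "w' ` S = w ` {X \<in> Ob C. Fo X \<in> S}" if S: "strictly_full E S" for S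
    proof
      show "w ` {X \<in> Ob C. Fo X \<in> S} \<subseteq> w' ` S"
        using w by force
      show "w' ` S \<subseteq> w ` {X \<in> Ob C. Fo X \<in> S}"
      proof
        fix x assume "x \<in> w' ` S"
        then obtain Y where Y: "Y \<in> S" "x = w' Y"
          by blast
        then have YO: "Y \<in> Ob E"
          using S by (auto simp: strictly_full_def)
        obtain X where X: "X \<in> Ob C" "isomorphic_in E (Fo X) Y"
          using ess_surj[OF YO] .
        then have "Fo X \<in> S" "w X = x"
          using S Y YO Fo_ob[OF X(1)] isomorphic_sym[OF X(2)] iso[OF _ YO X(2)] w[OF X(1)]
          by (auto simp: strictly_full_def)
        then show "x \<in> w ` {X \<in> Ob C. Fo X \<in> S}"
          using X by blast
      qed
    qed
    have "w' ` T = w ` {X \<in> Ob C. Fo X \<in> T}" "w' ` F = w ` {X \<in> Ob C. Fo X \<in> F}"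
      using tp im by (auto simp: torsion_pair_in_def)
    then have "s = torsion_cone w {X \<in> Ob C. Fo X \<in> T} {X \<in> Ob C. Fo X \<in> F}"
      unfolding s torsion_cone_def by simp
    then show "s \<in> torsion_cones C w"
      using torsion_pair_preimage[OF tp] unfolding torsion_cones_def by blast
  qed
  show "torsion_cones C w \<subseteq> torsion_cones E w'"
  proof
    fix s assume "s \<in> torsion_cones C w"
    then obtain T F where tp: "torsion_pair_in C T F" and s: "s = torsion_cone w T F"
      by (auto simp: torsion_cones_def)
    have im: "w ` S = w' ` {Y \<in> Ob E. \<exists>X \<in> S. isomorphic_in E (Fo X) Y}" if S: "S \<subseteq> Ob C" for S
    proof
      show "w ` S \<subseteq> w' ` {Y \<in> Ob E. \<exists>X \<in> S. isomorphic_in E (Fo X) Y}"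
      proof clarify
        fix X assume X: "X \<in> S"
        then have "X \<in> Ob C" "Fo X \<in> Ob E"
          using S Fo_ob by auto
        then show "w X \<in> w' ` {Y \<in> Ob E. \<exists>X \<in> S. isomorphic_in E (Fo X) Y}"
          using w[of X] X E.isomorphic_refl[of "Fo X"]
          by (intro image_eqI[of _ _ "Fo X"]) auto
      qed
      show "w' ` {Y \<in> Ob E. \<exists>X \<in> S. isomorphic_in E (Fo X) Y} \<subseteq> w ` S"
      proof clarify
        fix Y X assume *: "Y \<in> Ob E" "X \<in> S" "isomorphic_in E (Fo X) Y"
        then have "X \<in> Ob C"
          using S by blast
        then have "w' Y = w X"
          using w[of X] iso[OF Fo_ob _ *(3), of] * by simp
        then show "w' Y \<in> w ` S"
          using * by blast
      qed
    qed
    have "T \<subseteq> Ob C" "F \<subseteq> Ob C"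
      using tp by (auto simp: torsion_pair_in_def strictly_full_def)
    then have im': "w ` T = w' ` {Y \<in> Ob E. \<exists>X \<in> T. isomorphic_in E (Fo X) Y}"
      "w ` F = w' ` {Y \<in> Ob E. \<exists>X \<in> F. isomorphic_in E (Fo X) Y}"
      using im by auto
    have "s = torsion_cone w' {Y \<in> Ob E. \<exists>X \<in> T. isomorphic_in E (Fo X) Y}
        {Y \<in> Ob E. \<exists>X \<in> F. isomorphic_in E (Fo X) Y}"
      unfolding s torsion_cone_def im' ..
    then show "s \<in> torsion_cones E w'"
      using torsion_pair_image[OF tp] unfolding torsion_cones_def by blast
  qed
qed

section \<open>The cofan of a heart\<close>

text \<open>A sum of generators lies in a face only if every summand does. Consequently the
  effective cone of a face subcategory is the face that defines it.\<close>

lemma face_generated: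
  fixes w :: "'o \<Rightarrow> 'l::ab_group_add"
  assumes t: "cone_face t (integral_cone hull (w ` K))"
  shows "integral_cone hull (w ` {X \<in> K. w X \<in> t}) = t"
proof (rule equalityI)
  have ct: "integral_cone t"
    using cone_face_integral_cone[OF t integral_cone_hull] .
  show "integral_cone hull (w ` {X \<in> K. w X \<in> t}) \<subseteq> t"
    by (rule integral_cone_hull_minimal[OF ct]) blast
  let ?E = "integral_cone hull (w ` K)" and ?S = "integral_cone hull (w ` {X \<in> K. w X \<in> t})"
  have face: "\<And>x y. x \<in> ?E \<Longrightarrow> y \<in> ?E \<Longrightarrow> x + y \<in> t \<Longrightarrow> x \<in> t \<and> y \<in> t"
    using t unfolding cone_face_def by blast
  \<comment> \<open>Induction over the cone: the set on the right is a cone containing the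
    generators, by the face property.\<close>
  have "?E \<subseteq> {x \<in> ?E. x \<in> t \<longrightarrow> x \<in> ?S}"
  proof (rule integral_cone_hull_minimal)
    show "integral_cone {x \<in> ?E. x \<in> t \<longrightarrow> x \<in> ?S}"
    proof (rule integral_coneI)
      show "0 \<in> {x \<in> ?E. x \<in> t \<longrightarrow> x \<in> ?S}"
        using integral_cone_zero[OF integral_cone_hull] by blast
      fix x y assume x: "x \<in> {x \<in> ?E. x \<in> t \<longrightarrow> x \<in> ?S}" and y: "y \<in> {x \<in> ?E. x \<in> t \<longrightarrow> x \<in> ?S}"
      then have "x + y \<in> ?E"
        using integral_cone_add[OF integral_cone_hull] by blast
      moreover have "x + y \<in> ?S" if "x + y \<in> t"
        using face[OF _ _ that] x y integral_cone_add[OF integral_cone_hull] by blast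
      ultimately show "x + y \<in> {x \<in> ?E. x \<in> t \<longrightarrow> x \<in> ?S}"
        by blast
    qed
    show "w ` K \<subseteq> {x \<in> ?E. x \<in> t \<longrightarrow> x \<in> ?S}"
      using hull_subset[of "w ` K" integral_cone]
        hull_subset[of "w ` {X \<in> K. w X \<in> t}" integral_cone] by blast
  qed
  then show "t \<subseteq> ?S"
    using t unfolding cone_face_def by blast
qed

context triangle_additive
begin

text \<open>Objects of F[1] * T have class - w f + w t; conversely T and F[1] lie in the tilt as
  extensions with a zero object.\<close>

lemma cone_tilt:
  assumes tp: "tors_pair D Heart T F"
  shows "integral_cone hull (w ` tilt D T F) = torsion_cone w T F"
proof
  have TF: "T \<subseteq> Ob D" "F \<subseteq> Ob D"
    using tp heart_ob unfolding tors_pair_def by blast+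
  let ?t = "torsion_cone w T F"
  have ct: "integral_cone ?t"
    unfolding torsion_cone_def by (rule integral_cone_hull)
  have gen: "w ` T \<union> uminus ` w ` F \<subseteq> ?t"
    unfolding torsion_cone_def by (rule hull_subset)
  show "integral_cone hull (w ` tilt D T F) \<subseteq> ?t"
  proof (rule integral_cone_hull_minimal[OF ct])
    show "w ` tilt D T F \<subseteq> ?t"
    proof clarify
      fix X assume "X \<in> tilt D T F"
      then obtain f t where ft: "f \<in> F" "t \<in> T" "ext (sh 1 f) X t"
        by (auto simp: tilt_def)
      have "w X = - w f + w t"
        using w_ext[OF ft(3)] w_sh[of f] TF ft by auto
      moreover have "- w f \<in> ?t" "w t \<in> ?t"
        using gen ft by blast+
      ultimately show "w X \<in> ?t"
        using integral_cone_add[OF ct] by metis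
    qed
  qed
  obtain N where N: "zero_object D N"
    using has_zero_object by blast
  have NTF: "N \<in> T" "N \<in> F"
    using tors_pair_zero[OF tp N] by auto
  have "X \<in> tilt D T F" if "X \<in> T" for X
    using ext_id_left[OF _ zero_object_sh[OF N], of X] that TF NTF unfolding tilt_def by blast
  moreover have "sh 1 X \<in> tilt D T F" if "X \<in> F" for X
    using ext_id_right[OF sh_ob N, of X 1] that TF NTF unfolding tilt_def by blast
  moreover have "- w X = w (sh 1 X)" if "X \<in> F" for X
    using w_sh TF that by auto
  ultimately have "w ` T \<union> uminus ` w ` F \<subseteq> w ` tilt D T F"
    by auto
  then show "?t \<subseteq> integral_cone hull (w ` tilt D T F)"
    unfolding torsion_cone_def by (rule hull_mono)
qed

text \<open>Decomposing the generators of \<open>E(K')\<close> along \<open>(T, F)\<close> gives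
  \<open>E(K) + E(K') = E(K) - (E(T \<inter> F') - E(F \<inter> T'))\<close>.\<close>

lemma torsion_cone_sum:
  assumes tp: "tors_pair D Heart T F" and tp': "tors_pair D Heart T' F'"
  shows "torsion_cone w T F + torsion_cone w T' F' \<in> cofaces (torsion_cone w T F)"
proof -
  let ?s = "torsion_cone w T F" and ?s' = "torsion_cone w T' F'"
  have cs: "integral_cone ?s" "integral_cone ?s'"
    unfolding torsion_cone_def by (rule integral_cone_hull)+
  have gT: "w X \<in> ?s" if "X \<in> T" for X
    using that unfolding torsion_cone_def by (intro hull_inc) blast
  have gF: "- w X \<in> ?s" if "X \<in> F" for X
    using that unfolding torsion_cone_def by (intro hull_inc) blast
  have gT': "w X \<in> ?s'" if "X \<in> T'" for X
    using that unfolding torsion_cone_def by (intro hull_inc) blast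
  have gF': "- w X \<in> ?s'" if "X \<in> F'" for X
    using that unfolding torsion_cone_def by (intro hull_inc) blast
  have z: "0 \<in> ?s" "0 \<in> ?s'"
    using cs by (auto simp: integral_cone_def)
  define M where "M = ?s + ?s'"
  have cM: "integral_cone M"
    unfolding M_def by (rule integral_cone_sum[OF cs])
  have sM: "?s \<subseteq> M" "?s' \<subseteq> M"
    using set_zero_plus2[OF z(1), of ?s'] set_zero_plus2[OF z(2), of ?s]
    by (simp_all add: M_def add.commute)
  \<comment> \<open>The elements satisfying the coface condition of \<open>cofaces_iff\<close>. They
    form a cone, so only the generators of ?s' need checking.\<close>
  define G where "G = {x. \<exists>a \<in> ?s. \<exists>b \<in> ?s. x = a - b \<and> - b \<in> M}"
  have cG: "integral_cone G"
  proof (rule integral_coneI)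
    show "0 \<in> G"
      using z sM unfolding G_def by force
    fix x y assume "x \<in> G" "y \<in> G"
    then obtain a b c d where *: "a \<in> ?s" "b \<in> ?s" "x = a - b" "- b \<in> M"
      "c \<in> ?s" "d \<in> ?s" "y = c - d" "- d \<in> M"
      unfolding G_def by blast
    have "x + y = (a + c) - (b + d)" "- (b + d) = - b + - d"
      using * by simp_all
    moreover have "a + c \<in> ?s" "b + d \<in> ?s" "- b + - d \<in> M"
      using * integral_cone_add[OF cs(1)] integral_cone_add[OF cM] by blast+
    ultimately show "x + y \<in> G"
      unfolding G_def by (metis (mono_tags, lifting) mem_Collect_eq)
  qed
  have TH: "T \<subseteq> Heart" "F \<subseteq> Heart" "T' \<subseteq> Heart" "F' \<subseteq> Heart"
    and seq: "\<And>X. X \<in> Heart \<Longrightarrow> \<exists>A \<in> T. \<exists>B \<in> F. ext A X B"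
    and hz': "\<And>X Y. X \<in> T' \<Longrightarrow> Y \<in> F' \<Longrightarrow> hz X Y"
    using tp tp' unfolding tors_pair_def by blast+
  have T'G: "w X \<in> G" if X: "X \<in> T'" for X
  proof -
    obtain A B where AB: "A \<in> T" "B \<in> F" "ext A X B"
      using seq[of X] X TH by blast
    have H: "A \<in> Heart" "B \<in> Heart"
      using AB TH by blast+
    \<comment> \<open>B is a quotient of X in T', hence lies in T'. So w B is in M, and w X = w A -
      (- w B) is an admissible difference.\<close>
    have "hz B Y" if Y: "Y \<in> F'" for Y
    proof -
      have "Y \<in> Heart"
        using Y TH by blast
      then show ?thesis
        using ext_hz_from[OF ext_rot[OF AB(3)] heart_ob[OF \<open>Y \<in> Heart\<close>] hz'[OF X Y] heart_hz_1(1)[OF H(1)]]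
        by blast
    qed
    then have "B \<in> T'"
      using tors_pair_T_iff[OF tp'] H by blast
    then have "w B \<in> M"
      using gT' sM by blast
    moreover have "w X = w A - (- w B)"
      using w_ext[OF AB(3)] by simp
    ultimately show ?thesis
      unfolding G_def using gT[OF AB(1)] gF[OF AB(2)] by force
  qed
  have F'G: "- w X \<in> G" if X: "X \<in> F'" for X
  proof -
    obtain A B where AB: "A \<in> T" "B \<in> F" "ext A X B"
      using seq[of X] X TH by blast
    have H: "A \<in> Heart" "B \<in> Heart"
      using AB TH by blast+
    \<comment> \<open>Dually, A is a subobject of X in F', hence lies in F', and the subtracted
      element is w A.\<close>
    have "hz Y A" if Y: "Y \<in> T'" for Y
    proof -
      have "Y \<in> Heart"
        using Y TH by blast
      then show ?thesis
        using ext_hz_to[OF ext_unrot[OF AB(3)] heart_ob[OF \<open>Y \<in> Heart\<close>] heart_hz_1(2)[OF _ H(2)] hz'[OF Y X]]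
        by blast
    qed
    then have "A \<in> F'"
      using tors_pair_F_iff[OF tp'] H by blast
    then have "- w A \<in> M"
      using gF' sM by blast
    moreover have "- w X = - w B - w A"
      using w_ext[OF AB(3)] by simp
    ultimately show ?thesis
      unfolding G_def using gT[OF AB(1)] gF[OF AB(2)] by blast
  qed
  have "?s' \<subseteq> G"
    unfolding torsion_cone_def[of w T' F']
    by (rule integral_cone_hull_minimal[OF cG]) (use T'G F'G in blast)
  moreover have "?s \<subseteq> G"
    using z(1) sM unfolding G_def by force
  ultimately have "M \<subseteq> G"
    using integral_cone_add[OF cG] unfolding M_def by (auto elim!: set_plus_elim)
  then show ?thesis
    using cM sM unfolding cofaces_iff[OF cs(1)] M_def[symmetric] G_def by blast
qed

lemma cones_of_intermediate_hearts:
  "(\<lambda>K. integral_cone hull (w ` K)) ` intermediate_hearts D Heart = torsion_cones HC w"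
  unfolding intermediate_hearts_eq_tilts torsion_cones_def torsion_pair_in_heart_iff
  using cone_tilt by (auto simp: image_def) blast+

lemma integral_cofan_torsion_cones: "integral_cofan (\<Union>s \<in> torsion_cones HC w. cofaces s)"
proof (rule integral_cofan_cofaces)
  show "integral_cone s" if "s \<in> torsion_cones HC w" for s
    using that integral_cone_hull by (auto simp: torsion_cones_def torsion_cone_def)
  show "s + s' \<in> cofaces s" if "s \<in> torsion_cones HC w" "s' \<in> torsion_cones HC w" for s s'
    using that torsion_cone_sum by (auto simp: torsion_cones_def torsion_pair_in_heart_iff)
qed

lemma complete_torsion_cones:
  assumes "length_cat HC"
  shows "complete_cofan (\<Union>s \<in> torsion_cones HC w. cofaces s)"
  unfolding complete_cofan_def
proof (intro allI impI)
  fix v :: "'a \<Rightarrow> int" assume v: "additive v"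
  \<comment> \<open>The torsion pair is the one attached to v \<circ> w, while the cone below is
    formed from w itself.\<close>
  interpret v: integer_additive D U V "v \<circ> w"
    by unfold_locales (use assms v w_ext in \<open>auto simp: additive.add\<close>)
  let ?s = "torsion_cone w v.Tw v.Fw"
  have cs: "integral_cone ?s"
    unfolding torsion_cone_def by (rule integral_cone_hull)
  have v0: "v 0 = 0" and vm: "\<And>x. v (- x) = - v x" and vp: "\<And>x y. v (x + y) = v x + v y"
    using additive.zero[OF v] additive.minus[OF v] additive.add[OF v] by auto
  have "?s \<subseteq> {x. 0 \<le> v x}"
    unfolding torsion_cone_def
  proof (rule integral_cone_hull_minimal)
    show "integral_cone {x. 0 \<le> v x}"
      using v0 vp by (simp add: integral_cone_def)
    show "w ` v.Tw \<union> uminus ` w ` v.Fw \<subseteq> {x. 0 \<le> v x}"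
      using v.Tw_ge v.Fw_le vm by auto
  qed
  moreover have "?s \<in> torsion_cones HC w"
    using v.Tw_Fw_tors_pair unfolding torsion_cones_def torsion_pair_in_heart_iff by blast
  ultimately show "\<exists>s \<in> \<Union>s \<in> torsion_cones HC w. cofaces s. \<forall>x \<in> s. 0 \<le> v x"
    using coface_self[OF cs] by blast
qed

end

text \<open>A triangle puts X - A - B into the relation subgroup, so X and A + B have the same
  coset. This is the only way in which the Grothendieck group enters.\<close>

lemma (in triangulated_category) K0_class_ext:
  fixes lam :: "('o \<Rightarrow>\<^sub>0 int) set \<Rightarrow> 'l::ab_group_add"
  assumes lam: "lam \<in> hom (K0 D) type_group" and e: "is_ext D A X B"
  shows "lam (K0_class D X) = lam (K0_class D A) + lam (K0_class D B)"
proof -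
  let ?G = "free_Abelian_group (Ob D)" and ?R = "K0_subgroup D"
  interpret G: comm_group ?G
    by (rule abelian_free_Abelian_group)
  have "K0_relations D \<subseteq> carrier ?G"
  proof
    fix x assume "x \<in> K0_relations D"
    then obtain P Y Q f g h where "Tri D P Y Q f g h" and x: "x = frag_of Y - frag_of P - frag_of Q"
      by (auto simp: K0_relations_def)
    then have "P \<in> Ob D" "Y \<in> Ob D" "Q \<in> Ob D"
      using tri_typed by blast+
    then show "x \<in> carrier ?G"
      unfolding x using keys_diff[of "frag_of Y - frag_of P" "frag_of Q"]
        keys_diff[of "frag_of Y" "frag_of P"] by (auto simp: carrier_free_Abelian_group_iff)
  qed
  then have sub: "subgroup ?R ?G" and rel: "K0_relations D \<subseteq> ?R"
    unfolding K0_subgroup_def by (auto intro: G.generate_is_subgroup generate.incl)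
  then interpret R: normal ?R ?G
    by (simp add: G.normal_iff_subgroup)
  obtain f g h where T: "Tri D A X B f g h"
    using e by (auto simp: is_ext_def)
  have car: "frag_of A \<in> carrier ?G" "frag_of X \<in> carrier ?G" "frag_of B \<in> carrier ?G"
    using tri_typed[OF T] by auto
  have "frag_of X - frag_of A - frag_of B \<in> ?R"
    using rel T unfolding K0_relations_def by blast
  then have "(frag_of X - frag_of A - frag_of B) \<otimes>\<^bsub>?G\<^esub> (frag_of A \<otimes>\<^bsub>?G\<^esub> frag_of B)
      \<in> ?R #>\<^bsub>?G\<^esub> (frag_of A \<otimes>\<^bsub>?G\<^esub> frag_of B)"
    using G.rcosI[OF _ R.subset] car G.m_closed by blast
  then have "frag_of X \<in> ?R #>\<^bsub>?G\<^esub> (frag_of A \<otimes>\<^bsub>?G\<^esub> frag_of B)"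
    by simp
  then have "K0_class D X = ?R #>\<^bsub>?G\<^esub> (frag_of A \<otimes>\<^bsub>?G\<^esub> frag_of B)"
    using G.repr_independence[OF _ _ sub] car G.m_closed unfolding K0_class_def by metis
  also have "\<dots> = K0_class D A \<otimes>\<^bsub>K0 D\<^esub> K0_class D B"
    using R.rcos_sum[OF car(1,3)] by (simp add: K0_class_def K0_def FactGroup_def)
  finally have eq: "K0_class D X = K0_class D A \<otimes>\<^bsub>K0 D\<^esub> K0_class D B" .
  have "K0_class D A \<in> carrier (K0 D)" "K0_class D B \<in> carrier (K0 D)"
    using G.rcosetsI[OF R.subset] car by (simp_all add: K0_class_def K0_def FactGroup_def)
  then show ?thesis
    using hom_mult[OF lam] eq by (simp add: type_group_def)
qed

section \<open>Effective cones and the cofans of a heart\<close>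

lemma eff_cone_eq: "eff_cone D lam S = integral_cone hull ((\<lambda>X. lam (K0_class D X)) ` S)"
  by (simp add: eff_cone_def image_def) (metis (no_types, lifting))

lemma bounded_heart_triangle_additive:
  fixes D :: "('o, 'm) tri_cat"
  assumes D: "triangulated_category D" and H: "bounded_heart D H" and lam: "lam \<in> hom (K0 D) type_group"
  obtains U V where "H = U \<inter> V" "triangle_additive D U V (\<lambda>X. lam (K0_class D X))"
proof -
  obtain U V where UV: "bounded_t_structure D U V" "H = U \<inter> V"
    using H by (auto simp: bounded_heart_def)
  have "bounded_t_category D U V"
    using D UV(1) by (intro bounded_t_category.intro bounded_t_category_axioms.intro)
  then have "triangle_additive D U V (\<lambda>X. lam (K0_class D X))"
    using triangulated_category.K0_class_ext[OF D lam]
    by (intro triangle_additive.intro triangle_additive_axioms.intro)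
  then show ?thesis
    using that UV by blast
qed

lemma cones_of_hearts_eq:
  fixes D :: "('o, 'm) tri_cat"
  assumes "triangulated_category D" "bounded_heart D H" "lam \<in> hom (K0 D) type_group"
  shows "eff_cone D lam ` intermediate_hearts D H =
    torsion_cones (D\<lparr>Ob := H\<rparr>) (\<lambda>X. lam (K0_class D X))"
proof -
  obtain U V where H: "H = U \<inter> V" and "triangle_additive D U V (\<lambda>X. lam (K0_class D X))"
    using bounded_heart_triangle_additive[OF assms] .
  then interpret triangle_additive D U V "\<lambda>X. lam (K0_class D X)"
    by simp
  show ?thesis
    using cones_of_intermediate_hearts by (simp add: eff_cone_eq H)
qed

text \<open>The intrinsic description from which the cofan property, independence of D and
  completeness are read off.\<close>

lemma heart_cofan_eq:
  fixes D :: "('o, 'm) tri_cat"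
  assumes "triangulated_category D" "bounded_heart D H" "lam \<in> hom (K0 D) type_group"
  shows "heart_cofan D lam H =
    (\<Union>s \<in> torsion_cones (D\<lparr>Ob := H\<rparr>) (\<lambda>X. lam (K0_class D X)). cofaces s)"
  unfolding heart_cofan_def cones_of_hearts_eq[OF assms, symmetric] by simp

text \<open>Being the heart of two categories with the same class map is expressed by an additive
  equivalence under which \<open>lam\<close> and \<open>lam'\<close> agree on objects. The
  invariance of classes under isomorphism that \<open>torsion_cones_eq\<close> asks for comes from
  triangles, through \<open>w_iso\<close>.\<close>

lemma heart_cofan_invariant:
  fixes D :: "('o, 'm) tri_cat" and D' :: "('p, 'n) tri_cat"
    and lam :: "('o \<Rightarrow>\<^sub>0 int) set \<Rightarrow> 'l::ab_group_add"
  assumes D: "triangulated_category D" "bounded_heart D H" "lam \<in> hom (K0 D) type_group"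
    and D': "triangulated_category D'" "bounded_heart D' H'" "lam' \<in> hom (K0 D') type_group"
    and F: "additive_equivalence (D\<lparr>Ob := H\<rparr>) (D'\<lparr>Ob := H'\<rparr>) Fo Fm"
    and eq: "\<forall>X \<in> H. lam' (K0_class D' (Fo X)) = lam (K0_class D X)"
  shows "heart_cofan D' lam' H' = heart_cofan D lam H"
proof -
  obtain U V where H: "H = U \<inter> V" and 1: "triangle_additive D U V (\<lambda>X. lam (K0_class D X))"
    using bounded_heart_triangle_additive[OF D] .
  obtain U' V' where H': "H' = U' \<inter> V'" and 2: "triangle_additive D' U' V' (\<lambda>X. lam' (K0_class D' X))"
    using bounded_heart_triangle_additive[OF D'] .
  interpret i1: triangle_additive D U V "\<lambda>X. lam (K0_class D X)" by (rule 1)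
  interpret i2: triangle_additive D' U' V' "\<lambda>X. lam' (K0_class D' X)" by (rule 2)
  interpret additive_equiv "D\<lparr>Ob := H\<rparr>" "D'\<lparr>Ob := H'\<rparr>" Fo Fm
    unfolding H H'
    by (intro additive_equiv.intro additive_equiv_axioms.intro i1.heart.preadditive_category_axioms
        i2.heart.preadditive_category_axioms F[unfolded H H'])
  have "torsion_cones (D'\<lparr>Ob := H'\<rparr>) (\<lambda>X. lam' (K0_class D' X)) =
      torsion_cones (D\<lparr>Ob := H\<rparr>) (\<lambda>X. lam (K0_class D X))"
  proof (rule torsion_cones_eq)
    show "lam' (K0_class D' (Fo X)) = lam (K0_class D X)" if "X \<in> Ob (D\<lparr>Ob := H\<rparr>)" for X
      using eq that by simp
    show "lam' (K0_class D' Y) = lam' (K0_class D' Z)"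
      if "Y \<in> Ob (D'\<lparr>Ob := H'\<rparr>)" "Z \<in> Ob (D'\<lparr>Ob := H'\<rparr>)" "isomorphic_in (D'\<lparr>Ob := H'\<rparr>) Y Z" for Y Z
    proof -
      have "Y \<in> Ob D'" "Z \<in> Ob D'"
        using that i2.heart_ob H' by auto
      moreover have "isomorphic_in D' Y Z"
        using that(3) by (simp add: isomorphic_in_def iso_arrow_def)
      ultimately show ?thesis
        by (rule i2.w_iso)
    qed
  qed
  then show ?thesis
    unfolding heart_cofan_eq[OF D] heart_cofan_eq[OF D'] by simp
qed

text \<open>Every coface is obtained by subtracting a face, and by \<open>face_generated\<close>
  that face is the effective cone of its face subcategory.\<close>

lemma heart_cofan_faces:
  fixes D :: "('o, 'm) tri_cat"
  shows "heart_cofan D lam H = {eff_cone D lam K \<ominus>\<^sub>M eff_cone D lam S | K S.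
    K \<in> intermediate_hearts D H \<and> face_subcategory D lam K S}"
proof -
  have S: "eff_cone D lam {X \<in> K. lam (K0_class D X) \<in> t} = t" if "cone_face t (eff_cone D lam K)" for K t
    using that face_generated[of t "\<lambda>X. lam (K0_class D X)" K] by (simp add: eff_cone_eq)
  have "cofaces (eff_cone D lam K) =
      {eff_cone D lam K \<ominus>\<^sub>M eff_cone D lam S | S. face_subcategory D lam K S}" for K
  proof -
    have "integral_cone (eff_cone D lam K)"
      unfolding eff_cone_def by (rule integral_cone_hull)
    then have "cofaces (eff_cone D lam K) =
        {eff_cone D lam K \<ominus>\<^sub>M t | t. cone_face t (eff_cone D lam K)}"
      by (rule cofaces_eq_faces)
    also have "\<dots> = {eff_cone D lam K \<ominus>\<^sub>M eff_cone D lam {X \<in> K. lam (K0_class D X) \<in> t} | t.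
        cone_face t (eff_cone D lam K)}"
      by (intro Collect_cong ex_cong1) (auto simp: S)
    also have "\<dots> = {eff_cone D lam K \<ominus>\<^sub>M eff_cone D lam S | S. face_subcategory D lam K S}"
      unfolding face_subcategory_def by blast
    finally show ?thesis .
  qed
  then show ?thesis
    unfolding heart_cofan_def by blast
qed

lemma heart_cofan_real_eq:
  fixes D :: "('o, 'm) tri_cat" and lam :: "('o \<Rightarrow>\<^sub>0 int) set \<Rightarrow> 'a::ab_group_add"
  shows "heart_cofan_real D lam H = realification (heart_cofan D lam H)"
proof -
  have "conv (eff_cone D lam K \<ominus>\<^sub>M eff_cone D lam S) =
      eff_cone_real D lam K \<ominus>\<^sub>M eff_cone_real D lam S" for K S
    unfolding eff_cone_real_def eff_cone_def
    by (rule conv_minkowski_diff[OF integral_cone_hull integral_cone_hull])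
  then have "heart_cofan_real D lam H = {conv (eff_cone D lam K \<ominus>\<^sub>M eff_cone D lam S) | K S.
      K \<in> intermediate_hearts D H \<and> face_subcategory D lam K S}"
    by (simp add: heart_cofan_real_def)
  moreover have "{conv (d K S) | K S. P K S} = conv ` {d K S | K S. P K S}"
    for d :: "'o set \<Rightarrow> 'o set \<Rightarrow> 'a set" and P
    by blast
  ultimately show ?thesis
    unfolding heart_cofan_faces realification_def by simp
qed

theorem mainTheorem5:
  fixes D :: "('o, 'm) tri_cat"
    and H :: "'o set"
    and lam :: "('o \<Rightarrow>\<^sub>0 int) set \<Rightarrow> 'l::ab_group_add"
  assumes "triangulated_category D"
    and "bounded_heart D H"
    and "free_of_finite_rank TYPE('l)"
    and "lam \<in> hom (K0 D) type_group"
  shows "heart_cofan D lam H =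
           {eff_cone D lam K \<ominus>\<^sub>M eff_cone D lam S | K S.
              K \<in> intermediate_hearts D H \<and> face_subcategory D lam K S} \<and>
    integral_cofan (heart_cofan D lam H) \<and>
    (\<forall>(D' :: ('p, 'n) tri_cat) H' lam' Fo Fm.
           triangulated_category D' \<and> bounded_heart D' H' \<and> lam' \<in> hom (K0 D') type_group \<and>
           additive_equivalence (D\<lparr>Ob := H\<rparr>) (D'\<lparr>Ob := H'\<rparr>) Fo Fm \<and>
           (\<forall>X \<in> H. lam' (K0_class D' (Fo X)) = lam (K0_class D X)) \<longrightarrow>
         heart_cofan D' lam' H' = heart_cofan D lam H) \<and>
    (length_cat (D\<lparr>Ob := H\<rparr>) \<longrightarrow> complete_cofan (heart_cofan D lam H)) \<and>
    real_cofan (heart_cofan_real D lam H) \<and>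
    heart_cofan_real D lam H = realification (heart_cofan D lam H)"
proof (intro conjI allI impI)
  obtain U V where H: "H = U \<inter> V" and "triangle_additive D U V (\<lambda>X. lam (K0_class D X))"
    using bounded_heart_triangle_additive[OF assms(1,2,4)] .
  then interpret triangle_additive D U V "\<lambda>X. lam (K0_class D X)"
    by simp
  note eq = heart_cofan_eq[OF assms(1,2,4)]
  show "heart_cofan D lam H = {eff_cone D lam K \<ominus>\<^sub>M eff_cone D lam S | K S.
      K \<in> intermediate_hearts D H \<and> face_subcategory D lam K S}"
    by (rule heart_cofan_faces)
  show cofan: "integral_cofan (heart_cofan D lam H)"
    unfolding eq using integral_cofan_torsion_cones unfolding H .
  show "complete_cofan (heart_cofan D lam H)" if "length_cat (D\<lparr>Ob := H\<rparr>)"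
    unfolding eq using complete_torsion_cones that by (simp add: H)
  show real: "heart_cofan_real D lam H = realification (heart_cofan D lam H)"
    by (rule heart_cofan_real_eq)
  show "real_cofan (heart_cofan_real D lam H)"
    unfolding real by (rule real_cofan_realification[OF cofan])
next
  fix D' :: "('p, 'n) tri_cat" and H' lam' Fo Fm
  assume "triangulated_category D' \<and> bounded_heart D' H' \<and> lam' \<in> hom (K0 D') type_group \<and>
    additive_equivalence (D\<lparr>Ob := H\<rparr>) (D'\<lparr>Ob := H'\<rparr>) Fo Fm \<and>
    (\<forall>X \<in> H. lam' (K0_class D' (Fo X)) = lam (K0_class D X))"
  then show "heart_cofan D' lam' H' = heart_cofan D lam H"
    using heart_cofan_invariant[OF assms(1,2,4)] by blast
qed

end
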